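(* Let $\mathcal S=(a_i)_{i\ge1}$ be an infinite sequence of elementary foldings that is periodic with even period $k$ ($k$ even, $a_{i+k}=a_i$ for all $i$), and let $M_{\mathcal S}$ be the substitution matrix of $G=F_{a_1}\circ\dots\circ F_{a_k}$. Then $M_{\mathcal S}$ has eigenvalues (with algebraic multiplicity) $4^k,2^k,2^k,2^k,1,1,0,0$. Moreover: (i) $4^k$ is the Perron–Frobenius eigenvalue of $M_{\mathcal S}$ with eigenvector $(1,1,1,1,1,1,1,1)^t$, so all eight types of unit triangles have density $\frac18$ in $P_{\mathcal S}$; (ii) the eigenspace for eigenvalue $1$ is spanned by $(0,1,-2,1,0,0,0,0)^t$ and $(0,0,0,0,0,1,-2,1)^t$ if $a_1=+$, and by $(1,-2,1,0,0,0,0,0)^t$ and $(0,0,0,0,1,-2,1,0)^t$ if $a_1=-$; (iii) the eigenspace for eigenvalue $0$ is spanned by $(1,-3,3,-1,0,0,0,0)^t$ and $(0,0,0,0,1,-3,3,-1)^t$; (iv) the eigenspace for eigenvalue $2^k$ has dimension $2$ or $3$.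
   Context: Grid: let $\xi_1=(0,-2\sqrt3)$ and let $\xi_2,\xi_3$ be its counterclockwise rotations by $2\pi/3$ and $4\pi/3$. For $i\in\{1,2,3\}$, $n\in\mathbb Z$ put $\ell_{i,n}=\{x\in\mathbb R^2:(x,\xi_i)=3n+1\}$. The union $\mathcal L$ of these lines is a triangular grid whose smallest triangles (unit triangles) are regular of side $1$; unit edges are their sides. A triangle is positive if its vertex opposite its horizontal side lies above that side, negative otherwise. $O$ is the origin, $T_0$ the positive unit triangle centered at $O$, $\lambda T_0$ its image under the homothety with center $O$, ratio $\lambda$. Folding patterns: an elementary folding folds a paper regular triangle of side $2a$ along its three midsegments onto its central triangle of side $a$; it is a folding up ($+$) if all three folds go through the upper half-space of $\mathbb R^3$, a folding down ($-$) if all go through the lower half-space; when unfolded, fold lines of a folding up become valleys, those of a folding down peaks. For a finite sequence $(a_1,\dots,a_m)$ take the paper triangle $(-2)^mT_0$, perform $a_m$ first (onto $(-2)^{m-1}T_0$), …, finally $a_1$ (onto $T_0$), unfold, and color valleys red and peaks blue. For infinite $\mathcal S$, $P_{\mathcal S}$ colors every unit edge of $\mathcal L$ by its color in the pattern of $(a_1,\dots,a_m)$ for any $m$ with the edge interior to $(-2)^mT_0$. Substitutions: an edge-colored triangle is a regular triangle $\Delta$ of integer side, subdivided into unit triangles, with each unit edge colored red or blue. $F_\epsilon$ ($\epsilon=\pm$) maps it to $2\Delta$ (homothety of ratio $2$ about the center of $\Delta$), each unit triangle $\tau$ becoming $2\tau$ subdivided into four unit triangles; each unit edge $e$ of $\Delta$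 becomes two unit edges both colored opposite to $e$; the three interior edges of $2\tau$ are colored, for $F_+$, blue if $\tau$ is positive and red if negative, and for $F_-$, red if $\tau$ positive and blue if negative. Types: unit triangles are of eight types, ordered as: types $1,2,3,4$ are positive with $3,2,1,0$ red sides respectively; types $5,6,7,8$ are negative with $0,1,2,3$ red sides respectively. The substitution matrix of a substitution $G$ is the $8\times8$ matrix whose $(i,j)$ entry is the number of unit triangles of type $i$ in $G(\tau_j)$, for $\tau_j$ a unit triangle of type $j$ (this does not depend on the choice of $\tau_j$). Density of a type in $P_{\mathcal S}$: the limit as $R\to\infty$ of the proportion of unit triangles of that type among all unit triangles contained in the ball of radius $R$ centered at $O$. *)

theory Defs
  imports
    "HOL-Analysis.Analysis"
    "Jordan_Normal_Form.Char_Poly"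
    "Jordan_Normal_Form.Matrix_Kernel"
begin

text \<open>The plane is \<^typ>\<open>complex\<close> with its real inner product. Unit edges and unit triangles are
  represented by their sets of end points and of vertices; the corresponding segments and regions
  are the convex hulls.\<close>

datatype color = Red | Blue

fun opposite :: "color \<Rightarrow> color" where
  "opposite Red = Blue"
| "opposite Blue = Red"

datatype folding = Up | Down


subsection \<open>The grid\<close>

definition xi :: "nat \<Rightarrow> complex" where
  "xi i = cis (2 * pi * (real i - 1) / 3) * Complex 0 (- 2 * sqrt 3)"

definition grid_line :: "nat \<Rightarrow> int \<Rightarrow> complex set" where
  "grid_line i n = {x. inner x (xi i) = 3 * real_of_int n + 1}"

definition grid_vertices :: "complex set" where
  "grid_vertices = {x. \<exists>i\<in>{1,2,3}. \<exists>j\<in>{1,2,3}. \<exists>m n. i \<noteq> j \<and> x \<in> grid_line i m \<and> x \<in> grid_line j n}"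

text \<open>Below, \<open>V\<close> is the vertex set of a triangular grid of mesh 1 (the whole plane grid or a
  subdivided triangle), in which vertices at distance 1 are exactly the neighbours.\<close>

definition unit_edges :: "complex set \<Rightarrow> complex set set" where
  "unit_edges V = {{u, v} | u v. u \<in> V \<and> v \<in> V \<and> dist u v = 1}"

definition unit_triangles :: "complex set \<Rightarrow> complex set set" where
  "unit_triangles V = {{u, v, w} | u v w. u \<in> V \<and> v \<in> V \<and> w \<in> V \<and>
     dist u v = 1 \<and> dist v w = 1 \<and> dist u w = 1}"

definition sides :: "complex set \<Rightarrow> complex set set" where
  "sides t = {e. e \<subseteq> t \<and> card e = 2}"

definition positive :: "complex set \<Rightarrow> bool" where
  "positive t \<longleftrightarrow> (\<exists>u v w. t = {u, v, w} \<and> u \<noteq> v \<and> Im u = Im v \<and> Im w > Im u)"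

definition red_sides :: "(complex set \<Rightarrow> color) \<Rightarrow> complex set \<Rightarrow> nat" where
  "red_sides c t = card {e \<in> sides t. c e = Red}"

definition triangle_type :: "(complex set \<Rightarrow> color) \<Rightarrow> complex set \<Rightarrow> nat" where
  "triangle_type c t = (if positive t then 4 - red_sides c t else 5 + red_sides c t)"

text \<open>The triangle bounded by the three lines \<open>grid_line i 0\<close>; its vertices are \<open>- xi i / 6\<close>.\<close>

definition T0 :: "complex set" where
  "T0 = {x. \<forall>i\<in>{1,2,3}. inner x (xi i) \<le> 1}"

definition scaled_T0 :: "real \<Rightarrow> complex set" where
  "scaled_T0 r = (\<lambda>x. r *\<^sub>R x) ` T0"


subsection \<open>Folding patterns\<close>

text \<open>Folding \<open>scaled_T0 ((-2) ^ Suc m)\<close> onto its central triangle \<open>scaled_T0 c\<close>, where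
  \<open>c = (-2) ^ m\<close>: the fold lines are the lines \<open>inner x (xi i) = c\<close>, and the corner beyond the
  \<open>i\<close>-th fold line (open, disjoint for distinct \<open>i\<close>) is reflected in that line. Division by \<open>c\<close>
  accounts for the sign of \<open>c\<close>.\<close>

definition on_fold_line :: "real \<Rightarrow> complex \<Rightarrow> bool" where
  "on_fold_line c x \<longleftrightarrow> (\<exists>i\<in>{1,2,3}. inner x (xi i) = c)"

definition in_corner :: "real \<Rightarrow> nat \<Rightarrow> complex \<Rightarrow> bool" where
  "in_corner c i x \<longleftrightarrow> inner x (xi i) / c > 1"

definition reflect :: "real \<Rightarrow> nat \<Rightarrow> complex \<Rightarrow> complex" where
  "reflect c i x = x - (2 * (inner x (xi i) - c) / inner (xi i) (xi i)) *\<^sub>R xi i"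

definition turned_over :: "real \<Rightarrow> complex \<Rightarrow> bool" where
  "turned_over c x \<longleftrightarrow> (\<exists>i\<in>{1,2,3}. in_corner c i x)"

definition fold_point :: "real \<Rightarrow> complex \<Rightarrow> complex" where
  "fold_point c x =
     (if turned_over c x then reflect c (SOME i. i \<in> {1,2,3} \<and> in_corner c i x) x else x)"

text \<open>\<open>crease_color a m up x\<close> is the color of the crease through a point of the paper that, when the
  foldings \<open>a m, \<dots>, a 1\<close> remain to be performed, lies at position \<open>x\<close> of \<open>scaled_T0 ((-2) ^ m)\<close>
  in a layer whose upper side is still facing up iff \<open>up\<close> holds. All layers are folded together, so
  in a layer lying face down a folding up leaves a peak and a folding down a valley. Once a point
  lies on a fold line it stays on the boundary of the folded paper. For \<open>m = 0\<close> the point lies on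
  no crease and the value is irrelevant.\<close>

fun crease_color :: "(nat \<Rightarrow> folding) \<Rightarrow> nat \<Rightarrow> bool \<Rightarrow> complex \<Rightarrow> color" where
  "crease_color a 0 up x = undefined"
| "crease_color a (Suc m) up x =
     (let c = (-2) ^ m in
      if on_fold_line c x
      then (if (a (Suc m) = Up) = up then Red else Blue)
      else crease_color a m (up \<noteq> turned_over c x) (fold_point c x))"

text \<open>Creases are unions of unit edges, so the color of a unit edge can be read off at its
  midpoint.\<close>

definition finite_pattern :: "(nat \<Rightarrow> folding) \<Rightarrow> nat \<Rightarrow> complex set \<Rightarrow> color" where
  "finite_pattern a m e = crease_color a m True ((\<Sum>x\<in>e. x) / 2)"

definition interior_edge :: "nat \<Rightarrow> complex set \<Rightarrow> bool" where
  "interior_edge m e \<longleftrightarrow> rel_interior (convex hull e) \<subseteq> interior (scaled_T0 ((-2) ^ m))"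

text \<open>The pattern of an infinite sequence \<open>a 1, a 2, \<dots>\<close> (the value \<open>a 0\<close> is not used). The choice
  of \<open>m\<close> is immaterial, see \<open>folding_pattern_eq\<close> below.\<close>

definition folding_pattern :: "(nat \<Rightarrow> folding) \<Rightarrow> complex set \<Rightarrow> color" where
  "folding_pattern a e = finite_pattern a (SOME m. interior_edge m e) e"

definition has_type_density :: "(complex set \<Rightarrow> color) \<Rightarrow> nat \<Rightarrow> real \<Rightarrow> bool" where
  "has_type_density c i d \<longleftrightarrow>
     ((\<lambda>R. real (card {t \<in> unit_triangles grid_vertices.
                        convex hull t \<subseteq> cball 0 R \<and> triangle_type c t = i})
           / real (card {t \<in> unit_triangles grid_vertices. convex hull t \<subseteq> cball 0 R}))
       \<longlongrightarrow> d) at_top"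


subsection \<open>Substitutions on edge-colored triangles\<close>

text \<open>The edge-colored triangle \<open>Colored_Triangle p n c\<close> with \<open>n \<noteq> 0\<close> has center \<open>p\<close> and region
  \<open>p + n T0\<close>: it has side \<open>\<bar>n\<bar>\<close> and is positive iff \<open>n > 0\<close>. Only the values of \<open>c\<close> on the unit
  edges of its subdivision matter.\<close>

datatype colored_triangle =
  Colored_Triangle (center: complex) (ratio: int) (coloring: "complex set \<Rightarrow> color")

text \<open>The vertices of the subdivision, in barycentric coordinates with respect to the corners
  \<open>p - n xi i / 6\<close>.\<close>

definition subdivision_vertices :: "colored_triangle \<Rightarrow> complex set" where
  "subdivision_vertices X =
     {center X - (sgn (real_of_int (ratio X)) / 6) *\<^sub>R
        (real i *\<^sub>R xi 1 + real j *\<^sub>R xi 2 + real k *\<^sub>R xi 3)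
      | i j k :: nat. int (i + j + k) = \<bar>ratio X\<bar>}"

definition halves :: "complex set \<Rightarrow> complex set set" where
  "halves e = {{u, midpoint u v} | u v. e = {u, v} \<and> u \<noteq> v}"

definition midsegments :: "complex set \<Rightarrow> complex set set" where
  "midsegments t = {{midpoint u v, midpoint u w} | u v w. t = {u, v, w} \<and> card {u, v, w} = 3}"

fun inner_color :: "folding \<Rightarrow> bool \<Rightarrow> color" where
  "inner_color Up True = Blue"
| "inner_color Up False = Red"
| "inner_color Down True = Red"
| "inner_color Down False = Blue"

definition subst_F_coloring :: "folding \<Rightarrow> colored_triangle \<Rightarrow> complex set \<Rightarrow> color" where
  "subst_F_coloring s X e' =
     (let V = subdivision_vertices X;
          h = (\<lambda>x. center X + 2 *\<^sub>R (x - center X))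
      in if \<exists>e\<in>unit_edges V. e' \<in> halves (h ` e)
         then opposite (coloring X (THE e. e \<in> unit_edges V \<and> e' \<in> halves (h ` e)))
         else inner_color s (positive (THE t. t \<in> unit_triangles V \<and> e' \<in> midsegments (h ` t))))"

definition subst_F :: "folding \<Rightarrow> colored_triangle \<Rightarrow> colored_triangle" where
  "subst_F s X = Colored_Triangle (center X) (2 * ratio X) (subst_F_coloring s X)"

text \<open>The composition of \<open>subst_F (a 1), \<dots>, subst_F (a k)\<close>; the last one is applied first.\<close>

definition subst_comp :: "(nat \<Rightarrow> folding) \<Rightarrow> nat \<Rightarrow> colored_triangle \<Rightarrow> colored_triangle" where
  "subst_comp a k = foldr (\<circ>) (map (\<lambda>i. subst_F (a i)) [1..<Suc k]) id"

definition unit_triangle_of_type :: "nat \<Rightarrow> colored_triangle \<Rightarrow> bool" where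
  "unit_triangle_of_type j X \<longleftrightarrow>
     \<bar>ratio X\<bar> = 1 \<and> triangle_type (coloring X) (subdivision_vertices X) = j"

definition type_count :: "nat \<Rightarrow> colored_triangle \<Rightarrow> nat" where
  "type_count i X =
     card {t \<in> unit_triangles (subdivision_vertices X). triangle_type (coloring X) t = i}"

text \<open>Matrix indices start at 0, so row and column \<open>i\<close> belong to type \<open>Suc i\<close>.\<close>

definition substitution_matrix :: "(colored_triangle \<Rightarrow> colored_triangle) \<Rightarrow> real mat" where
  "substitution_matrix G =
     mat 8 8 (\<lambda>(i, j). real (type_count (Suc i) (G (SOME X. unit_triangle_of_type (Suc j) X))))"


subsection \<open>Linear algebra\<close>

definition eigenspace :: "real mat \<Rightarrow> real \<Rightarrow> real vec set" where
  "eigenspace A r = mat_kernel (char_matrix A r)"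

definition eigenspace_dim :: "real mat \<Rightarrow> real \<Rightarrow> nat" where
  "eigenspace_dim A r = kernel_dim (char_matrix A r)"

definition vec_span :: "nat \<Rightarrow> real vec set \<Rightarrow> real vec set" where
  "vec_span n S = LinearCombinations.module.span class_ring (module_vec TYPE(real) n) S"

text \<open>The eigenvalue singled out by the Perron--Frobenius theorem for primitive matrices: simple, with a
  positive eigenvector, and strictly larger in modulus than all other complex eigenvalues.\<close>

definition perron_frobenius_eigenvalue :: "real mat \<Rightarrow> real \<Rightarrow> bool" where
  "perron_frobenius_eigenvalue A r \<longleftrightarrow>
     square_mat A \<and> (\<forall>i<dim_row A. \<forall>j<dim_col A. 0 \<le> A $$ (i, j)) \<and>
     0 < r \<and> Polynomial.order r (char_poly A) = 1 \<and>
     (\<exists>v. eigenvector A v r \<and> (\<forall>i<dim_row A. 0 < vec_index v i)) \<and>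
     (\<forall>z. eigenvalue (map_mat complex_of_real A) z \<and> z \<noteq> complex_of_real r \<longrightarrow> cmod z < r)"


subsection \<open>The infinite pattern is well defined\<close>

lemma scaled_T0_eq:
  assumes "r \<noteq> 0"
  shows "scaled_T0 r = {x. \<forall>i\<in>{1,2,3}. inner x (xi i) / r \<le> 1}"
proof -
  have "x \<in> scaled_T0 r" if "\<forall>i\<in>{1,2,3}. inner x (xi i) / r \<le> 1" for x
  proof -
    have "x = r *\<^sub>R (inverse r *\<^sub>R x)" using assms by simp
    moreover have "inverse r *\<^sub>R x \<in> T0"
      using that by (auto simp: T0_def divide_inverse mult.commute)
    ultimately show ?thesis unfolding scaled_T0_def by blast
  qed
  then show ?thesis using assms by (auto simp: scaled_T0_def T0_def)
qed


lemma xi_nonzero: "xi i \<noteq> 0"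
  by (simp add: xi_def Complex_eq_0)

lemma xi_sum: "xi 1 + xi 2 + xi 3 = 0"
proof -
  let ?w = "Complex (- 1 / 2) (sqrt 3 / 2)"
  have w: "cis (2 * pi / 3) = ?w"
    by (simp add: cis.ctr cos_120 sin_120)
  have "cis (4 * pi / 3) = cis (2 * pi / 3) * cis (2 * pi / 3)"
    unfolding cis_mult by (rule arg_cong [where f = cis]) simp
  then have w2: "cis (4 * pi / 3) = ?w * ?w"
    unfolding w .
  have "xi 1 = Complex 0 (- 2 * sqrt 3)"
    by (simp add: xi_def)
  moreover have "xi 2 = ?w * Complex 0 (- 2 * sqrt 3)"
    unfolding w [symmetric] by (simp add: xi_def)
  moreover have "xi 3 = ?w * ?w * Complex 0 (- 2 * sqrt 3)"
    unfolding w2 [symmetric] by (simp add: xi_def)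
  ultimately have "xi 1 + xi 2 + xi 3 = (1 + ?w + ?w * ?w) * Complex 0 (- 2 * sqrt 3)"
    by (simp only: distrib_right mult_1)
  also have "1 + ?w + ?w * ?w = 0"
    by (simp add: complex_eq_iff)
  finally show ?thesis by simp
qed

lemma interior_edge_midpoint:
  assumes "interior_edge m {u, v}" and "i \<in> {1,2,3}" and that: "u \<noteq> v"
  shows "inner ((\<Sum>x\<in>{u, v}. x) / 2) (xi i) / (-2) ^ m < 1"
proof -
  let ?x = "midpoint u v"
  have x: "(\<Sum>x\<in>{u, v}. x) / 2 = ?x"
    using that by (simp add: midpoint_def scaleR_conv_of_real field_simps)
  have "?x \<in> rel_interior (convex hull {u, v})"
    using that by (simp add: segment_convex_hull [symmetric] rel_interior_closed_segment
        midpoint_in_open_segment)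
  then have "?x \<in> interior (scaled_T0 ((-2) ^ m))"
    using assms(1) by (auto simp: interior_edge_def)
  also have "\<dots> \<subseteq> interior {y. inner (xi i /\<^sub>R (-2) ^ m) y \<le> 1}"
    by (rule interior_mono)
      (use assms(2) in \<open>auto simp: scaled_T0_eq divide_inverse inner_commute mult.commute\<close>)
  also have "\<dots> = {y. inner (xi i /\<^sub>R (-2) ^ m) y < 1}"
    by (rule interior_halfspace_le) (simp add: xi_nonzero)
  finally show ?thesis
    unfolding x by (simp add: divide_inverse inner_commute mult.commute)
qed

lemma crease_color_stable:
  assumes "\<forall>i\<in>{1,2,3}. inner x (xi i) / (-2) ^ m < 1"
  shows "(\<forall>i\<in>{1,2,3}. inner x (xi i) / (-2) ^ (m + n) < 1) \<and>
    crease_color a (m + n) True x = crease_color a m True x"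
proof (induction n)
  case 0
  then show ?case using assms by simp
next
  case (Suc n)
  let ?c = "(-2) ^ (m + n) :: real"
  have lt: "inner x (xi 1) / ?c < 1" "inner x (xi 2) / ?c < 1" "inner x (xi 3) / ?c < 1"
    using Suc by auto
  have "inner x (xi 1) + inner x (xi 2) + inner x (xi 3) = 0"
    by (metis inner_add_right inner_zero_right xi_sum)
  then have "inner x (xi 1) / ?c + inner x (xi 2) / ?c + inner x (xi 3) / ?c = 0"
    by (metis add_divide_distrib div_0)
  then have "inner x (xi 1) / ?c > -2" "inner x (xi 2) / ?c > -2" "inner x (xi 3) / ?c > -2"
    using lt by linarith+
  then have "\<forall>i\<in>{1,2,3}. inner x (xi i) / (-2) ^ (m + Suc n) < 1"
    by auto
  moreover have "\<not> turned_over ?c x"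
    using lt by (auto simp: turned_over_def in_corner_def)
  moreover have "\<not> on_fold_line ?c x"
    using lt by (auto simp: on_fold_line_def)
  ultimately show ?case
    using Suc by (auto simp: fold_point_def Let_def)
qed

lemma folding_pattern_eq:
  assumes "interior_edge m e" and "e \<in> unit_edges V"
  shows "folding_pattern a e = finite_pattern a m e"
proof -
  obtain u v where e: "e = {u, v}" and "dist u v = 1"
    using assms(2) by (auto simp: unit_edges_def)
  then have "u \<noteq> v" by auto
  define m' where "m' = (SOME m. interior_edge m e)"
  have "interior_edge m' e"
    unfolding m'_def by (rule someI [of "\<lambda>m. interior_edge m e", OF assms(1)])
  define x where "x = (\<Sum>x\<in>e. x) / 2"
  have stable: "crease_color a (p + q) True x = crease_color a p True x" if "interior_edge p e" for p q
  proof -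
    have "\<forall>i\<in>{1,2,3}. inner x (xi i) / (-2) ^ p < 1"
      using interior_edge_midpoint [OF that [unfolded e] _ \<open>u \<noteq> v\<close>] unfolding x_def e by (rule ballI)
    from crease_color_stable [OF this] show ?thesis by (rule conjunct2)
  qed
  have "crease_color a m' True x = crease_color a m True x"
    using stable [OF \<open>interior_edge m' e\<close>, of m] stable [OF assms(1), of m'] by (simp add: add.commute)
  then show ?thesis
    by (simp add: folding_pattern_def finite_pattern_def x_def m'_def)
qed

end

theory Submission
  imports Defs "Jordan_Normal_Form.Jordan_Normal_Form_Uniqueness"
begin

text \<open>Count triangles not by type but by the moments of their colors: with spin \<open>1\<close> for red and \<open>-1\<close> for
  blue, take the elementary symmetric polynomials of the three spins, separately for the positive
  and the negative triangles. If a triangle has spins \<open>x, y, z\<close>, the substitution puts the same spin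
  \<open>c\<close> on its interior edges, so its corner triangles have spins \<open>(-x, -y, c)\<close>, \<open>(-x, c, -z)\<close>, \<open>(c, -y, -z)\<close>
  and its middle triangle has spins \<open>(c, c, c)\<close>. Hence the moments transform triangularly, with diagonal
  \<open>0, 0, 1, 1, -2, -2, 2, 4\<close>, in the same basis for both substitutions, and all statements about the
  substitution matrix can be read off the triangular form of the product.

  A crease is made by the folding \<open>a (Suc n)\<close> iff it lies on the grid \<open>(-2) ^ n L\<close> but not on
  \<open>(-2) ^ Suc n L\<close>, and until then it is turned over an even number of times iff the triangle of
  \<open>(-2) ^ Suc n L\<close> containing it has the orientation of the central one, since each reflection reverses
  the orientation. So the pattern of \<open>a\<close> arises from the pattern of \<open>i \<mapsto> a (i + 2)\<close> by the
  substitutions of \<open>a 2\<close> and \<open>a 1\<close>. All moments except the total number of triangles grow at most like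
  \<open>3 ^ k\<close> under \<open>k\<close> substitutions, and a disc of radius \<open>R\<close> is filled by supertriangles of a fixed size up
  to \<open>O(R)\<close> triangles, so the types are equidistributed.\<close>

subsection \<open>Coordinates on the triangular grid\<close>

text \<open>A corner triangle keeps two sides of its parent, with negated spins, and receives one
  interior edge. So a product of d spins of the parent reappears, with sign (-1)^d, in exactly the 3
  - d corners that contain those d sides. This is the origin of the diagonal entries 0, 1, -2 for d
  = 3, 2, 1, once for each orientation because corners keep the orientation of the parent. For d = 0
  the middle triangle counts as well; its orientation is opposite, so the number of triangles is
  multiplied by 3 + 1 and the excess of positive over negative ones by 3 - 1. For even k the powers
  of -2 and of 2 coincide, and the resulting triple eigenvalue can be defective only through the one
  coefficient coupling the excess to the moments of degree one; hence dimension 2 or 3. The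
  homothety of ratio -2 reverses orientations, and its center is not a vertex of the grid. Therefore
  the pattern is compared with itself two foldings at a time, at the positive ratio 4, and index
  shifts are unavoidable.\<close>

definition omega :: complex where
  "omega = Complex (1 / 2) (sqrt 3 / 2)"

text \<open>The flag \<open>g\<close> distinguishes the upright frame from the one rotated by \<open>\<pi>\<close>, so that a negative
  triangle of integer side looks in its own frame like a positive one.\<close>

definition pt :: "complex \<Rightarrow> bool \<Rightarrow> int \<Rightarrow> int \<Rightarrow> complex" where
  "pt z g i j = z + (if g then 1 else -1) * (of_int i + of_int j * omega)"

datatype dir = Hor | Wst | Dia

fun edge :: "complex \<Rightarrow> bool \<Rightarrow> dir \<Rightarrow> int \<Rightarrow> int \<Rightarrow> complex set" where
  "edge z g Hor i j = {pt z g i j, pt z g (i + 1) j}"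
| "edge z g Wst i j = {pt z g i j, pt z g i (j + 1)}"
| "edge z g Dia i j = {pt z g (i + 1) j, pt z g i (j + 1)}"

type_synonym index = "bool \<times> int \<times> int"

fun tri :: "complex \<Rightarrow> bool \<Rightarrow> index \<Rightarrow> complex set" where
  "tri z g (b, i, j) =
     (if b then {pt z g i j, pt z g (i + 1) j, pt z g i (j + 1)}
      else {pt z g (i + 1) (j + 1), pt z g i (j + 1), pt z g (i + 1) j})"

lemma Re_pt: "Re (pt z g i j) = Re z + (if g then 1 else -1) * (i + j / 2)"
  and Im_pt: "Im (pt z g i j) = Im z + (if g then 1 else -1) * (j * (sqrt 3 / 2))"
  by (auto simp: pt_def omega_def)

lemma pt_eq_iff: "pt z g i j = pt z g i' j' \<longleftrightarrow> i = i' \<and> j = j'"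
  by (auto simp: complex_eq_iff Re_pt Im_pt)

text \<open>The right-hand side is the norm form of the Eisenstein integers, so adjacency becomes a
  finite problem about integers.\<close>

lemma dist_pt: "(dist (pt z g i j) (pt z g k l))\<^sup>2 = of_int ((k - i)\<^sup>2 + (k - i) * (l - j) + (l - j)\<^sup>2)"
proof -
  define s :: real where "s = (if g then 1 else -1)"
  have "(dist (pt z g i j) (pt z g k l))\<^sup>2 =
      (Re (pt z g i j) - Re (pt z g k l))\<^sup>2 + (Im (pt z g i j) - Im (pt z g k l))\<^sup>2"
    by (simp add: dist_norm cmod_power2)
  also have "\<dots> = (s * ((i + j / 2) - (k + l / 2)))\<^sup>2 + (s * ((j - l) * (sqrt 3 / 2)))\<^sup>2"
  proof -
    have "Re (pt z g i j) - Re (pt z g k l) = s * ((i + j / 2) - (k + l / 2))"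
      by (simp add: Re_pt s_def)
    moreover have "Im (pt z g i j) - Im (pt z g k l) = s * ((j - l) * (sqrt 3 / 2))"
      by (simp add: Im_pt s_def left_diff_distrib)
    ultimately show ?thesis by (simp only:)
  qed
  also have "\<dots> = ((i + j / 2) - (k + l / 2))\<^sup>2 + ((j - l) * (sqrt 3 / 2))\<^sup>2"
    unfolding power_mult_distrib[of s] by (simp add: s_def)
  also have "\<dots> = of_int ((k - i)\<^sup>2 + (k - i) * (l - j) + (l - j)\<^sup>2)"
    by (simp add: power_mult_distrib power_divide) (simp add: power2_eq_square field_simps)
  finally show ?thesis .
qed

lemma unit_loeschian:
  fixes x y :: int
  assumes "x\<^sup>2 + x * y + y\<^sup>2 = 1"
  shows "(x, y) \<in> {(1, 0), (0, 1), (-1, 1), (-1, 0), (0, -1), (1, -1)}"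
proof -
  have "(2 * x + y)\<^sup>2 + 3 * y\<^sup>2 = 4" "(2 * y + x)\<^sup>2 + 3 * x\<^sup>2 = 4"
    using assms by (simp_all add: power2_eq_square algebra_simps)
  then have "3 * y\<^sup>2 \<le> 4" "3 * x\<^sup>2 \<le> 4"
    by (metis le_add_same_cancel2 zero_le_power2)+
  then have "y\<^sup>2 \<le> 1" "x\<^sup>2 \<le> 1" by linarith+
  then have "\<bar>y\<bar> \<le> 1" "\<bar>x\<bar> \<le> 1" by (simp_all add: abs_square_le_1)
  then have "x \<in> {-1, 0, 1}" "y \<in> {-1, 0, 1}" by auto
  then show ?thesis using assms by auto
qed

lemma dist_pt_eq_1_iff:
  "dist (pt z g i j) (pt z g k l) = 1 \<longleftrightarrow>
     (k = i + 1 \<and> l = j \<or> k = i \<and> l = j + 1 \<or> k = i - 1 \<and> l = j + 1 \<or>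
      k = i - 1 \<and> l = j \<or> k = i \<and> l = j - 1 \<or> k = i + 1 \<and> l = j - 1)" (is "?L \<longleftrightarrow> ?R")
proof
  assume ?L
  then have "real_of_int ((k - i)\<^sup>2 + (k - i) * (l - j) + (l - j)\<^sup>2) = 1"
    by (metis dist_pt power_one)
  then have "(k - i, l - j) \<in> {(1, 0), (0, 1), (-1, 1), (-1, 0), (0, -1), (1, -1)}"
    by (intro unit_loeschian) linarith
  then show ?R
    by (simp only: insert_iff prod.inject empty_iff, elim disjE conjE) simp_all
next
  assume ?R
  then have "(dist (pt z g i j) (pt z g k l))\<^sup>2 = 1"
    unfolding dist_pt by (elim disjE) auto
  then show ?L
    by (simp add: power2_eq_1_iff) (metis zero_le_dist neg_0_le_iff_le not_one_le_zero)
qed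

text \<open>The predicate \<open>P\<close> on indices lets one lemma serve both the grid of the
  whole plane and a subdivided triangle.\<close>

lemma unit_edges_pt:
  "unit_edges {pt z g i j | i j. P i j} =
     {edge z g d i j | d i j. \<forall>k l. pt z g k l \<in> edge z g d i j \<longrightarrow> P k l}" (is "?L = ?R")
proof
  show "?L \<subseteq> ?R"
  proof
    fix e assume "e \<in> ?L"
    then obtain i j k l where e: "e = {pt z g i j, pt z g k l}" "P i j" "P k l"
      and d: "dist (pt z g i j) (pt z g k l) = 1"
      unfolding unit_edges_def by blast
    have "\<exists>d i j. e = edge z g d i j"
      using d unfolding dist_pt_eq_1_iff
    proof (elim disjE conjE)
      assume "k = i + 1" "l = j"
      then have "e = edge z g Hor i j" using e by simp
      then show ?thesis by blast
    next
      assume "k = i" "l = j + 1"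
      then have "e = edge z g Wst i j" using e by simp
      then show ?thesis by blast
    next
      assume "k = i - 1" "l = j + 1"
      then have "e = edge z g Dia (i - 1) j" using e by simp
      then show ?thesis by blast
    next
      assume "k = i - 1" "l = j"
      then have "e = edge z g Hor (i - 1) j" using e by (simp add: insert_commute)
      then show ?thesis by blast
    next
      assume "k = i" "l = j - 1"
      then have "e = edge z g Wst i (j - 1)" using e by (simp add: insert_commute)
      then show ?thesis by blast
    next
      assume "k = i + 1" "l = j - 1"
      then have "e = edge z g Dia i (j - 1)" using e by (simp add: insert_commute)
      then show ?thesis by blast
    qed
    then obtain d i' j' where "e = edge z g d i' j'" by blast
    moreover have "\<forall>k l. pt z g k l \<in> e \<longrightarrow> P k l" using e by (simp add: pt_eq_iff)
    ultimately show "e \<in> ?R" by blast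
  qed
next
  show "?R \<subseteq> ?L"
  proof
    fix e assume "e \<in> ?R"
    then obtain d i j where e: "e = edge z g d i j" and P: "\<forall>k l. pt z g k l \<in> edge z g d i j \<longrightarrow> P k l"
      by blast
    obtain k l m n where e2: "edge z g d i j = {pt z g k l, pt z g m n}"
      and d1: "dist (pt z g k l) (pt z g m n) = 1"
    proof (cases d)
      case Hor
      show ?thesis by (rule that[of i j "i + 1" j]) (simp_all add: Hor dist_pt_eq_1_iff)
    next
      case Wst
      show ?thesis by (rule that[of i j i "j + 1"]) (simp_all add: Wst dist_pt_eq_1_iff)
    next
      case Dia
      show ?thesis by (rule that[of "i + 1" j i "j + 1"]) (simp_all add: Dia dist_pt_eq_1_iff)
    qed
    then have "P k l" "P m n" using P by blast+
    then show "e \<in> ?L" unfolding unit_edges_def e e2 using d1 by blast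
  qed
qed

lemma edge_inj: "edge z g d i j = edge z g d' i' j' \<longleftrightarrow> d = d' \<and> i = i' \<and> j = j'"
  by (cases d; cases d') (auto simp: doubleton_eq_iff pt_eq_iff)

lemma card_tri: "card (tri z g T) = 3"
  by (cases T) (auto simp: pt_eq_iff)

lemma tri_inj: "tri z g T = tri z g T' \<longleftrightarrow> T = T'"
proof
  assume eq: "tri z g T = tri z g T'"
  obtain b i j b' i' j' where T: "T = (b, i, j)" "T' = (b', i', j')"
    by (metis surj_pair)
  define S where "S U = {(k, l). pt z g k l \<in> tri z g U}" for U
  have S: "S (b, i, j) = (if b then {(i, j), (i + 1, j), (i, j + 1)}
      else {(i + 1, j + 1), (i, j + 1), (i + 1, j)})" for b i j
    by (auto simp: S_def pt_eq_iff)
  \<comment> \<open>Each index summed over the three vertices is \<open>3 * i + 1\<close> or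
    \<open>3 * i + 2\<close>: the quotient by 3 recovers \<open>i\<close>, the remainder recovers
    the flag.\<close>
  have sums: "(\<Sum>p\<in>S (b, i, j). fst p) = 3 * i + (if b then 1 else 2) \<and>
      (\<Sum>p\<in>S (b, i, j). snd p) = 3 * j + (if b then 1 else 2)" for b i j
    by (auto simp: S)
  have "S T = S T'" using eq by (simp add: S_def)
  then show "T = T'"
    using sums[of b i j] sums[of b' i' j'] unfolding T by (auto split: if_splits; presburger)
qed simp

lemma unit_triangles_pt:
  "unit_triangles {pt z g i j | i j. P i j} =
     tri z g ` {T. \<forall>k l. pt z g k l \<in> tri z g T \<longrightarrow> P k l}" (is "?L = ?R")
proof
  show "?L \<subseteq> ?R"
  proof
    fix t assume "t \<in> ?L"
    then obtain i j k l m n where t: "t = {pt z g i j, pt z g k l, pt z g m n}" "P i j" "P k l" "P m n"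
      and d: "dist (pt z g i j) (pt z g k l) = 1" "dist (pt z g i j) (pt z g m n) = 1"
        "dist (pt z g k l) (pt z g m n) = 1"
      unfolding unit_triangles_def by blast
    have "\<exists>T\<in>{(True, i, j), (False, i - 1, j), (True, i - 1, j), (False, i - 1, j - 1),
        (True, i, j - 1), (False, i, j - 1)}. t = tri z g T"
      using d(1,2) unfolding dist_pt_eq_1_iff
      by (elim disjE conjE; use d(3) in \<open>simp add: dist_pt_eq_1_iff t(1) insert_commute\<close>)
    moreover have "\<forall>k l. pt z g k l \<in> t \<longrightarrow> P k l" using t by (simp add: pt_eq_iff)
    ultimately show "t \<in> ?R" by blast
  qed
next
  show "?R \<subseteq> ?L"
  proof
    fix t assume "t \<in> ?R"
    then obtain T where t: "t = tri z g T" and P: "\<forall>k l. pt z g k l \<in> tri z g T \<longrightarrow> P k l"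
      by blast
    obtain b i j where T: "T = (b, i, j)" by (metis surj_pair)
    obtain k l m n p q where t2: "tri z g T = {pt z g k l, pt z g m n, pt z g p q}" and d:
      "dist (pt z g k l) (pt z g m n) = 1" "dist (pt z g m n) (pt z g p q) = 1"
      "dist (pt z g k l) (pt z g p q) = 1"
    proof (cases b)
      case True
      show ?thesis by (rule that[of i j "i + 1" j i "j + 1"]) (simp_all add: T True dist_pt_eq_1_iff)
    next
      case False
      show ?thesis by (rule that[of "i + 1" "j + 1" i "j + 1" "i + 1" j])
        (simp_all add: T False dist_pt_eq_1_iff)
    qed
    moreover have "P k l" "P m n" "P p q" using P t2 by blast+
    ultimately show "t \<in> ?L" unfolding unit_triangles_def t t2 using d by blast
  qed
qed

fun tri_edges :: "index \<Rightarrow> (dir \<times> int \<times> int) set" where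
  "tri_edges (b, i, j) =
     {(Hor, i, if b then j else j + 1), (Wst, if b then i else i + 1, j), (Dia, i, j)}"

lemma sides_triple:
  assumes "u \<noteq> v" "v \<noteq> w" "u \<noteq> w"
  shows "sides {u, v, w} = {{u, v}, {v, w}, {u, w}}"
proof
  show "sides {u, v, w} \<subseteq> {{u, v}, {v, w}, {u, w}}"
  proof
    fix e assume "e \<in> sides {u, v, w}"
    then obtain x y where "e = {x, y}" "x \<noteq> y" "{x, y} \<subseteq> {u, v, w}"
      unfolding sides_def by (auto simp: card_2_iff)
    then show "e \<in> {{u, v}, {v, w}, {u, w}}" by auto
  qed
qed (use assms in \<open>auto simp: sides_def\<close>)

lemma sides_tri: "sides (tri z g T) = (\<lambda>(d, i, j). edge z g d i j) ` tri_edges T"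
proof -
  obtain b i j where T: "T = (b, i, j)" by (metis surj_pair)
  show ?thesis
    unfolding T by (cases b) (auto simp: sides_triple pt_eq_iff)
qed

lemma positive_tri: "positive (tri z g (b, i, j)) \<longleftrightarrow> b = g"
proof
  assume "b = g"
  then show "positive (tri z g (b, i, j))"
    unfolding positive_def
  proof (cases b)
    case True
    then show "\<exists>u v w. tri z g (b, i, j) = {u, v, w} \<and> u \<noteq> v \<and> Im u = Im v \<and> Im u < Im w"
      using \<open>b = g\<close> by (intro exI[of _ "pt z g i j"] exI[of _ "pt z g (i+1) j"] exI[of _ "pt z g i (j+1)"])
        (auto simp: pt_eq_iff Im_pt)
  next
    case False
    then show "\<exists>u v w. tri z g (b, i, j) = {u, v, w} \<and> u \<noteq> v \<and> Im u = Im v \<and> Im u < Im w"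
      using \<open>b = g\<close> by (intro exI[of _ "pt z g (i+1) (j+1)"] exI[of _ "pt z g i (j+1)"] exI[of _ "pt z g (i+1) j"])
        (auto simp: pt_eq_iff Im_pt)
  qed
next
  assume "positive (tri z g (b, i, j))"
  then obtain u v w where t: "tri z g (b, i, j) = {u, v, w}" and uv: "u \<noteq> v" "Im u = Im v" "Im u < Im w"
    unfolding positive_def by blast
  \<comment> \<open>The vertices have only two heights, and that of the horizontal side occurs
    twice. The sum of the heights thus tells which level carries that side; the sign of
    \<open>h\<close> accounts for the frame.\<close>
  have sm: "(\<Sum>x\<in>tri z g (b, i, j). Im x) = Im u + Im v + Im w"
  proof -
    have "w \<noteq> u" "w \<noteq> v" using uv by auto
    then show ?thesis unfolding t using uv by simp
  qed
  define h where "h = (if g then 1 else -1) * (sqrt 3 / 2)"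
  have "{Im u, Im w} = Im ` tri z g (b, i, j)" unfolding t using uv by auto
  also have "\<dots> = {Im z + j * h, Im z + (j + 1) * h}"
    by (auto simp: Im_pt h_def algebra_simps)
  finally have two: "{Im u, Im w} = {Im z + j * h, Im z + (j + 1) * h}" .
  have sm2: "(\<Sum>x\<in>tri z g (b, i, j). Im x) = 3 * Im z + 3 * j * h + (if b then h else 2 * h)"
    by (auto simp: pt_eq_iff Im_pt h_def field_simps)
  have "3 * Im u + (Im w - Im u) = 3 * (Im z + j * h) + (if b then h else 2 * h)"
    using sm sm2 uv by simp
  moreover have "Im u = Im z + j * h \<and> Im w = Im z + j * h + h \<or> Im w = Im z + j * h \<and> Im u = Im z + j * h + h"
    using two by (auto simp: doubleton_eq_iff algebra_simps)
  moreover have "h > 0 \<longleftrightarrow> g" "h \<noteq> 0" by (auto simp: h_def)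
  ultimately show "b = g" using uv by (auto split: if_splits)
qed

definition col :: "complex \<Rightarrow> bool \<Rightarrow> (complex set \<Rightarrow> color) \<Rightarrow> dir \<Rightarrow> int \<Rightarrow> int \<Rightarrow> color" where
  "col z g c d i j = c (edge z g d i j)"

fun reds :: "(dir \<Rightarrow> int \<Rightarrow> int \<Rightarrow> color) \<Rightarrow> index \<Rightarrow> nat" where
  "reds \<psi> (b, i, j) = of_bool (\<psi> Hor i (if b then j else j + 1) = Red) +
     of_bool (\<psi> Wst (if b then i else i + 1) j = Red) + of_bool (\<psi> Dia i j = Red)"

definition ttype :: "bool \<Rightarrow> (dir \<Rightarrow> int \<Rightarrow> int \<Rightarrow> color) \<Rightarrow> index \<Rightarrow> nat" where
  "ttype g \<psi> T = (if fst T = g then 4 - reds \<psi> T else 5 + reds \<psi> T)"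

lemma triangle_type_tri: "triangle_type c (tri z g T) = ttype g (col z g c) T"
proof -
  obtain b i j where T: "T = (b, i, j)" by (metis surj_pair)
  let ?E = "\<lambda>(d, i, j). edge z g d i j"
  have "{e \<in> sides (tri z g T). c e = Red} = ?E ` {x \<in> tri_edges T. c (?E x) = Red}"
    unfolding sides_tri by blast
  moreover have "inj_on ?E A" for A by (auto simp: inj_on_def edge_inj)
  ultimately have "red_sides c (tri z g T) = card {x \<in> tri_edges T. c (?E x) = Red}"
    unfolding red_sides_def by (simp add: card_image)
  also have "\<dots> = (\<Sum>x\<in>tri_edges T. of_bool (c (?E x) = Red))"
    by (simp only: of_bool_def sum.inter_filter[symmetric] T tri_edges.simps finite.intros card_eq_sum)
  also have "\<dots> = reds (col z g c) T"
    by (cases b) (simp_all add: T col_def del: edge.simps)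
  finally have "red_sides c (tri z g T) = reds (col z g c) T" .
  moreover have "positive (tri z g T) \<longleftrightarrow> fst T = g"
    by (simp only: T positive_tri fst_conv)
  ultimately show ?thesis
    by (simp only: triangle_type_def ttype_def)
qed

lemma reds_le_3: "reds \<psi> T \<le> 3"
  by (cases T) auto

subsection \<open>The substitutions in coordinates\<close>

text \<open>One parity decides whether the fine edge lies on a coarse edge. Otherwise it is a
  midsegment of a coarse triangle, whose orientation in the frame is given by a second parity;
  comparing it with \<open>g\<close> yields the orientation in the plane.\<close>

fun sub :: "folding \<Rightarrow> bool \<Rightarrow> (dir \<Rightarrow> int \<Rightarrow> int \<Rightarrow> color) \<Rightarrow> dir \<Rightarrow> int \<Rightarrow> int \<Rightarrow> color" where
  "sub s g \<psi> Hor i j = (if even j then opposite (\<psi> Hor (i div 2) (j div 2)) else inner_color s (even i = g))"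
| "sub s g \<psi> Wst i j = (if even i then opposite (\<psi> Wst (i div 2) (j div 2)) else inner_color s (even j = g))"
| "sub s g \<psi> Dia i j = (if odd (i + j) then opposite (\<psi> Dia (i div 2) (j div 2)) else inner_color s (even i = g))"

text \<open>Halving the indices finds the coarse rhombus containing the fine triangle, and the
  parities tell which half of the rhombus it lies in. When they differ, the triangle is a corner of
  its parent and so has the same orientation.\<close>

fun parent :: "index \<Rightarrow> index" where
  "parent (b, i, j) =
     (if even i \<and> even j then True else if odd i \<and> odd j then False else b, i div 2, j div 2)"

fun children :: "index \<Rightarrow> index set" where
  "children (b, i, j) =
     (if b then {(True, 2 * i, 2 * j), (True, 2 * i + 1, 2 * j), (True, 2 * i, 2 * j + 1), (False, 2 * i, 2 * j)}
      else {(False, 2 * i + 1, 2 * j + 1), (False, 2 * i + 1, 2 * j), (False, 2 * i, 2 * j + 1),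
            (True, 2 * i + 1, 2 * j + 1)})"

lemma parent_eq_iff: "parent t = T \<longleftrightarrow> t \<in> children T"
proof -
  obtain b i j where t: "t = (b, i, j)" by (metis surj_pair)
  obtain B I J where T: "T = (B, I, J)" by (metis surj_pair)
  have "\<exists>k. i = 2 * k \<or> i = 2 * k + 1" "\<exists>l. j = 2 * l \<or> j = 2 * l + 1"
    by presburger+
  then obtain k l where "i = 2 * k \<or> i = 2 * k + 1" "j = 2 * l \<or> j = 2 * l + 1"
    by blast
  moreover have "2 * x \<noteq> 2 * y + 1" "2 * y + 1 \<noteq> 2 * x" for x y :: int by presburger+
  ultimately show ?thesis
    unfolding t T by (cases B; cases b; elim disjE) auto
qed

lemma finite_children: "finite (children T)"
  by (cases T) simp

lemma parent_vimage: "parent -` A = (\<Union>T\<in>A. children T)"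
  by (auto simp del: parent.simps children.simps simp: parent_eq_iff[of _ "parent _", symmetric] simp flip: parent_eq_iff)

lemma finite_parent_vimage: "finite A \<Longrightarrow> finite (parent -` A)"
  by (auto simp: parent_vimage finite_children)

text \<open>Sets of descendants are written as preimages, which compose well under iteration; the
  sets of children are disjoint because \<open>parent\<close> is a function.\<close>

lemma sum_parent_vimage:
  assumes "finite A"
  shows "(\<Sum>t\<in>parent -` A. f t) = (\<Sum>T\<in>A. \<Sum>t\<in>children T. f t)"
  unfolding parent_vimage
  by (rule sum.UNION_disjoint) (use assms in \<open>auto simp: finite_children simp del: children.simps parent.simps simp flip: parent_eq_iff\<close>)

fun spin :: "color \<Rightarrow> real" where
  "spin Red = 1"
| "spin Blue = -1"

fun fold_sign :: "folding \<Rightarrow> real" where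
  "fold_sign Up = 1"
| "fold_sign Down = -1"

lemma spin_opposite: "spin (opposite c) = - spin c"
  by (cases c) auto

text \<open>The polynomial of degree two is shifted by its mean \<open>1\<close> over the types, so that only the last
  moment is nonzero on the uniform distribution.\<close>

definition moment_of :: "bool \<Rightarrow> real \<Rightarrow> real \<Rightarrow> real \<Rightarrow> nat \<Rightarrow> real" where
  "moment_of p x y z = nth_default 0
     (if p then [x * y * z, 0, x * y + y * z + z * x - 1, 0, x + y + z, 0, 1, 1]
      else [0, x * y * z, 0, x * y + y * z + z * x - 1, 0, x + y + z, -1, 1])"

fun moment :: "bool \<Rightarrow> (dir \<Rightarrow> int \<Rightarrow> int \<Rightarrow> color) \<Rightarrow> index \<Rightarrow> nat \<Rightarrow> real" where
  "moment g \<psi> (b, i, j) = moment_of (b = g) (spin (\<psi> Hor i (if b then j else j + 1)))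
     (spin (\<psi> Wst (if b then i else i + 1) j)) (spin (\<psi> Dia i j))"

text \<open>Constant contributions are expressed through \<open>q 6\<close> and \<open>q 7\<close>,
  which keeps the map linear. For instance \<open>q 2 + q 6\<close> is the degree two sum over the
  positive triangles minus the number of negative triangles, since the middle triangles of the
  latter are positive and have spin product \<open>s\<close>.\<close>

definition advance :: "real \<Rightarrow> (nat \<Rightarrow> real) \<Rightarrow> nat \<Rightarrow> real" where
  "advance s q = nth_default 0
     [- s * (q 2 + q 6), s * (q 3 - q 6), q 2 + 2 * s * q 4 - 2 * q 6, q 3 - 2 * s * q 5 + 2 * q 6,
      - 2 * q 4 - 3 * s * q 6, - 2 * q 5 - 3 * s * q 6, 2 * q 6, 4 * q 7]"

lemma less_8_cases:
  fixes r :: nat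
  obtains "r = 0" | "r = 1" | "r = 2" | "r = 3" | "r = 4" | "r = 5" | "r = 6" | "r = 7" | "r \<ge> 8"
  by linarith

lemma moment_of_simps:
  "moment_of p x y z 0 = (if p then x * y * z else 0)"
  "moment_of p x y z (Suc 0) = (if p then 0 else x * y * z)"
  "moment_of p x y z 2 = (if p then x * y + y * z + z * x - 1 else 0)"
  "moment_of p x y z 3 = (if p then 0 else x * y + y * z + z * x - 1)"
  "moment_of p x y z 4 = (if p then x + y + z else 0)"
  "moment_of p x y z 5 = (if p then 0 else x + y + z)"
  "moment_of p x y z 6 = (if p then 1 else - 1)"
  "moment_of p x y z 7 = 1"
  "r \<ge> 8 \<Longrightarrow> moment_of p x y z r = 0"
  by (simp_all add: moment_of_def nth_default_def)

lemma advance_simps: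
  "advance s q 0 = - s * (q 2 + q 6)"
  "advance s q (Suc 0) = s * (q 3 - q 6)"
  "advance s q 2 = q 2 + 2 * s * q 4 - 2 * q 6"
  "advance s q 3 = q 3 - 2 * s * q 5 + 2 * q 6"
  "advance s q 4 = - 2 * q 4 - 3 * s * q 6"
  "advance s q 5 = - 2 * q 5 - 3 * s * q 6"
  "advance s q 6 = 2 * q 6"
  "advance s q 7 = 4 * q 7"
  "r \<ge> 8 \<Longrightarrow> advance s q r = 0"
  by (simp_all add: advance_def nth_default_def)

lemma moment_of_children:
  assumes "c = (if p then - s else s)" and "s\<^sup>2 = 1"
  shows "moment_of p (- x) (- y) c r + moment_of p (- x) c (- z) r + moment_of p c (- y) (- z) r +
    moment_of (\<not> p) c c c r = advance s (moment_of p x y z) r"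
proof -
  have s: "s * s = 1" "s * (s * t) = t" for t using assms(2) by (simp_all add: power2_eq_square mult.assoc[symmetric])
  show ?thesis
    unfolding assms(1)
    by (cases r rule: less_8_cases; cases p) (simp_all add: moment_of_simps advance_simps, simp_all add: algebra_simps s)
qed

lemma moment_children:
  "(\<Sum>t\<in>children T. moment g (sub s g \<psi>) t r) = advance (fold_sign s) (moment g \<psi> T) r"
proof -
  obtain b i j where T: "T = (b, i, j)" by (metis surj_pair)
  define x y z where "x = spin (\<psi> Hor i (if b then j else j + 1))"
    and "y = spin (\<psi> Wst (if b then i else i + 1) j)" and "z = spin (\<psi> Dia i j)"
  define c where "c = spin (inner_color s (b = g))"
  have c: "c = (if b = g then - fold_sign s else fold_sign s)"
    unfolding c_def by (cases s; cases "b = g") auto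
  have s: "(fold_sign s)\<^sup>2 = 1" by (cases s) auto
  have m: "moment g \<psi> T = moment_of (b = g) x y z"
    unfolding T by (simp add: x_def y_def z_def)
  have d: "(2 * k + 1) div 2 = k" "(2 * k + 1 + 1) div 2 = k + 1" for k :: int by presburger+
  have ne: "2 * k \<noteq> 2 * l + 1" "2 * k + 1 \<noteq> 2 * l" for k l :: int by presburger+
  show ?thesis
  proof (cases b)
    case True
    have "moment g (sub s g \<psi>) (True, 2 * i, 2 * j) = moment_of (b = g) (- x) (- y) c"
      "moment g (sub s g \<psi>) (True, 2 * i + 1, 2 * j) = moment_of (b = g) (- x) c (- z)"
      "moment g (sub s g \<psi>) (True, 2 * i, 2 * j + 1) = moment_of (b = g) c (- y) (- z)"
      "moment g (sub s g \<psi>) (False, 2 * i, 2 * j) = moment_of (\<not> (b = g)) c c c"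
      using True by (simp_all add: d spin_opposite x_def y_def z_def c_def)
    then show ?thesis
      using moment_of_children[OF c s, of x y r z] unfolding m by (simp add: T True ne del: moment.simps)
  next
    case False
    have "moment g (sub s g \<psi>) (False, 2 * i + 1, 2 * j + 1) = moment_of (b = g) (- x) (- y) c"
      "moment g (sub s g \<psi>) (False, 2 * i + 1, 2 * j) = moment_of (b = g) c (- y) (- z)"
      "moment g (sub s g \<psi>) (False, 2 * i, 2 * j + 1) = moment_of (b = g) (- x) c (- z)"
      "moment g (sub s g \<psi>) (True, 2 * i + 1, 2 * j + 1) = moment_of (\<not> (b = g)) c c c"
      using False by (simp_all add: d spin_opposite x_def y_def z_def c_def add.commute[of 1])
    then show ?thesis
      using moment_of_children[OF c s, of x y r z] unfolding m by (simp add: T False ne del: moment.simps)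
  qed
qed

lemma sum_advance: "(\<Sum>T\<in>A. advance s (q T) r) = advance s (\<lambda>r. \<Sum>T\<in>A. q T r) r"
  by (cases r rule: less_8_cases)
    (simp_all add: advance_simps sum_subtractf sum.distrib sum_distrib_left sum_negf distrib_left right_diff_distrib)

lemma moment_parent_vimage:
  assumes "finite A"
  shows "(\<Sum>t\<in>parent -` A. moment g (sub s g \<psi>) t r) =
    advance (fold_sign s) (\<lambda>r. \<Sum>T\<in>A. moment g \<psi> T r) r"
  by (simp add: sum_parent_vimage assms moment_children sum_advance)

section \<open>Edge-colored triangles in grid indices\<close>

lemma xi_1: "xi 1 = Complex 0 (- 2 * sqrt 3)"
  and xi_2: "xi 2 = Complex 3 (sqrt 3)"
  and xi_3: "xi 3 = Complex (- 3) (sqrt 3)"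
proof -
  show x1: "xi 1 = Complex 0 (- 2 * sqrt 3)"
    by (simp add: xi_def)
  show x2: "xi 2 = Complex 3 (sqrt 3)"
    by (simp add: xi_def complex_eq_iff cos_120 sin_120)
  show "xi 3 = Complex (- 3) (sqrt 3)"
    using xi_sum unfolding x1 x2 by (simp add: complex_eq_iff)
qed

text \<open>The lower left corner of a positive triangle and the upper right corner of a negative
  one, so that in the frame starting there all indices of the subdivision are nonnegative.\<close>

definition corner :: "colored_triangle \<Rightarrow> complex" where
  "corner X = center X - (real_of_int (ratio X) / 6) *\<^sub>R xi 2"

abbreviation upright :: "colored_triangle \<Rightarrow> bool" where
  "upright X \<equiv> ratio X > 0"

definition in_side :: "int \<Rightarrow> int \<Rightarrow> int \<Rightarrow> bool" where
  "in_side n i j \<longleftrightarrow> 0 \<le> i \<and> 0 \<le> j \<and> i + j \<le> n"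

lemma subdivision_vertices_eq:
  assumes "ratio X \<noteq> 0"
  shows "subdivision_vertices X = {pt (corner X) (upright X) i j | i j. in_side \<bar>ratio X\<bar> i j}"
    (is "?L = ?R")
proof -
  define s :: real where "s = sgn (real_of_int (ratio X))"
  have s: "s = (if upright X then 1 else -1)" "real_of_int (ratio X) = s * real_of_int \<bar>ratio X\<bar>"
    using assms by (auto simp: s_def sgn_if)
  \<comment> \<open>Of the three barycentric weights, those of \<open>xi 3\<close> and
    \<open>xi 1\<close> become the indices along 1 and \<open>omega\<close>; the weight
    \<open>l\<close> is determined by the side length.\<close>
  have key: "center X - (s / 6) *\<^sub>R (real k *\<^sub>R xi 1 + real l *\<^sub>R xi 2 + real m *\<^sub>R xi 3) =
    pt (corner X) (upright X) (int m) (int k)" if "int (k + l + m) = \<bar>ratio X\<bar>" for k l m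
  proof -
    define n where "n = real_of_int \<bar>ratio X\<bar>"
    have r: "real l = n - real k - real m"
      using that unfolding n_def by linarith
    have n: "real_of_int (ratio X) = s * n" using s(2) unfolding n_def .
    show ?thesis
      unfolding complex_eq_iff Re_pt Im_pt corner_def xi_1 xi_2 xi_3 s(1)[symmetric]
      by (simp add: r n) (simp add: field_simps)
  qed
  show ?thesis
  proof
    show "?L \<subseteq> ?R"
    proof
      fix x assume "x \<in> ?L"
      then obtain k l m where "x = center X - (s / 6) *\<^sub>R (real k *\<^sub>R xi 1 + real l *\<^sub>R xi 2 + real m *\<^sub>R xi 3)"
        and kl: "int (k + l + m) = \<bar>ratio X\<bar>"
        unfolding subdivision_vertices_def s_def by blast
      then have "x = pt (corner X) (upright X) (int m) (int k)" using key by simp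
      moreover have "in_side \<bar>ratio X\<bar> (int m) (int k)" using kl by (auto simp: in_side_def)
      ultimately show "x \<in> ?R" by blast
    qed
    show "?R \<subseteq> ?L"
    proof
      fix x assume "x \<in> ?R"
      then obtain i j where x: "x = pt (corner X) (upright X) i j" and ij: "in_side \<bar>ratio X\<bar> i j"
        by blast
      define k l m where "k = nat j" "l = nat (\<bar>ratio X\<bar> - i - j)" "m = nat i"
      have kl: "int (k + l + m) = \<bar>ratio X\<bar>" and "int m = i" "int k = j"
        using ij by (auto simp: k_l_m_def in_side_def)
      then have "x = center X - (s / 6) *\<^sub>R (real k *\<^sub>R xi 1 + real l *\<^sub>R xi 2 + real m *\<^sub>R xi 3)"
        unfolding x using key[OF kl] by simp
      then show "x \<in> ?L"
        unfolding subdivision_vertices_def s_def[symmetric] using kl by blast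
    qed
  qed
qed

definition region :: "int \<Rightarrow> index set" where
  "region n = {(b, i, j). 0 \<le> i \<and> 0 \<le> j \<and> i + j + (if b then 1 else 2) \<le> n}"

lemma all_vertices_tri:
  "(\<forall>k l. pt z g k l \<in> tri z g (b, i, j) \<longrightarrow> P k l) \<longleftrightarrow>
     (if b then P i j \<and> P (i + 1) j \<and> P i (j + 1) else P (i + 1) (j + 1) \<and> P i (j + 1) \<and> P (i + 1) j)"
  by (auto simp: pt_eq_iff)

lemma region_eq: "region n = {T. \<forall>k l. pt z g k l \<in> tri z g T \<longrightarrow> in_side n k l}"
proof -
  have "T \<in> region n \<longleftrightarrow> (\<forall>k l. pt z g k l \<in> tri z g T \<longrightarrow> in_side n k l)" for T
  proof -
    obtain b i j where T: "T = (b, i, j)" by (metis surj_pair)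
    show ?thesis
      unfolding T all_vertices_tri by (auto simp: region_def in_side_def)
  qed
  then show ?thesis by blast
qed

lemma finite_region: "finite (region n)"
proof -
  have "region n \<subseteq> UNIV \<times> {0..n} \<times> {0..n}" by (auto simp: region_def split: if_splits)
  then show ?thesis by (rule finite_subset) auto
qed

lemma region_double: "region (2 * n) = parent -` region n"
proof -
  have "(b, i, j) \<in> region (2 * n) \<longleftrightarrow> parent (b, i, j) \<in> region n" for b i j
  proof -
    have "\<exists>k. i = 2 * k \<or> i = 2 * k + 1" "\<exists>l. j = 2 * l \<or> j = 2 * l + 1"
      by presburger+
    then obtain k l where "i = 2 * k \<or> i = 2 * k + 1" "j = 2 * l \<or> j = 2 * l + 1"
      by blast
    then show ?thesis
      by (cases b; elim disjE) (auto simp: region_def)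
  qed
  then show ?thesis by auto
qed

lemma halves_pair:
  assumes "u \<noteq> v"
  shows "halves {u, v} = {{u, midpoint u v}, {midpoint u v, v}}"
proof
  show "halves {u, v} \<subseteq> {{u, midpoint u v}, {midpoint u v, v}}"
    by (auto simp: halves_def doubleton_eq_iff midpoint_sym insert_commute)
  have "{u, midpoint u v} \<in> halves {u, v}"
    unfolding halves_def using assms by blast
  moreover have "{v, midpoint v u} \<in> halves {u, v}"
    unfolding halves_def using assms by blast
  ultimately show "{{u, midpoint u v}, {midpoint u v, v}} \<subseteq> halves {u, v}"
    by (simp add: midpoint_sym insert_commute)
qed

lemma midsegments_triple:
  assumes "u \<noteq> v" "v \<noteq> w" "u \<noteq> w"
  shows "midsegments {u, v, w} = {{midpoint u v, midpoint u w}, {midpoint u v, midpoint v w},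
    {midpoint u w, midpoint v w}}" (is "?L = ?R")
proof
  show "?L \<subseteq> ?R"
  proof
    fix e assume "e \<in> ?L"
    then obtain x y z where e: "e = {midpoint x y, midpoint x z}" and eq: "{u, v, w} = {x, y, z}"
      and c: "card {x, y, z} = 3"
      unfolding midsegments_def by blast
    have "x \<noteq> y" "x \<noteq> z" "y \<noteq> z" using c by (auto simp: card_insert_if split: if_splits)
    then have "x = u \<and> y = v \<and> z = w \<or> x = u \<and> y = w \<and> z = v \<or> x = v \<and> y = u \<and> z = w \<or>
      x = v \<and> y = w \<and> z = u \<or> x = w \<and> y = u \<and> z = v \<or> x = w \<and> y = v \<and> z = u"
    proof -
      have "x \<in> {u, v, w}" "y \<in> {u, v, w}" "z \<in> {u, v, w}" using eq by auto
      then show ?thesis using \<open>x \<noteq> y\<close> \<open>x \<noteq> z\<close> \<open>y \<noteq> z\<close> by auto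
    qed
    then show "e \<in> ?R"
      unfolding e by (elim disjE conjE) (simp_all add: midpoint_sym insert_commute)
  qed
  have c: "card {u, v, w} = 3" "card {v, u, w} = 3" "card {w, u, v} = 3"
    using assms by auto
  have "{midpoint u v, midpoint u w} \<in> ?L"
    unfolding midsegments_def using c by blast
  moreover have "{midpoint v u, midpoint v w} \<in> ?L"
    unfolding midsegments_def using c insert_commute[of u v "{w}"] by blast
  moreover have "{midpoint w u, midpoint w v} \<in> ?L"
    unfolding midsegments_def using c by blast
  ultimately show "?R \<subseteq> ?L"
    by (simp add: midpoint_sym)
qed

fun on_coarse :: "dir \<Rightarrow> int \<Rightarrow> int \<Rightarrow> bool" where
  "on_coarse Hor i j = even j"
| "on_coarse Wst i j = even i"
| "on_coarse Dia i j = odd (i + j)"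

text \<open>For an edge off the coarse grid, this is the orientation, within the frame, of the
  coarse triangle of which it is a midsegment.\<close>

fun side_of_coarse :: "dir \<Rightarrow> int \<Rightarrow> int \<Rightarrow> bool" where
  "side_of_coarse Hor i j = even i"
| "side_of_coarse Wst i j = even j"
| "side_of_coarse Dia i j = even i"

lemma sub_eq: "sub s g \<psi> d i j = (if on_coarse d i j then opposite (\<psi> d (i div 2) (j div 2))
    else inner_color s (side_of_coarse d i j = g))"
  by (cases d) auto

lemma midpoint_pt:
  assumes "i + k = 2 * m" "j + l = 2 * n"
  shows "midpoint (pt z g i j) (pt z g k l) = pt z g m n"
proof -
  have "real_of_int m = (i + k) / 2" "real_of_int n = (j + l) / 2"
    using assms by (simp_all flip: of_int_add)
  then show ?thesis
    by (auto simp: complex_eq_iff Re_pt Im_pt midpoint_def add_divide_distrib diff_divide_distrib distrib_right)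
qed

text \<open>\<open>E\<close> holds the index pairs of a coarse edge: in the frame of the image, the
  homothety is doubling of indices. A fine edge is therefore half of at most one coarse edge, the
  one with halved indices.\<close>

lemma halves_edge:
  "edge z g d' i' j' \<in> halves ((\<lambda>(i, j). pt z g (2 * i) (2 * j)) ` E) \<longleftrightarrow>
     d' = d \<and> i' div 2 = i \<and> j' div 2 = j \<and> on_coarse d' i' j'"
  if "E = (case d of Hor \<Rightarrow> {(i, j), (i + 1, j)} | Wst \<Rightarrow> {(i, j), (i, j + 1)} | Dia \<Rightarrow> {(i + 1, j), (i, j + 1)})"
proof (cases d)
  case Hor
  have "halves ((\<lambda>(i, j). pt z g (2 * i) (2 * j)) ` E) = {edge z g Hor (2 * i) (2 * j), edge z g Hor (2 * i + 1) (2 * j)}"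
    by (simp add: that Hor halves_pair pt_eq_iff midpoint_pt[of _ _ "2 * i + 1" _ _ "2 * j"] add.assoc)
  then show ?thesis
    unfolding Hor by (cases d'; auto simp: edge_inj simp del: edge.simps; presburger)
next
  case Wst
  have "halves ((\<lambda>(i, j). pt z g (2 * i) (2 * j)) ` E) = {edge z g Wst (2 * i) (2 * j), edge z g Wst (2 * i) (2 * j + 1)}"
    by (simp add: that Wst halves_pair pt_eq_iff midpoint_pt[of _ _ "2 * i" _ _ "2 * j + 1"] add.assoc)
  then show ?thesis
    unfolding Wst by (cases d'; auto simp: edge_inj simp del: edge.simps; presburger)
next
  case Dia
  have "halves ((\<lambda>(i, j). pt z g (2 * i) (2 * j)) ` E) = {edge z g Dia (2 * i + 1) (2 * j), edge z g Dia (2 * i) (2 * j + 1)}"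
    by (simp add: that Dia halves_pair pt_eq_iff midpoint_pt[of _ _ "2 * i + 1" _ _ "2 * j + 1"] add.assoc)
  then show ?thesis
    unfolding Dia by (cases d'; auto simp: edge_inj simp del: edge.simps; presburger)
qed

lemma midsegments_tri:
  "edge z g d' i' j' \<in> midsegments ((\<lambda>(i, j). pt z g (2 * i) (2 * j)) ` E) \<longleftrightarrow>
     side_of_coarse d' i' j' = b \<and> i' div 2 = i \<and> j' div 2 = j \<and> \<not> on_coarse d' i' j'"
  if "E = (if b then {(i, j), (i + 1, j), (i, j + 1)} else {(i + 1, j + 1), (i, j + 1), (i + 1, j)})"
proof (cases b)
  case True
  have "midsegments ((\<lambda>(i, j). pt z g (2 * i) (2 * j)) ` E) =
     {edge z g Hor (2 * i) (2 * j + 1), edge z g Wst (2 * i + 1) (2 * j), edge z g Dia (2 * i) (2 * j)}"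
    by (simp add: that True midsegments_triple pt_eq_iff midpoint_pt[of _ _ "2 * i" _ _ "2 * j + 1"]
      midpoint_pt[of _ _ "2 * i + 1" _ _ "2 * j"] midpoint_pt[of _ _ "2 * i + 1" _ _ "2 * j + 1"] insert_commute)
  then show ?thesis
    using True by (cases d'; auto simp: edge_inj simp del: edge.simps; presburger)
next
  case False
  have "midsegments ((\<lambda>(i, j). pt z g (2 * i) (2 * j)) ` E) =
     {edge z g Hor (2 * i + 1) (2 * j + 1), edge z g Wst (2 * i + 1) (2 * j + 1), edge z g Dia (2 * i + 1) (2 * j + 1)}"
    by (simp add: that False midsegments_triple pt_eq_iff midpoint_pt[of _ _ "2 * i + 1" _ _ "2 * j + 2"]
      midpoint_pt[of _ _ "2 * i + 2" _ _ "2 * j + 1"] midpoint_pt[of _ _ "2 * i + 1" _ _ "2 * j + 1"] insert_commute add.commute[of 2])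
  then show ?thesis
    using False by (cases d'; auto simp: edge_inj simp del: edge.simps; presburger)
qed

lemma all_vertices_edge:
  "(\<forall>k l. pt z g k l \<in> edge z g d i j \<longrightarrow> P k l) \<longleftrightarrow>
     (case d of Hor \<Rightarrow> P i j \<and> P (i + 1) j | Wst \<Rightarrow> P i j \<and> P i (j + 1) | Dia \<Rightarrow> P (i + 1) j \<and> P i (j + 1))"
  by (cases d) (auto simp: pt_eq_iff)

text \<open>Here the definite descriptions in \<open>subst_F_coloring\<close> are resolved, by
  exhibiting the unique edge or triangle. The condition \<open>side\<close> is about indices alone,
  so it may be stated with an arbitrary origin \<open>z'\<close>.\<close>

lemma subst_F_col:
  assumes "ratio X \<noteq> 0"
    and side: "\<forall>k l. pt z' (upright X) k l \<in> edge z' (upright X) d i j \<longrightarrow> in_side (2 * \<bar>ratio X\<bar>) k l"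
  shows "col (corner (subst_F s X)) (upright X) (coloring (subst_F s X)) d i j =
    sub s (upright X) (col (corner X) (upright X) (coloring X)) d i j"
proof -
  define g where "g = upright X"
  define z where "z = corner X"
  define w where "w = corner (subst_F s X)"
  define n where "n = \<bar>ratio X\<bar>"
  define h where "h = (\<lambda>x. center X + 2 *\<^sub>R (x - center X))"
  define e where "e = edge w g d i j"
  define H where "H = (\<lambda>(i, j). pt w g (2 * i) (2 * j))"
  \<comment> \<open>The homothety sends the corner of \<open>X\<close> to the corner of its image,
    so relative to these two origins it doubles indices.\<close>
  have h: "h (pt z g k l) = H (k, l)" for k l
    by (simp add: h_def z_def w_def corner_def subst_F_def pt_def scaleR_conv_of_real algebra_simps H_def)
  have V: "subdivision_vertices X = {pt z g i j | i j. in_side n i j}"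
    using subdivision_vertices_eq[OF assms(1)] by (simp add: z_def g_def n_def)
  have hal: "e \<in> halves (h ` edge z g d' i' j') \<longleftrightarrow> d = d' \<and> i div 2 = i' \<and> j div 2 = j' \<and> on_coarse d i j"
    for d' i' j'
  proof -
    define E where "E = (case d' of Hor \<Rightarrow> {(i', j'), (i' + 1, j')} | Wst \<Rightarrow> {(i', j'), (i', j' + 1)}
      | Dia \<Rightarrow> {(i' + 1, j'), (i', j' + 1)})"
    have "h ` edge z g d' i' j' = H ` E"
      by (cases d') (simp_all add: h E_def)
    then show ?thesis
      using halves_edge[OF E_def, of w g d i j] unfolding e_def H_def by simp
  qed
  have mid: "e \<in> midsegments (h ` tri z g (b', i', j')) \<longleftrightarrow>
      side_of_coarse d i j = b' \<and> i div 2 = i' \<and> j div 2 = j' \<and> \<not> on_coarse d i j"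
    for b' i' j'
  proof -
    define E where "E = (if b' then {(i', j'), (i' + 1, j'), (i', j' + 1)}
      else {(i' + 1, j' + 1), (i', j' + 1), (i' + 1, j')})"
    have "h ` tri z g (b', i', j') = H ` E"
      by (simp add: h E_def)
    then show ?thesis
      using midsegments_tri[OF E_def, of w g d i j] unfolding e_def H_def by simp
  qed
  have "col w g (coloring (subst_F s X)) d i j = subst_F_coloring s X e"
    by (simp add: col_def subst_F_def e_def)
  also have "\<dots> = sub s g (col z g (coloring X)) d i j"
  proof (cases "on_coarse d i j")
    case True
    define e0 where "e0 = edge z g d (i div 2) (j div 2)"
    have "\<forall>k l. pt z g k l \<in> e0 \<longrightarrow> in_side n k l"
      using side True unfolding e0_def n_def all_vertices_edge
      by (cases d) (auto simp: in_side_def)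
    then have e0: "e0 \<in> unit_edges (subdivision_vertices X)"
      unfolding V unit_edges_pt e0_def by blast
    have uniq: "e1 \<in> unit_edges (subdivision_vertices X) \<and> e \<in> halves (h ` e1) \<longleftrightarrow> e1 = e0" for e1
    proof
      assume a: "e1 \<in> unit_edges (subdivision_vertices X) \<and> e \<in> halves (h ` e1)"
      then obtain d' i' j' where e1: "e1 = edge z g d' i' j'"
        unfolding V unit_edges_pt by blast
      then show "e1 = e0" using a hal[of d' i' j'] unfolding e0_def by simp
    next
      assume "e1 = e0"
      then show "e1 \<in> unit_edges (subdivision_vertices X) \<and> e \<in> halves (h ` e1)"
        using e0 hal[of d "i div 2" "j div 2"] True unfolding e0_def by blast
    qed
    have "subst_F_coloring s X e = opposite (coloring X e0)"
      unfolding subst_F_coloring_def Let_def h_def[symmetric]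
      by (simp only: Bex_def uniq the_eq_trivial if_True simp_thms)
    then show ?thesis
      using True by (simp add: sub_eq col_def e0_def)
  next
    case False
    define t0 where "t0 = tri z g (side_of_coarse d i j, i div 2, j div 2)"
    have "\<exists>k. i = 2 * k \<or> i = 2 * k + 1" "\<exists>l. j = 2 * l \<or> j = 2 * l + 1"
      by presburger+
    then obtain k l where "i = 2 * k \<or> i = 2 * k + 1" "j = 2 * l \<or> j = 2 * l + 1"
      by blast
    then have "\<forall>k l. pt z g k l \<in> t0 \<longrightarrow> in_side n k l"
      using side False unfolding t0_def n_def all_vertices_edge all_vertices_tri
      by (cases d; elim disjE) (auto simp: in_side_def)
    then have t0: "t0 \<in> unit_triangles (subdivision_vertices X)"
      unfolding V unit_triangles_pt t0_def by blast
    have uniq: "t1 \<in> unit_triangles (subdivision_vertices X) \<and> e \<in> midsegments (h ` t1) \<longleftrightarrow> t1 = t0" for t1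
    proof
      assume a: "t1 \<in> unit_triangles (subdivision_vertices X) \<and> e \<in> midsegments (h ` t1)"
      then obtain T where "t1 = tri z g T"
        unfolding V unit_triangles_pt by blast
      then obtain b' i' j' where t1: "t1 = tri z g (b', i', j')"
        by (metis surj_pair)
      then show "t1 = t0" using a mid[of b' i' j'] unfolding t0_def by (simp del: tri.simps)
    next
      assume "t1 = t0"
      then show "t1 \<in> unit_triangles (subdivision_vertices X) \<and> e \<in> midsegments (h ` t1)"
        using t0 mid[of "side_of_coarse d i j" "i div 2" "j div 2"] False unfolding t0_def by blast
    qed
    have "\<not> (\<exists>e1\<in>unit_edges (subdivision_vertices X). e \<in> halves (h ` e1))"
      using hal False unfolding V unit_edges_pt by blast
    then have "subst_F_coloring s X e = inner_color s (positive t0)"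
      unfolding subst_F_coloring_def Let_def h_def[symmetric]
      by (simp only: uniq the_eq_trivial if_False)
    then show ?thesis
      using False unfolding t0_def positive_tri by (simp add: sub_eq)
  qed
  finally show ?thesis by (simp add: g_def z_def w_def)
qed

definition total :: "colored_triangle \<Rightarrow> nat \<Rightarrow> real" where
  "total X r = (\<Sum>T\<in>region \<bar>ratio X\<bar>. moment (upright X) (col (corner X) (upright X) (coloring X)) T r)"

lemma total_subst_F:
  assumes "ratio X \<noteq> 0"
  shows "total (subst_F s X) = advance (fold_sign s) (total X)"
proof
  fix r
  define g where "g = upright X"
  define \<psi> where "\<psi> = col (corner X) g (coloring X)"
  define \<psi>' where "\<psi>' = col (corner (subst_F s X)) g (coloring (subst_F s X))"
  have r: "\<bar>ratio (subst_F s X)\<bar> = 2 * \<bar>ratio X\<bar>" "upright (subst_F s X) = g"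
    by (auto simp: subst_F_def g_def zero_less_mult_iff)
  have "moment g \<psi>' T = moment g (sub s g \<psi>) T" if "T \<in> region (2 * \<bar>ratio X\<bar>)" for T
  proof -
    obtain b i j where T: "T = (b, i, j)" by (metis surj_pair)
    have "\<psi>' d k l = sub s g \<psi> d k l" if "(d, k, l) \<in> tri_edges T" for d k l
      unfolding \<psi>'_def \<psi>_def g_def
    proof (rule subst_F_col[OF assms])
      show "\<forall>k' l'. pt 0 (upright X) k' l' \<in> edge 0 (upright X) d k l \<longrightarrow> in_side (2 * \<bar>ratio X\<bar>) k' l'"
        using \<open>T \<in> region _\<close> that unfolding T all_vertices_edge
        by (auto simp: region_def in_side_def split: if_splits)
    qed
    then show ?thesis
      unfolding T by simp
  qed
  then have "total (subst_F s X) r = (\<Sum>T\<in>region (2 * \<bar>ratio X\<bar>). moment g (sub s g \<psi>) T r)"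
    unfolding total_def r by (intro sum.cong) (simp_all add: \<psi>'_def)
  also have "\<dots> = advance (fold_sign s) (total X) r"
    unfolding region_double moment_parent_vimage[OF finite_region]
    by (simp add: total_def[abs_def] \<psi>_def g_def)
  finally show "total (subst_F s X) r = advance (fold_sign s) (total X) r" .
qed

fun advances :: "(nat \<Rightarrow> folding) \<Rightarrow> nat \<Rightarrow> (nat \<Rightarrow> real) \<Rightarrow> nat \<Rightarrow> real" where
  "advances a 0 q = q"
| "advances a (Suc k) q = advance (fold_sign (a 1)) (advances (\<lambda>i. a (Suc i)) k q)"

lemma subst_comp_Suc: "subst_comp a (Suc k) X = subst_F (a 1) (subst_comp (\<lambda>i. a (Suc i)) k X)"
proof -
  have "[1..<Suc (Suc k)] = 1 # map Suc [1..<Suc k]"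
    by (metis One_nat_def map_Suc_upt upt_conv_Cons zero_less_Suc Suc_less_eq)
  then show ?thesis
    by (simp add: subst_comp_def o_def del: upt_Suc)
qed

lemma total_subst_comp:
  assumes "ratio X \<noteq> 0"
  shows "ratio (subst_comp a k X) = 2 ^ k * ratio X \<and> total (subst_comp a k X) = advances a k (total X)"
proof (induction k arbitrary: a)
  case 0
  then show ?case by (simp add: subst_comp_def)
next
  case (Suc k)
  have "ratio (subst_comp (\<lambda>i. a (Suc i)) k X) \<noteq> 0" using Suc assms by simp
  from total_subst_F[OF this] show ?case
    unfolding subst_comp_Suc using Suc by (simp add: subst_F_def)
qed

lemma type_count_eq:
  assumes "ratio X \<noteq> 0"
  shows "type_count i X = card {T \<in> region \<bar>ratio X\<bar>. ttype (upright X) (col (corner X) (upright X) (coloring X)) T = i}"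
proof -
  define z where "z = corner X"
  define g where "g = upright X"
  have "unit_triangles (subdivision_vertices X) = tri z g ` region \<bar>ratio X\<bar>"
    unfolding subdivision_vertices_eq[OF assms] z_def g_def unit_triangles_pt region_eq[symmetric] ..
  then have "{t \<in> unit_triangles (subdivision_vertices X). triangle_type (coloring X) t = i} =
      tri z g ` {T \<in> region \<bar>ratio X\<bar>. ttype g (col z g (coloring X)) T = i}"
    by (auto simp del: tri.simps simp: triangle_type_tri)
  moreover have "inj_on (tri z g) A" for A by (simp only: inj_on_def tri_inj) blast
  ultimately show ?thesis
    unfolding type_count_def by (simp add: card_image z_def g_def)
qed

subsection \<open>The substitution matrix\<close>

text \<open>Column \<open>j\<close> consists of the moments of a triangle of type
  \<open>Suc j\<close>, so the matrix turns vectors of type counts into vectors of summed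
  moments.\<close>

definition moment_mat :: "real mat" where
  "moment_mat = mat 8 8 (\<lambda>(i, j).
    [[1, -1, 1, -1, 0, 0, 0, 0],
     [0, 0, 0, 0, -1, 1, -1, 1],
     [2, -2, -2, 2, 0, 0, 0, 0],
     [0, 0, 0, 0, 2, -2, -2, 2],
     [3, 1, -1, -3, 0, 0, 0, 0],
     [0, 0, 0, 0, -3, -1, 1, 3],
     [1, 1, 1, 1, -1, -1, -1, -1],
     [1, 1, 1, 1, 1, 1, 1, 1]] ! i ! j)"

definition moment_inv :: "real mat" where
  "moment_inv = mat 8 8 (\<lambda>(i, j).
    [[1/8, 0, 1/8, 0, 1/8, 0, 1/8, 1/8],
     [-3/8, 0, -1/8, 0, 1/8, 0, 1/8, 1/8],
     [3/8, 0, -1/8, 0, -1/8, 0, 1/8, 1/8],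
     [-1/8, 0, 1/8, 0, -1/8, 0, 1/8, 1/8],
     [0, -1/8, 0, 1/8, 0, -1/8, -1/8, 1/8],
     [0, 3/8, 0, -1/8, 0, -1/8, -1/8, 1/8],
     [0, -3/8, 0, -1/8, 0, 1/8, -1/8, 1/8],
     [0, 1/8, 0, 1/8, 0, 1/8, -1/8, 1/8]] ! i ! j)"

text \<open>The shape of the matrix of a composition of a positive even number of maps \<open>advance\<close>.\<close>

definition moment_step :: "real \<Rightarrow> real \<Rightarrow> real \<Rightarrow> real \<Rightarrow> real \<Rightarrow> real \<Rightarrow> real \<Rightarrow> real \<Rightarrow> real \<Rightarrow> real mat" where
  "moment_step s \<alpha> \<beta> \<gamma> \<delta> c p q r = mat 8 8 (\<lambda>(i, j).
    [[0, 0, -s, 0, \<gamma>, 0, \<delta>, 0],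
     [0, 0, 0, s, 0, \<gamma>, \<delta>, 0],
     [0, 0, 1, 0, \<alpha>, 0, \<beta>, 0],
     [0, 0, 0, 1, 0, -\<alpha>, -\<beta>, 0],
     [0, 0, 0, 0, p, 0, c, 0],
     [0, 0, 0, 0, 0, p, c, 0],
     [0, 0, 0, 0, 0, 0, q, 0],
     [0, 0, 0, 0, 0, 0, 0, r]] ! i ! j)"

lemma moment_mat_carrier [simp]: "moment_mat \<in> carrier_mat 8 8"
  and moment_inv_carrier [simp]: "moment_inv \<in> carrier_mat 8 8"
  and moment_step_carrier [simp]: "moment_step s \<alpha> \<beta> \<gamma> \<delta> c p q r \<in> carrier_mat 8 8"
  by (simp_all add: moment_mat_def moment_inv_def moment_step_def)

lemma sum_lessThan_8:
  fixes f :: "nat \<Rightarrow> real"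
  shows "(\<Sum>i<8. f i) = f 0 + f 1 + f 2 + f 3 + f 4 + f 5 + f 6 + f 7"
  by (simp add: eval_nat_numeral)

lemma all_less_8: "(\<forall>i<8. P i) \<longleftrightarrow> P 0 \<and> P (Suc 0) \<and> P 2 \<and> P 3 \<and> P 4 \<and> P 5 \<and> P 6 \<and> P (7 :: nat)"
  by (simp add: eval_nat_numeral All_less_Suc conj_ac)

lemma mult_mat_vec_8:
  assumes "A \<in> carrier_mat 8 8" "v \<in> carrier_vec 8" "i < 8"
  shows "vec_index (A *\<^sub>v v) i = (\<Sum>j<8. A $$ (i, j) * vec_index v j)"
  using assms by (auto simp: scalar_prod_def lessThan_atLeast0 intro!: sum.cong)

lemma mult_mat_8:
  fixes A B :: "real mat"
  assumes "A \<in> carrier_mat 8 8" "B \<in> carrier_mat 8 8" "i < 8" "j < 8"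
  shows "(A * B) $$ (i, j) = (\<Sum>l<8. A $$ (i, l) * B $$ (l, j))"
  using assms by (auto simp: scalar_prod_def lessThan_atLeast0 intro!: sum.cong)

lemma vec_eq_8_iff:
  fixes v w :: "real vec"
  assumes "v \<in> carrier_vec 8" "w \<in> carrier_vec 8"
  shows "v = w \<longleftrightarrow> (\<forall>i<8. vec_index v i = vec_index w i)"
  using assms by (metis carrier_vecD eq_vecI)

lemma mat_eq_8_iff:
  fixes A B :: "real mat"
  assumes "A \<in> carrier_mat 8 8" "B \<in> carrier_mat 8 8"
  shows "A = B \<longleftrightarrow> (\<forall>i<8. \<forall>j<8. A $$ (i, j) = B $$ (i, j))"
  using assms by (metis carrier_matD eq_matI)

lemma moment_mat_inverse: "moment_inv * moment_mat = 1\<^sub>m 8"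
proof -
  have "(moment_inv * moment_mat) $$ (i, j) = 1\<^sub>m 8 $$ (i, j)" if "i < 8" "j < 8" for i j
    unfolding mult_mat_8[OF moment_inv_carrier moment_mat_carrier that] sum_lessThan_8
    using that by (cases i rule: less_8_cases; cases j rule: less_8_cases)
      (simp_all add: moment_mat_def moment_inv_def)
  then show ?thesis
    by (subst mat_eq_8_iff) (auto simp: mult_carrier_mat[of _ 8 8])
qed

lemma moment_mat_inverse': "moment_mat * moment_inv = 1\<^sub>m 8"
  by (rule mat_mult_left_right_inverse[OF moment_inv_carrier moment_mat_carrier moment_mat_inverse])

lemma advance_list: "advance s (nth_default 0 [x0, x1, x2, x3, x4, x5, x6, x7]) = nth_default 0
    [- s * (x2 + x6), s * (x3 - x6), x2 + 2 * s * x4 - 2 * x6, x3 - 2 * s * x5 + 2 * x6,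
     - 2 * x4 - 3 * s * x6, - 2 * x5 - 3 * s * x6, 2 * x6, 4 * x7]"
  unfolding advance_def by (rule arg_cong[where f = "nth_default 0"]) (simp add: nth_default_def)

text \<open>Every \<open>advance\<close> discards moments 0 and 1, so only the sign of the outermost
  folding \<open>a 1\<close> reaches the first two rows. The rows pair up with shared coefficients
  because the substitutions commute with simultaneously swapping the two orientations and the two
  colors; this negates moments of odd degree and \<open>q 6\<close>.\<close>

lemma advances_eq:
  assumes "k > 0"
  obtains \<alpha> \<beta> \<gamma> \<delta> c where "\<And>q. advances a k q = nth_default 0
    [- fold_sign (a 1) * q 2 + \<gamma> * q 4 + \<delta> * q 6, fold_sign (a 1) * q 3 + \<gamma> * q 5 + \<delta> * q 6,
     q 2 + \<alpha> * q 4 + \<beta> * q 6, q 3 - \<alpha> * q 5 - \<beta> * q 6,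
     (- 2) ^ k * q 4 + c * q 6, (- 2) ^ k * q 5 + c * q 6, 2 ^ k * q 6, 4 ^ k * q 7]"
proof -
  have "\<exists>\<alpha> \<beta> \<gamma> \<delta> c. \<forall>q. advances a (Suc k) q = nth_default 0
    [- fold_sign (a 1) * q 2 + \<gamma> * q 4 + \<delta> * q 6, fold_sign (a 1) * q 3 + \<gamma> * q 5 + \<delta> * q 6,
     q 2 + \<alpha> * q 4 + \<beta> * q 6, q 3 - \<alpha> * q 5 - \<beta> * q 6,
     (- 2) ^ Suc k * q 4 + c * q 6, (- 2) ^ Suc k * q 5 + c * q 6, 2 ^ Suc k * q 6, 4 ^ Suc k * q 7]" for k
  proof (induction k arbitrary: a)
    case 0
    show ?case
      by (rule exI[of _ "2 * fold_sign (a 1)"], rule exI[of _ "-2"], rule exI[of _ 0],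
          rule exI[of _ "- fold_sign (a 1)"], rule exI[of _ "- 3 * fold_sign (a 1)"])
        (rule allI, unfold advances.simps advance_def,
         rule arg_cong[where f = "nth_default 0"], simp add: algebra_simps)
  next
    case (Suc k)
    define b where "b = (\<lambda>i. a (Suc i))"
    obtain \<alpha> \<beta> \<gamma> \<delta> c where IH: "\<And>q. advances b (Suc k) q = nth_default 0
      [- fold_sign (b 1) * q 2 + \<gamma> * q 4 + \<delta> * q 6, fold_sign (b 1) * q 3 + \<gamma> * q 5 + \<delta> * q 6,
       q 2 + \<alpha> * q 4 + \<beta> * q 6, q 3 - \<alpha> * q 5 - \<beta> * q 6,
       (- 2) ^ Suc k * q 4 + c * q 6, (- 2) ^ Suc k * q 5 + c * q 6, 2 ^ Suc k * q 6, 4 ^ Suc k * q 7]"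
      using Suc[of b] by blast
    have "advances a (Suc (Suc k)) q = advance (fold_sign (a 1)) (advances b (Suc k) q)" for q
      by (simp add: b_def)
    then show ?case
      unfolding IH advance_list
      by (intro allI arg_cong[where f = "nth_default 0"] exI[of _ "\<alpha> + 2 * fold_sign (a 1) * (- 2) ^ Suc k"] exI[of _ "\<beta> + 2 * fold_sign (a 1) * c - 2 * 2 ^ Suc k"]
          exI[of _ "- fold_sign (a 1) * \<alpha>"] exI[of _ "- fold_sign (a 1) * (\<beta> + 2 ^ Suc k)"]
          exI[of _ "- 2 * c - 3 * fold_sign (a 1) * 2 ^ Suc k"])
        (simp add: algebra_simps)
  qed
  then show ?thesis
    using that assms by (metis gr0_conv_Suc)
qed

lemma moment_eq_moment_mat:
  assumes "r < 8"
  shows "moment g \<psi> T r = moment_mat $$ (r, ttype g \<psi> T - 1)"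
proof -
  obtain b i j where T: "T = (b, i, j)" by (metis surj_pair)
  have *: "moment_of p (spin x) (spin y) (spin z) r = moment_mat $$ (r,
      (if p then 4 - (of_bool (x = Red) + of_bool (y = Red) + of_bool (z = Red))
       else 5 + (of_bool (x = Red) + of_bool (y = Red) + of_bool (z = Red))) - 1)" for p x y z
    using assms
    by (cases r rule: less_8_cases; cases p; cases x; cases y; cases z)
      (simp_all add: moment_of_simps moment_mat_def)
  show ?thesis
    unfolding T moment.simps * by (simp add: ttype_def)
qed

lemma ttype_range: "ttype g \<psi> T \<in> {1..8}"
  using reds_le_3[of \<psi> T] by (auto simp: ttype_def)

lemma sum_moment_eq:
  assumes "r < 8" and "finite A"
  shows "(\<Sum>T\<in>A. moment g \<psi> T r) =
    (\<Sum>i<8. moment_mat $$ (r, i) * real (card {T \<in> A. ttype g \<psi> T = Suc i}))"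
proof -
  have m: "moment g \<psi> T r = (\<Sum>i<8. if ttype g \<psi> T = Suc i then moment_mat $$ (r, i) else 0)" for T
  proof -
    have "(\<Sum>i<8. if ttype g \<psi> T = Suc i then moment_mat $$ (r, i) else 0) =
        (\<Sum>i<8. if i = ttype g \<psi> T - 1 then moment_mat $$ (r, i) else 0)"
      using ttype_range[of g \<psi> T] by (intro sum.cong refl) auto
    then show ?thesis
      using ttype_range[of g \<psi> T] by (auto simp: moment_eq_moment_mat[OF assms(1)] sum.delta)
  qed
  have "(\<Sum>T\<in>A. moment g \<psi> T r) = (\<Sum>i<8. \<Sum>T\<in>A. if ttype g \<psi> T = Suc i then moment_mat $$ (r, i) else 0)"
    unfolding m by (rule sum.swap)
  also have "\<dots> = (\<Sum>i<8. moment_mat $$ (r, i) * real (card {T \<in> A. ttype g \<psi> T = Suc i}))"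
    using assms(2) by (intro sum.cong refl) (simp add: sum.inter_filter[symmetric] mult.commute)
  finally show ?thesis .
qed

lemma card_ttype_eq:
  assumes "i < 8" and "finite A"
  shows "real (card {T \<in> A. ttype g \<psi> T = Suc i}) =
    (\<Sum>r<8. moment_inv $$ (i, r) * (\<Sum>T\<in>A. moment g \<psi> T r))"
proof -
  define x where "x = vec 8 (\<lambda>i. real (card {T \<in> A. ttype g \<psi> T = Suc i}))"
  define y where "y = vec 8 (\<lambda>r. \<Sum>T\<in>A. moment g \<psi> T r)"
  have [simp]: "x \<in> carrier_vec 8" "y \<in> carrier_vec 8" by (simp_all add: x_def y_def)
  have "y = moment_mat *\<^sub>v x"
    by (subst vec_eq_8_iff) (auto simp: mult_mat_vec_8 y_def x_def sum_moment_eq assms(2) intro!: mult_mat_vec_carrier[of _ 8 8] simp del: index_mult_mat_vec)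
  then have "moment_inv *\<^sub>v y = x"
    by (simp add: assoc_mult_mat_vec[symmetric, of _ 8 8 _ 8] moment_mat_inverse)
  then have "vec_index x i = (\<Sum>r<8. moment_inv $$ (i, r) * vec_index y r)"
    using assms(1) mult_mat_vec_8[of moment_inv y i] by simp
  then show ?thesis
    using assms(1) by (simp add: x_def y_def)
qed

text \<open>Makes the \<open>SOME\<close> in \<open>substitution_matrix\<close> meaningful for every
  column.\<close>

lemma unit_triangle_of_type_exists:
  assumes "j < 8"
  shows "\<exists>X. unit_triangle_of_type (Suc j) X"
proof -
  define n where "n = (if j < 4 then 1 else -1 :: int)"
  define \<rho> where "\<rho> = (if j < 4 then 3 - j else j - 4)"
  \<comment> \<open>The corner does not depend on the coloring, so a dummy coloring suffices to name
    the edges that \<open>f\<close> has to color.\<close>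
  define z where "z = corner (Colored_Triangle 0 n (\<lambda>_. Red))"
  define g where "g = (n > 0)"
  define f where "f e = (if e = edge z g Hor 0 0 then (if \<rho> \<ge> 1 then Red else Blue)
    else if e = edge z g Wst 0 0 then (if \<rho> \<ge> 2 then Red else Blue)
    else (if \<rho> \<ge> 3 then Red else Blue))" for e
  define X where "X = Colored_Triangle 0 n f"
  have n: "ratio X \<noteq> 0" "\<bar>ratio X\<bar> = 1" "upright X = g" "corner X = z" "coloring X = f"
    by (auto simp: X_def n_def g_def z_def corner_def)
  have "in_side 1 k l \<longleftrightarrow> (k, l) \<in> {(0, 0), (1, 0), (0, 1)}" for k l
    by (auto simp: in_side_def)
  then have "subdivision_vertices X = tri z g (True, 0, 0)"
    unfolding subdivision_vertices_eq[OF n(1)] n by auto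
  moreover have "ttype g (col z g f) (True, 0, 0) = Suc j"
  proof -
    have "reds (col z g f) (True, 0, 0) = \<rho>"
      using assms by (auto simp: col_def f_def edge_inj \<rho>_def simp del: edge.simps)
    then show ?thesis
      unfolding ttype_def using assms by (auto simp: g_def n_def \<rho>_def)
  qed
  ultimately have "unit_triangle_of_type (Suc j) X"
    unfolding unit_triangle_of_type_def n by (simp only: triangle_type_tri)
  then show ?thesis ..
qed

text \<open>The moments depend on the type alone. As they determine the moments of every substituted
  triangle, the matrix is independent of the triangle picked by \<open>SOME\<close>.\<close>

lemma total_unit_triangle:
  assumes "unit_triangle_of_type (Suc j) X" and "r < 8"
  shows "total X r = moment_mat $$ (r, j)"
proof -
  have n: "ratio X \<noteq> 0" "\<bar>ratio X\<bar> = 1" using assms by (auto simp: unit_triangle_of_type_def)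
  have "in_side 1 k l \<longleftrightarrow> (k, l) \<in> {(0, 0), (1, 0), (0, 1)}" for k l
    by (auto simp: in_side_def)
  then have V: "subdivision_vertices X = tri (corner X) (upright X) (True, 0, 0)"
    unfolding subdivision_vertices_eq[OF n(1)] n by auto
  have "region 1 = {(True, 0, 0)}"
    by (auto simp: region_def split: if_splits)
  then have "total X r = moment_mat $$ (r, ttype (upright X) (col (corner X) (upright X) (coloring X)) (True, 0, 0) - 1)"
    unfolding total_def n by (simp add: moment_eq_moment_mat[OF assms(2)] del: moment.simps)
  then show ?thesis
    using assms(1) unfolding unit_triangle_of_type_def V triangle_type_tri by simp
qed

text \<open>Both sides list, in column \<open>j\<close>, the summed moments of the image of a unit
  triangle of type \<open>Suc j\<close>: on the left counted by types, on the right obtained by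
  \<open>advances\<close>.\<close>

lemma moment_mat_substitution_matrix:
  assumes "even k" "k > 0"
  obtains \<alpha> \<beta> \<gamma> \<delta> c where "moment_mat * substitution_matrix (subst_comp a k) =
    moment_step (fold_sign (a 1)) \<alpha> \<beta> \<gamma> \<delta> c (2 ^ k) (2 ^ k) (4 ^ k) * moment_mat"
proof -
  obtain \<alpha> \<beta> \<gamma> \<delta> c where adv: "\<And>q. advances a k q = nth_default 0
    [- fold_sign (a 1) * q 2 + \<gamma> * q 4 + \<delta> * q 6, fold_sign (a 1) * q 3 + \<gamma> * q 5 + \<delta> * q 6,
     q 2 + \<alpha> * q 4 + \<beta> * q 6, q 3 - \<alpha> * q 5 - \<beta> * q 6,
     (- 2) ^ k * q 4 + c * q 6, (- 2) ^ k * q 5 + c * q 6, 2 ^ k * q 6, 4 ^ k * q 7]"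
    by (rule advances_eq[OF assms(2), of a], rule that)
  let ?M = "substitution_matrix (subst_comp a k)"
  let ?U = "moment_step (fold_sign (a 1)) \<alpha> \<beta> \<gamma> \<delta> c (2 ^ k) (2 ^ k) (4 ^ k)"
  have M: "?M \<in> carrier_mat 8 8" by (simp add: substitution_matrix_def)
  \<comment> \<open>Parity enters here: the degree one eigenvalues merge with the eigenvalue of
    moment 6.\<close>
  have p: "(- 2) ^ k = (2 :: real) ^ k" using assms(1) by simp
  have "\<forall>r<8. \<forall>j<8. (moment_mat * ?M) $$ (r, j) = (?U * moment_mat) $$ (r, j)"
  proof (intro allI impI)
    fix r j :: nat assume r: "r < 8" and j: "j < 8"
    define X where "X = (SOME X. unit_triangle_of_type (Suc j) X)"
    have X: "unit_triangle_of_type (Suc j) X"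
      unfolding X_def using unit_triangle_of_type_exists[OF j] by (rule someI_ex)
    then have "ratio X \<noteq> 0" by (auto simp: unit_triangle_of_type_def)
    note tot = total_subst_comp[OF this, of a k]
    let ?Y = "subst_comp a k X"
    have Y: "ratio ?Y \<noteq> 0" using tot \<open>ratio X \<noteq> 0\<close> by simp
    have "(moment_mat * ?M) $$ (r, j) = (\<Sum>i<8. moment_mat $$ (r, i) * real (type_count (Suc i) ?Y))"
      unfolding mult_mat_8[OF moment_mat_carrier M r j]
      using j by (intro sum.cong) (simp_all add: substitution_matrix_def X_def)
    also have "\<dots> = total ?Y r"
      unfolding total_def sum_moment_eq[OF r finite_region] type_count_eq[OF Y] ..
    also have "\<dots> = advances a k (total X) r" using tot by simp
    also have "\<dots> = (\<Sum>i<8. ?U $$ (r, i) * total X i)"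
      using r unfolding adv p
      by (cases r rule: less_8_cases)
        (simp_all add: sum_lessThan_8 moment_step_def nth_default_def)
    also have "\<dots> = (?U * moment_mat) $$ (r, j)"
      using total_unit_triangle[OF X] by (simp add: mult_mat_8[OF _ _ r j])
    finally show "(moment_mat * ?M) $$ (r, j) = (?U * moment_mat) $$ (r, j)" .
  qed
  then have "moment_mat * ?M = ?U * moment_mat"
    using M by (subst mat_eq_8_iff) (auto intro!: mult_carrier_mat[of _ 8 8 _ 8])
  then show ?thesis by (rule that)
qed

section \<open>Linear algebra of the triangular form\<close>

lemma kernel_dim_eq_card:
  fixes A :: "real mat"
  assumes A: "A \<in> carrier_mat nr nc" and I: "I \<subseteq> {..<nc}"
    and b: "\<And>p. p \<in> I \<Longrightarrow> b p \<in> mat_kernel A"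
    and delta: "\<And>p q. p \<in> I \<Longrightarrow> q \<in> I \<Longrightarrow> vec_index (b p) q = of_bool (p = q)"
    and determined: "\<And>v. v \<in> mat_kernel A \<Longrightarrow> (\<forall>p\<in>I. vec_index v p = 0) \<Longrightarrow> v = 0\<^sub>v nc"
  shows "kernel_dim A = card I"
proof -
  interpret kernel nr nc A by (unfold_locales, rule A)
  have fin: "finite I" using I finite_subset by blast
  have inj: "inj_on b I"
    by (rule inj_onI) (metis delta of_bool_eq_1_iff)
  have sub: "b ` I \<subseteq> mat_kernel A" using b by auto
  \<comment> \<open>By \<open>delta\<close>, a coordinate in \<open>I\<close> of a linear
    combination is one of its coefficients. This yields independence at once, and spanning by
    subtracting the combination that matches \<open>v\<close> on \<open>I\<close>.\<close>
  have index: "vec_index (lincomb a (b ` I)) q = a (b q)" if "q \<in> I" for a q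
  proof -
    have "vec_index (lincomb a (b ` I)) q = (\<Sum>p\<in>I. a (b p) * vec_index (b p) q)"
      using I that by (subst lincomb_index[OF _ sub]) (auto simp: sum.reindex[OF inj])
    also have "\<dots> = (\<Sum>p\<in>I. if p = q then a (b p) else 0)"
      using delta that by (intro sum.cong) auto
    also have "\<dots> = a (b q)" using fin that by simp
    finally show ?thesis .
  qed
  have "mat_kernel A \<subseteq> span (b ` I)"
  proof
    fix v assume v: "v \<in> mat_kernel A"
    define a where "a x = vec_index v (the_inv_into I b x)" for x
    define w where "w = lincomb a (b ` I)"
    have w: "w \<in> mat_kernel A"
      unfolding w_def by (rule Ker.lincomb_closed[OF sub]) auto
    have car: "v \<in> carrier_vec nc" "w \<in> carrier_vec nc" using v w mat_kernel[OF A] by auto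
    have "v - w \<in> mat_kernel A"
      using v w car A by (auto simp: mat_kernel[OF A] mult_minus_distrib_mat_vec[OF A])
    moreover have "\<forall>p\<in>I. vec_index (v - w) p = 0"
      using car I by (auto simp: w_def index a_def the_inv_into_f_f[OF inj])
    ultimately have "v - w = 0\<^sub>v nc" by (rule determined)
    then have "vec_index (v - w) i = 0" if "i < nc" for i
      using that by simp
    then have "v = w"
      using car by (intro eq_vecI) auto
    moreover have "w \<in> span (b ` I)"
      unfolding w_def Ker.span_def using fin by blast
    ultimately show "v \<in> span (b ` I)" by simp
  qed
  moreover have "span (b ` I) \<subseteq> mat_kernel A" using sub by (rule Ker.span_is_subset2)
  moreover have "lin_indpt (b ` I)"
  proof (rule Ker.finite_lin_indpt2)
    fix a assume "lincomb a (b ` I) = 0\<^sub>v nc"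
    then have "a (b q) = 0" if "q \<in> I" for q
      using index[OF that, of a] I that by auto
    then show "\<forall>v\<in>b ` I. a v = 0" by blast
  qed (use fin sub in auto)
  ultimately have "basis (b ` I)"
    unfolding Ker.basis_def using sub by auto
  then have "dim = card (b ` I)"
    using Ker.dim_basis[of "b ` I"] fin by auto
  then show ?thesis
    by (simp add: card_image[OF inj])
qed

lemma vec_span_pair:
  assumes "u \<in> carrier_vec n" "v \<in> carrier_vec n"
  shows "vec_span n {u, v} = {x \<cdot>\<^sub>v u + y \<cdot>\<^sub>v v | x y. True}"
proof -
  interpret vec_space "TYPE(real)" n .
  have *: "lincomb_list c [u, v] = c 0 \<cdot>\<^sub>v u + c (Suc 0) \<cdot>\<^sub>v v" for c
    using assms by (simp add: lincomb_list_def)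
  have "vec_span n {u, v} = span_list [u, v]"
    unfolding vec_span_def using span_list_as_span[of "[u, v]"] assms by simp
  also have "\<dots> = {x \<cdot>\<^sub>v u + y \<cdot>\<^sub>v v | x y. True}"
    unfolding span_list_def *
  proof (intro equalityI subsetI, goal_cases)
    case (1 w)
    then show ?case by blast
  next
    case (2 w)
    then obtain x y where "w = x \<cdot>\<^sub>v u + y \<cdot>\<^sub>v v" by blast
    then show ?case
      by (intro CollectI exI[of _ "\<lambda>i. if i = 0 then x else y"]) (auto simp: class_ring_simps)
  qed
  finally show ?thesis .
qed

lemma mat_kernel_char_matrix_iff:
  fixes A :: "real mat"
  assumes "A \<in> carrier_mat n n"
  shows "v \<in> mat_kernel (char_matrix A e) \<longleftrightarrow> v \<in> carrier_vec n \<and> A *\<^sub>v v = e \<cdot>\<^sub>v v"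
proof (cases "v = 0\<^sub>v n")
  case True
  then show ?thesis
    using assms by (auto simp: mat_kernel_def char_matrix_def)
next
  case False
  have "eigenvector A v e \<longleftrightarrow> v \<in> carrier_vec n \<and> v \<noteq> 0\<^sub>v n \<and> char_matrix A e *\<^sub>v v = 0\<^sub>v n"
    by (rule eigenvector_char_matrix[OF assms])
  moreover have "dim_row A = n" using assms by auto
  ultimately show ?thesis
    using False assms unfolding mat_kernel[OF char_matrix_closed[OF assms]] eigenvector_def by auto
qed

lemma moment_mat_mult_vec:
  assumes "v \<in> carrier_vec 8"
  shows "vec_index (moment_mat *\<^sub>v v) 0 = vec_index v 0 - vec_index v 1 + vec_index v 2 - vec_index v 3"
    "vec_index (moment_mat *\<^sub>v v) 1 = - vec_index v 4 + vec_index v 5 - vec_index v 6 + vec_index v 7"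
    "vec_index (moment_mat *\<^sub>v v) 2 = 2 * vec_index v 0 - 2 * vec_index v 1 - 2 * vec_index v 2 + 2 * vec_index v 3"
    "vec_index (moment_mat *\<^sub>v v) 3 = 2 * vec_index v 4 - 2 * vec_index v 5 - 2 * vec_index v 6 + 2 * vec_index v 7"
    "vec_index (moment_mat *\<^sub>v v) 4 = 3 * vec_index v 0 + vec_index v 1 - vec_index v 2 - 3 * vec_index v 3"
    "vec_index (moment_mat *\<^sub>v v) 5 = - 3 * vec_index v 4 - vec_index v 5 + vec_index v 6 + 3 * vec_index v 7"
    "vec_index (moment_mat *\<^sub>v v) 6 = vec_index v 0 + vec_index v 1 + vec_index v 2 + vec_index v 3 - vec_index v 4 - vec_index v 5 - vec_index v 6 - vec_index v 7"
    "vec_index (moment_mat *\<^sub>v v) 7 = vec_index v 0 + vec_index v 1 + vec_index v 2 + vec_index v 3 + vec_index v 4 + vec_index v 5 + vec_index v 6 + vec_index v 7"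
  by (simp_all only: mult_mat_vec_8[OF moment_mat_carrier assms, simplified] sum_lessThan_8)
    (simp_all add: moment_mat_def)

text \<open>\<open>p\<close> and \<open>r\<close> stand for \<open>2 ^ k\<close> and
  \<open>4 ^ k\<close>; the inequalities 1 < p < r are what separates the eigenvalues.\<close>

locale moment_similar =
  fixes M :: "real mat" and s \<alpha> \<beta> \<gamma> \<delta> c p r :: real
  assumes M: "M \<in> carrier_mat 8 8"
    and MU: "moment_mat * M = moment_step s \<alpha> \<beta> \<gamma> \<delta> c p p r * moment_mat"
    and s: "s = 1 \<or> s = -1" and p: "p > 1" and r: "r > p"
begin

definition U :: "real mat" where "U = moment_step s \<alpha> \<beta> \<gamma> \<delta> c p p r"

lemma U_carrier [simp]: "U \<in> carrier_mat 8 8"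
  by (simp add: U_def)

lemma U_entries:
  assumes "w \<in> carrier_vec 8"
  shows "vec_index (U *\<^sub>v w) 0 = - s * vec_index w 2 + \<gamma> * vec_index w 4 + \<delta> * vec_index w 6"
    "vec_index (U *\<^sub>v w) (Suc 0) = s * vec_index w 3 + \<gamma> * vec_index w 5 + \<delta> * vec_index w 6"
    "vec_index (U *\<^sub>v w) 2 = vec_index w 2 + \<alpha> * vec_index w 4 + \<beta> * vec_index w 6"
    "vec_index (U *\<^sub>v w) 3 = vec_index w 3 - \<alpha> * vec_index w 5 - \<beta> * vec_index w 6"
    "vec_index (U *\<^sub>v w) 4 = p * vec_index w 4 + c * vec_index w 6"
    "vec_index (U *\<^sub>v w) 5 = p * vec_index w 5 + c * vec_index w 6"
    "vec_index (U *\<^sub>v w) 6 = p * vec_index w 6"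
    "vec_index (U *\<^sub>v w) 7 = r * vec_index w 7"
  using assms
  by (simp_all only: mult_mat_vec_8[OF U_carrier assms, simplified] sum_lessThan_8)
    (simp_all add: U_def moment_step_def)

lemma similar: "similar_mat_wit M U moment_inv moment_mat"
proof (rule similar_mat_witI[OF moment_mat_inverse moment_mat_inverse' _ M])
  have "M = (moment_inv * moment_mat) * M" using M by (simp add: moment_mat_inverse)
  also have "\<dots> = moment_inv * (moment_mat * M)"
    using M by (intro assoc_mult_mat[of _ 8 8 _ 8 _ 8]) auto
  also have "\<dots> = moment_inv * U * moment_mat"
    unfolding MU U_def[symmetric] by (rule assoc_mult_mat[of _ 8 8 _ 8 _ 8, symmetric]) auto
  finally show "M = moment_inv * U * moment_mat" .
qed auto

lemma char_poly_eq: "char_poly M = (\<Prod>x\<leftarrow>[0, 0, 1, 1, p, p, p, r]. [:- x, 1:])"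
proof -
  have "char_poly M = char_poly U"
    using similar by (intro char_poly_similar) (auto simp: similar_mat_def)
  also have "\<dots> = (\<Prod>x\<leftarrow>diag_mat U. [:- x, 1:])"
  proof (rule char_poly_upper_triangular[OF U_carrier])
    have "U $$ (i, j) = 0" if "i < 8" "j < i" for i j
      using that
      by (cases i rule: less_8_cases; cases j rule: less_8_cases) (simp_all add: U_def moment_step_def)
    then show "upper_triangular U"
      unfolding upper_triangular_def carrier_matD(1)[OF U_carrier] by auto
  qed
  also have "diag_mat U = [0, 0, 1, 1, p, p, p, r]"
  proof -
    have "dim_row U = 8" using U_carrier by (rule carrier_matD(1))
    then show ?thesis
      unfolding diag_mat_def by (simp add: U_def moment_step_def upt_conv_Cons)
  qed
  finally show ?thesis .
qed

lemma eigen_iff: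
  assumes "v \<in> carrier_vec 8"
  shows "M *\<^sub>v v = e \<cdot>\<^sub>v v \<longleftrightarrow> U *\<^sub>v (moment_mat *\<^sub>v v) = e \<cdot>\<^sub>v (moment_mat *\<^sub>v v)" (is "?L \<longleftrightarrow> ?R")
proof -
  have "moment_mat *\<^sub>v (M *\<^sub>v v) = (moment_mat * M) *\<^sub>v v"
    using M assms by (intro assoc_mult_mat_vec[symmetric, of _ 8 8 _ 8]) auto
  also have "\<dots> = U *\<^sub>v (moment_mat *\<^sub>v v)"
    unfolding MU U_def using assms by (intro assoc_mult_mat_vec[of _ 8 8 _ 8]) auto
  finally have *: "moment_mat *\<^sub>v (M *\<^sub>v v) = U *\<^sub>v (moment_mat *\<^sub>v v)" .
  have **: "moment_mat *\<^sub>v (e \<cdot>\<^sub>v v) = e \<cdot>\<^sub>v (moment_mat *\<^sub>v v)"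
    using assms by (intro mult_mat_vec[of _ 8 8]) auto
  have "moment_inv *\<^sub>v (moment_mat *\<^sub>v x) = x" if "x \<in> carrier_vec 8" for x
    using that by (simp add: assoc_mult_mat_vec[symmetric, of _ 8 8 _ 8] moment_mat_inverse)
  moreover have "M *\<^sub>v v \<in> carrier_vec 8" "e \<cdot>\<^sub>v v \<in> carrier_vec 8" using M assms by auto
  ultimately show ?thesis
    using * ** by metis
qed

lemma eigenspace_iff:
  "v \<in> eigenspace M e \<longleftrightarrow> v \<in> carrier_vec 8 \<and> U *\<^sub>v (moment_mat *\<^sub>v v) = e \<cdot>\<^sub>v (moment_mat *\<^sub>v v)"
  unfolding eigenspace_def mat_kernel_char_matrix_iff[OF M] using eigen_iff by blast

lemma eigenspace_coords:
  assumes "v \<in> carrier_vec 8" and w: "w = moment_mat *\<^sub>v v"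
  shows "v \<in> eigenspace M e \<longleftrightarrow>
    - s * vec_index w 2 + \<gamma> * vec_index w 4 + \<delta> * vec_index w 6 = e * vec_index w 0 \<and>
    s * vec_index w 3 + \<gamma> * vec_index w 5 + \<delta> * vec_index w 6 = e * vec_index w 1 \<and>
    vec_index w 2 + \<alpha> * vec_index w 4 + \<beta> * vec_index w 6 = e * vec_index w 2 \<and>
    vec_index w 3 - \<alpha> * vec_index w 5 - \<beta> * vec_index w 6 = e * vec_index w 3 \<and>
    p * vec_index w 4 + c * vec_index w 6 = e * vec_index w 4 \<and>
    p * vec_index w 5 + c * vec_index w 6 = e * vec_index w 5 \<and>
    p * vec_index w 6 = e * vec_index w 6 \<and> r * vec_index w 7 = e * vec_index w 7"
proof -
  have wc: "w \<in> carrier_vec 8" unfolding w using assms by (intro mult_mat_vec_carrier[of _ 8 8]) auto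
  have "U *\<^sub>v w \<in> carrier_vec 8" "e \<cdot>\<^sub>v w \<in> carrier_vec 8" "dim_vec w = 8"
    using wc by (auto intro!: mult_mat_vec_carrier[of _ 8 8])
  then show ?thesis
    unfolding eigenspace_iff w[symmetric] using assms(1)
    by (simp add: vec_eq_8_iff all_less_8 U_entries[OF wc] del: index_mult_mat_vec)
qed

end

text \<open>Below \<open>p\<close>, coordinates 6 and 7 are killed by the nonzero factors p - e and
  r - e, and then coordinates 4 and 5 by p - e.\<close>

lemma (in moment_similar) eigenspace_small:
  assumes "v \<in> eigenspace M e" and w: "w = moment_mat *\<^sub>v v" and "e < p"
  shows "v \<in> carrier_vec 8" "vec_index w 4 = 0" "vec_index w 5 = 0" "vec_index w 6 = 0" "vec_index w 7 = 0"
    "- s * vec_index w 2 = e * vec_index w 0" "s * vec_index w 3 = e * vec_index w 1"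
    "vec_index w 2 = e * vec_index w 2" "vec_index w 3 = e * vec_index w 3"
proof -
  show vc: "v \<in> carrier_vec 8" using assms(1) unfolding eigenspace_iff by blast
  note coords = assms(1)[unfolded eigenspace_coords[OF vc w]]
  have "p \<noteq> e" "r \<noteq> e" using \<open>e < p\<close> r by auto
  then show w6: "vec_index w 6 = 0" and w7: "vec_index w 7 = 0" using coords by simp_all
  then show w4: "vec_index w 4 = 0" and w5: "vec_index w 5 = 0" using coords \<open>p \<noteq> e\<close> by simp_all
  show "- s * vec_index w 2 = e * vec_index w 0" "s * vec_index w 3 = e * vec_index w 1"
    "vec_index w 2 = e * vec_index w 2" "vec_index w 3 = e * vec_index w 3"
    using coords w4 w5 w6 by simp_all
qed

lemma vec_of_list_8_carrier: "vec_of_list [x0, x1, x2, x3, x4, x5, x6, x7] \<in> carrier_vec 8"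
  by (rule carrier_vecI) simp

lemma vec_span_8_iff:
  assumes "v \<in> carrier_vec 8" "length us = 8" "length ws = 8"
  shows "v \<in> vec_span 8 {vec_of_list us, vec_of_list ws} \<longleftrightarrow>
    (\<exists>x y. \<forall>i<8. vec_index v i = x * us ! i + y * ws ! i)"
proof -
  have c: "vec_of_list us \<in> carrier_vec 8" "vec_of_list ws \<in> carrier_vec 8"
    using assms by (auto intro: carrier_vecI)
  have "v = x \<cdot>\<^sub>v vec_of_list us + y \<cdot>\<^sub>v vec_of_list ws \<longleftrightarrow> (\<forall>i<8. vec_index v i = x * us ! i + y * ws ! i)" for x y
    using c assms by (subst vec_eq_8_iff) (auto simp: vec_of_list_index)
  then show ?thesis
    unfolding vec_span_pair[OF c] by blast
qed

lemma (in moment_similar) eigenspace_eq_spanI: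
  assumes len: "length us = 8" "length ws = 8"
    and fwd: "\<And>v. v \<in> carrier_vec 8 \<Longrightarrow> v \<in> eigenspace M e \<Longrightarrow>
      \<exists>x y. \<forall>i<8. vec_index v i = x * us ! i + y * ws ! i"
    and bwd: "\<And>v x y. v \<in> carrier_vec 8 \<Longrightarrow> \<forall>i<8. vec_index v i = x * us ! i + y * ws ! i \<Longrightarrow>
      v \<in> eigenspace M e"
  shows "eigenspace M e = vec_span 8 {vec_of_list us, vec_of_list ws}"
proof -
  have c: "vec_of_list us \<in> carrier_vec 8" "vec_of_list ws \<in> carrier_vec 8"
    using len by (auto intro: carrier_vecI)
  have "eigenspace M e \<subseteq> carrier_vec 8" using eigenspace_iff by blast
  moreover have "vec_span 8 {vec_of_list us, vec_of_list ws} \<subseteq> carrier_vec 8"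
    unfolding vec_span_pair[OF c] using c by auto
  moreover have "v \<in> eigenspace M e \<longleftrightarrow> v \<in> vec_span 8 {vec_of_list us, vec_of_list ws}"
    if "v \<in> carrier_vec 8" for v
    unfolding vec_span_8_iff[OF that len] using fwd[OF that] bwd[OF that] by blast
  ultimately show ?thesis by blast
qed

text \<open>Only the degree three moments survive. On each orientation, such a vector is orthogonal
  to all polynomials of degree at most two in the number of red sides, hence a multiple of the third
  difference with its signed binomial coefficients.\<close>

lemma (in moment_similar) eigenspace_0:
  "eigenspace M 0 =
     vec_span 8 {vec_of_list [1, -3, 3, -1, 0, 0, 0, 0], vec_of_list [0, 0, 0, 0, 1, -3, 3, -1]}"
    (is "_ = vec_span 8 {vec_of_list ?us, vec_of_list ?ws}")
proof (rule eigenspace_eq_spanI)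
  fix v :: "real vec" assume vc: "v \<in> carrier_vec 8" and v: "v \<in> eigenspace M 0"
  have "0 < p" using p by simp
  note w = eigenspace_small(2-5,8,9)[OF v refl this, unfolded mult_zero_left moment_mat_mult_vec[OF vc]]
  have "vec_index v 1 = - 3 * vec_index v 0" "vec_index v 2 = 3 * vec_index v 0"
    "vec_index v 3 = - vec_index v 0" "vec_index v 5 = - 3 * vec_index v 4"
    "vec_index v 6 = 3 * vec_index v 4" "vec_index v 7 = - vec_index v 4"
    using w by linarith+
  then have "\<forall>i<8. vec_index v i = vec_index v 0 * ?us ! i + vec_index v 4 * ?ws ! i"
    unfolding all_less_8 by simp
  then show "\<exists>x y. \<forall>i<8. vec_index v i = x * ?us ! i + y * ?ws ! i" by blast
next
  fix v :: "real vec" and x y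
  assume vc: "v \<in> carrier_vec 8" and v: "\<forall>i<8. vec_index v i = x * ?us ! i + y * ?ws ! i"
  show "v \<in> eigenspace M 0"
    unfolding eigenspace_coords[OF vc refl] moment_mat_mult_vec[OF vc]
    using v unfolding all_less_8 by simp
qed simp_all

text \<open>The moments of degree zero and one vanish, which on each orientation leaves the span of
  two second differences, (1,-2,1,0) and (0,1,-2,1). The relation between the moments of degree
  three and two selects one of them, according to \<open>s\<close>.\<close>

lemma (in moment_similar) eigenspace_1:
  assumes us: "us = (if s = 1 then [0, 1, -2, 1, 0, 0, 0, 0] else [1, -2, 1, 0, 0, 0, 0, 0])"
    and ws: "ws = (if s = 1 then [0, 0, 0, 0, 0, 1, -2, 1] else [0, 0, 0, 0, 1, -2, 1, 0])"
  shows "eigenspace M 1 = vec_span 8 {vec_of_list us, vec_of_list ws}"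
proof (rule eigenspace_eq_spanI)
  fix v :: "real vec" assume vc: "v \<in> carrier_vec 8" and v: "v \<in> eigenspace M 1"
  note w = eigenspace_small(2-7)[OF v refl p, unfolded mult_1_left moment_mat_mult_vec[OF vc]]
  show "\<exists>x y. \<forall>i<8. vec_index v i = x * us ! i + y * ws ! i"
  proof (cases "s = 1")
    case True
    have "vec_index v 0 = 0" "vec_index v 2 = - 2 * vec_index v 1" "vec_index v 3 = vec_index v 1"
      "vec_index v 4 = 0" "vec_index v 6 = - 2 * vec_index v 5" "vec_index v 7 = vec_index v 5"
      using w unfolding True mult_1_left mult_minus1 by linarith+
    then have "\<forall>i<8. vec_index v i = vec_index v 1 * us ! i + vec_index v 5 * ws ! i"
      unfolding all_less_8 us ws using True by simp
    then show ?thesis by blast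
  next
    case False
    then have s': "s = -1" using s by simp
    have "vec_index v 3 = 0" "vec_index v 1 = - 2 * vec_index v 0" "vec_index v 2 = vec_index v 0"
      "vec_index v 7 = 0" "vec_index v 5 = - 2 * vec_index v 4" "vec_index v 6 = vec_index v 4"
      using w unfolding s' minus_minus mult_1_left mult_minus1 by linarith+
    then have "\<forall>i<8. vec_index v i = vec_index v 0 * us ! i + vec_index v 4 * ws ! i"
      unfolding all_less_8 us ws using False by simp
    then show ?thesis by blast
  qed
next
  fix v :: "real vec" and x y
  assume vc: "v \<in> carrier_vec 8" and v: "\<forall>i<8. vec_index v i = x * us ! i + y * ws ! i"
  show "v \<in> eigenspace M 1"
    unfolding eigenspace_coords[OF vc refl] moment_mat_mult_vec[OF vc]
    using v s unfolding all_less_8 us ws by (elim disjE) simp_all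
qed (simp_all add: us ws)

lemma (in moment_similar) eigenvector_r:
  "eigenvector M (vec_of_list [1, 1, 1, 1, 1, 1, 1, 1]) r"
proof -
  define v :: "real vec" where "v = vec_of_list [1, 1, 1, 1, 1, 1, 1, 1]"
  have vc: "v \<in> carrier_vec 8" unfolding v_def by (rule vec_of_list_8_carrier)
  have v: "\<forall>i<8. vec_index v i = 1"
    unfolding all_less_8 v_def vec_of_list_index by simp
  have "v \<in> eigenspace M r"
    unfolding eigenspace_coords[OF vc refl] moment_mat_mult_vec[OF vc]
    using v unfolding all_less_8 by simp
  then have "M *\<^sub>v v = r \<cdot>\<^sub>v v"
    unfolding eigenspace_def mat_kernel_char_matrix_iff[OF M] by blast
  moreover have "v \<noteq> 0\<^sub>v 8"
  proof
    assume "v = 0\<^sub>v 8"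
    then have "vec_index v 0 = 0" by simp
    then show False using v by simp
  qed
  moreover have "dim_row M = 8" using M by auto
  ultimately show ?thesis
    unfolding eigenvector_def v_def[symmetric] using vc by simp
qed

text \<open>In moment coordinates, entries 4, 5 and 6 determine an eigenvector, and the only
  constraint between them is that \<open>c\<close> times entry 6 vanishes. For two foldings,
  \<open>c\<close> is 6 times the difference of their signs, so both dimensions occur.\<close>

lemma (in moment_similar) eigenspace_dim_p: "eigenspace_dim M p \<in> {2, 3}"
proof -
  define A where "A = char_matrix U p"
  have A: "A \<in> carrier_mat 8 8" unfolding A_def by simp
  have "kernel.dim 8 (char_matrix M p) = kernel.dim 8 A"
    unfolding A_def
    by (rule similar_mat_wit_kernel_dim[OF _ similar_mat_wit_char_matrix[OF similar]]) (use M in simp)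
  then have "eigenspace_dim M p = kernel_dim A"
    unfolding eigenspace_dim_def kernel_dim_def
    using carrier_matD(2)[OF char_matrix_closed[OF M, of p]] carrier_matD(2)[OF A] by simp
  also have "kernel_dim A \<in> {2, 3}"
  proof -
    have ker: "w \<in> mat_kernel A \<longleftrightarrow> w \<in> carrier_vec 8 \<and>
      (- s * vec_index w 2 + \<gamma> * vec_index w 4 + \<delta> * vec_index w 6 = p * vec_index w 0 \<and>
       s * vec_index w 3 + \<gamma> * vec_index w 5 + \<delta> * vec_index w 6 = p * vec_index w 1 \<and>
       vec_index w 2 + \<alpha> * vec_index w 4 + \<beta> * vec_index w 6 = p * vec_index w 2 \<and>
       vec_index w 3 - \<alpha> * vec_index w 5 - \<beta> * vec_index w 6 = p * vec_index w 3 \<and>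
       c * vec_index w 6 = 0 \<and> r * vec_index w 7 = p * vec_index w 7)" for w
    proof -
      have "U *\<^sub>v w = p \<cdot>\<^sub>v w \<longleftrightarrow> (\<forall>i<8. vec_index (U *\<^sub>v w) i = p * vec_index w i)" if "w \<in> carrier_vec 8"
        using that by (subst vec_eq_8_iff) (auto intro!: mult_mat_vec_carrier[of _ 8 8] simp del: index_mult_mat_vec)
      then show ?thesis
        unfolding A_def mat_kernel_char_matrix_iff[OF U_carrier] all_less_8
        using U_entries[of w] by auto
    qed
    \<comment> \<open>One of the entries 4, 5, 6 is set to 1 and the triangular system is solved
      upwards: entries 2 and 3 need a division by p - 1, entries 0 and 1 a division by p.\<close>
    define b where "b q = vec_of_list
      (let x = of_bool (q = (4::nat)); y = of_bool (q = 5); t = of_bool (q = 6);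
           u = (\<alpha> * x + \<beta> * t) / (p - 1); v = - (\<alpha> * y + \<beta> * t) / (p - 1)
       in [(- s * u + \<gamma> * x + \<delta> * t) / p, (s * v + \<gamma> * y + \<delta> * t) / p, u, v, x, y, t, 0])" for q
    have bker: "b q \<in> mat_kernel A" if "q \<in> {4, 5} \<or> c = 0" for q
    proof -
      have "b q \<in> carrier_vec 8" unfolding b_def Let_def by (rule vec_of_list_8_carrier)
      moreover have "u + a = p * u" if "u = a / (p - 1)" for u a :: real
        using that p by (simp add: field_simps)
      ultimately show ?thesis
        unfolding ker using p that
        by (simp add: b_def Let_def vec_of_list_index del: vec_of_list_Cons) (auto simp: field_simps)
    qed
    have det: "w = 0\<^sub>v 8" if "w \<in> mat_kernel A" "vec_index w 4 = 0" "vec_index w 5 = 0" "c \<noteq> 0 \<or> vec_index w 6 = 0" for w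
    proof -
      have wc: "w \<in> carrier_vec 8" using that(1) unfolding ker by blast
      note k = that(1)[unfolded ker, THEN conjunct2]
      have w6: "vec_index w 6 = 0" using k that(4) by auto
      have w7: "vec_index w 7 = 0" using k r by simp
      have w2: "vec_index w 2 = 0" and w3: "vec_index w 3 = 0" using k that(2,3) w6 p by simp_all
      have w0: "vec_index w 0 = 0" and w1: "vec_index w (Suc 0) = 0" using k that(2,3) w6 w2 w3 p by simp_all
      have "\<forall>i<8. vec_index w i = 0"
        unfolding all_less_8 using that(2,3) w0 w1 w2 w3 w6 w7 by simp
      then show ?thesis using wc by (subst vec_eq_8_iff) auto
    qed
    have delta: "vec_index (b q) q' = of_bool (q = q')" if "q \<in> {4, 5, 6}" "q' \<in> {4, 5, 6}" for q q'
      using that unfolding b_def Let_def vec_of_list_index by auto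
    show ?thesis
    proof (cases "c = 0")
      case True
      have "kernel_dim A = card {4, 5, 6 :: nat}"
        by (rule kernel_dim_eq_card[OF A, of _ b]) (use bker det delta True in auto)
      then show ?thesis by simp
    next
      case False
      have "kernel_dim A = card {4, 5 :: nat}"
        by (rule kernel_dim_eq_card[OF A, of _ b]) (use bker det delta False in auto)
      then show ?thesis by simp
    qed
  qed
  finally show ?thesis .
qed

lemma (in moment_similar) perron_frobenius_r:
  assumes "\<And>i j. i < 8 \<Longrightarrow> j < 8 \<Longrightarrow> M $$ (i, j) \<ge> 0"
  shows "perron_frobenius_eigenvalue M r"
proof -
  have dims: "dim_row M = 8" "dim_col M = 8" using M by auto
  define q where "q = (\<Prod>x\<leftarrow>[0, 0, 1, 1, p, p, p]. [:- x, 1:])"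
  have cp: "char_poly M = q * [:- r, 1:]"
    unfolding char_poly_eq q_def by (simp only: list.map prod_list.Cons prod_list.Nil mult_1_right mult.assoc)
  have q_r: "poly q r \<noteq> 0"
    unfolding q_def list.map prod_list.Cons prod_list.Nil poly_mult mult_eq_0_iff using p r by simp
  have "Polynomial.order r (char_poly M) = Polynomial.order r q + Polynomial.order r [:- r, 1:]"
  proof -
    have "q \<noteq> 0" using q_r by auto
    then show ?thesis
      unfolding cp by (intro order_mult) (simp only: mult_eq_0_iff, simp)
  qed
  also have "Polynomial.order r q = 0" using q_r by (rule order_0I)
  also have "Polynomial.order r [:- r, 1:] = 1"
    using order_power_n_n[of r 1] by simp
  finally have ord: "Polynomial.order r (char_poly M) = 1" by simp
  have "cmod z < r" if "eigenvalue (map_mat complex_of_real M) z" "z \<noteq> complex_of_real r" for z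
  proof -
    have "poly (char_poly (map_mat complex_of_real M)) z = 0"
      using that(1) eigenvalue_root_char_poly[of "map_mat complex_of_real M" 8 z] M by auto
    then have "poly (map_poly complex_of_real (char_poly M)) z = 0"
      by (simp add: of_real_hom.char_poly_hom[OF M])
    moreover interpret map_poly_comm_ring_hom complex_of_real ..
    have "map_poly complex_of_real (char_poly M) =
      (\<Prod>x\<leftarrow>[0, 0, 1, 1, complex_of_real p, complex_of_real p, complex_of_real p, complex_of_real r]. [:- x, 1:])"
      unfolding char_poly_eq list.map prod_list.Cons prod_list.Nil hom_mult by simp
    ultimately have "z \<in> {0, 1, complex_of_real p, complex_of_real r}"
      by (simp only: list.map prod_list.Cons prod_list.Nil poly_mult mult_eq_0_iff) auto
    then show ?thesis using that(2) p r by auto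
  qed
  moreover have "\<forall>i<8. 0 < vec_index (vec_of_list [1, 1, 1, 1, 1, 1, 1, 1 :: real]) i"
    unfolding all_less_8 vec_of_list_index by simp
  ultimately show ?thesis
    unfolding perron_frobenius_eigenvalue_def dims
    using assms p r ord eigenvector_r dims by auto
qed

subsection \<open>The color of a crease\<close>

text \<open>The three coordinates \<open>inner x (xi i)\<close>, measured in units of \<open>(-2) ^ n\<close>, determine the triangle of
  the grid \<open>(-2) ^ n L\<close> containing \<open>x\<close>; the sum of the rounded coordinates is \<open>0\<close> if that
  triangle has the orientation of the central one, and \<open>1\<close> otherwise.\<close>

definition coord :: "nat \<Rightarrow> complex \<Rightarrow> nat \<Rightarrow> real" where
  "coord n x i = (inner x (xi i) / (-2) ^ n - 1) / 3"

definition on_grid :: "nat \<Rightarrow> complex \<Rightarrow> bool" where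
  "on_grid n x \<longleftrightarrow> (\<exists>i\<in>{1, 2, 3}. coord n x i \<in> \<int>)"

definition central :: "nat \<Rightarrow> complex \<Rightarrow> bool" where
  "central n x \<longleftrightarrow> \<lceil>coord n x 1\<rceil> + \<lceil>coord n x 2\<rceil> + \<lceil>coord n x 3\<rceil> = 0"

lemma sum_coord: "coord n x 1 + coord n x 2 + coord n x 3 = -1"
proof -
  have "inner x (xi 1) + inner x (xi 2) + inner x (xi 3) = 0"
    by (metis inner_add_right inner_zero_right xi_sum)
  then have "inner x (xi 1) / (-2) ^ n + inner x (xi 2) / (-2) ^ n + inner x (xi 3) / (-2) ^ n = 0"
    by (metis add_divide_distrib div_0)
  moreover have "(a - 1) / 3 + (b - 1) / 3 + (c - 1) / 3 = -1" if "a + b + c = 0" for a b c :: real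
    using that by (simp add: field_simps)
  ultimately show ?thesis unfolding coord_def by blast
qed

text \<open>Off the grid each ceiling exceeds its coordinate by an amount strictly between 0 and 1,
  and the coordinates add up to -1. So the integer in question lies strictly between -1 and
  2.\<close>

lemma ceiling_sum_coord:
  assumes "\<not> on_grid n x"
  shows "\<lceil>coord n x 1\<rceil> + \<lceil>coord n x 2\<rceil> + \<lceil>coord n x 3\<rceil> \<in> {0, 1}"
proof -
  have "coord n x i < \<lceil>coord n x i\<rceil>" if "i \<in> {1, 2, 3}" for i
    using assms that by (metis Ints_of_int le_of_int_ceiling less_eq_real_def on_grid_def)
  moreover have "\<lceil>coord n x i\<rceil> < coord n x i + 1" for i
    using ceiling_correct[of "coord n x i"] by linarith
  ultimately have "coord n x 1 < \<lceil>coord n x 1\<rceil>" "coord n x 2 < \<lceil>coord n x 2\<rceil>" "coord n x 3 < \<lceil>coord n x 3\<rceil>"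
    "\<lceil>coord n x 1\<rceil> < coord n x 1 + 1" "\<lceil>coord n x 2\<rceil> < coord n x 2 + 1" "\<lceil>coord n x 3\<rceil> < coord n x 3 + 1"
    by auto
  with sum_coord[of n x] show ?thesis by simp linarith
qed

lemma inner_xi:
  "inner (xi 1) (xi 1) = 12" "inner (xi 2) (xi 2) = 12" "inner (xi 3) (xi 3) = 12"
  "inner (xi 1) (xi 2) = -6" "inner (xi 2) (xi 1) = -6" "inner (xi 1) (xi 3) = -6"
  "inner (xi 3) (xi 1) = -6" "inner (xi 2) (xi 3) = -6" "inner (xi 3) (xi 2) = -6"
  unfolding xi_1 xi_2 xi_3 inner_complex_def by (simp_all add: algebra_simps)

text \<open>Consequently a fold line \<open>inner x (xi i) = (-2) ^ m\<close> is a line of every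
  grid \<open>(-2) ^ n L\<close> with n \<le> m, and the reflection in it is a symmetry of these
  grids.\<close>

lemma power_minus_2_mod_3: "\<exists>t :: int. (-2) ^ d = 3 * of_int t + (1 :: real)"
proof (induction d)
  case 0
  then show ?case by (intro exI[of _ 0]) simp
next
  case (Suc d)
  then obtain t :: int where "(-2) ^ d = 3 * of_int t + (1 :: real)" by blast
  then show ?case by (intro exI[of _ "- 2 * t - 1"]) simp
qed

lemma other_two:
  assumes "i \<in> {1,2,3 :: nat}"
  obtains j k where "j \<in> {1, 2, 3}" "k \<in> {1, 2, 3}" "i \<noteq> j" "i \<noteq> k" "j \<noteq> k" "{1, 2, 3} = {i, j, k}"
proof -
  have sets: "{1, 2, 3} = {2,1,3 :: nat}" "{1, 2, 3} = {3,1,2 :: nat}" by auto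
  have "i = 1 \<or> i = 2 \<or> i = 3" using assms by auto
  then show ?thesis
    using that[of 2 3] that[of 1 3, unfolded sets(1)] that[of 1 2, unfolded sets(2)] by (elim disjE) simp_all
qed

text \<open>\<open>t\<close> is the number of the fold line among the parallel lines of level
  \<open>n\<close>. The reflection interchanges the other two directions; the constant - t - 1 comes
  from the sum -1 of the coordinates.\<close>

lemma coord_reflect:
  assumes "n \<le> m" "i \<in> {1, 2, 3}" "j \<in> {1, 2, 3}" "k \<in> {1, 2, 3}" "i \<noteq> j" "i \<noteq> k" "j \<noteq> k"
  obtains t :: int where
    "coord n (reflect ((-2) ^ m) i x) i = of_int (2 * t) - coord n x i"
    "coord n (reflect ((-2) ^ m) i x) j = of_int (- t - 1) - coord n x k"
    "coord n (reflect ((-2) ^ m) i x) k = of_int (- t - 1) - coord n x j"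
proof -
  obtain t :: int where t: "(-2) ^ (m - n) = 3 * of_int t + (1 :: real)"
    using power_minus_2_mod_3 by blast
  define u :: real where "u = (-2) ^ n"
  have u: "u \<noteq> 0" by (simp add: u_def)
  have c: "(-2) ^ m = (3 * of_int t + 1) * u"
    unfolding u_def t[symmetric] using assms(1) by (simp flip: power_add)
  define y where "y = reflect ((-2) ^ m) i x"
  have sum: "inner x (xi i) + inner x (xi j) + inner x (xi k) = 0"
  proof -
    have "inner x (xi 1) + inner x (xi 2) + inner x (xi 3) = 0"
      by (metis inner_add_right inner_zero_right xi_sum)
    then show ?thesis using assms(2-) by auto
  qed
  have xx: "inner (xi i) (xi i) = 12" "inner (xi i) (xi j) = -6" "inner (xi i) (xi k) = -6"
    using assms(2-) inner_xi by auto
  have y: "inner y (xi l) = inner x (xi l) - (inner x (xi i) - (3 * of_int t + 1) * u) / 6 * inner (xi i) (xi l)" for l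
    unfolding y_def reflect_def c xx by (simp add: inner_diff_left)
  have "inner y (xi i) = 2 * (3 * of_int t + 1) * u - inner x (xi i)"
    unfolding y xx by (simp add: field_simps)
  moreover have "inner y (xi j) = - inner x (xi k) - (3 * of_int t + 1) * u"
    "inner y (xi k) = - inner x (xi j) - (3 * of_int t + 1) * u"
    unfolding y xx using sum by (simp_all add: algebra_simps)
  ultimately have "coord n y i = of_int (2 * t) - coord n x i" "coord n y j = of_int (- t - 1) - coord n x k"
    "coord n y k = of_int (- t - 1) - coord n x j"
    unfolding coord_def u_def[symmetric] using u by (simp_all add: field_simps)
  then show ?thesis using that unfolding y_def by blast
qed

lemma Ints_of_int_minus_iff: "of_int t - x \<in> \<int> \<longleftrightarrow> (x :: real) \<in> \<int>"
  by (metis Ints_diff Ints_of_int add_diff_cancel_left' diff_add_cancel)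

lemma ceiling_of_int_minus:
  assumes "(x :: real) \<notin> \<int>"
  shows "\<lceil>of_int t - x\<rceil> = t + 1 - \<lceil>x\<rceil>"
proof -
  have "\<lceil>of_int t - x\<rceil> = t - \<lfloor>x\<rfloor>"
    by (metis ceiling_minus floor_diff_of_int minus_diff_eq)
  moreover have "\<lceil>x\<rceil> = \<lfloor>x\<rfloor> + 1"
    using assms by (simp add: ceiling_altdef) (metis Ints_of_int)
  ultimately show ?thesis by simp
qed

lemma reflect_grid:
  fixes x :: complex
  assumes "n \<le> m" "i \<in> {1, 2, 3}"
  defines "y \<equiv> reflect ((-2) ^ m) i x"
  shows "on_grid n y \<longleftrightarrow> on_grid n x"
    and "\<not> on_grid n x \<Longrightarrow> central n y \<longleftrightarrow> \<not> central n x"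
proof -
  obtain j k where jk: "j \<in> {1, 2, 3}" "k \<in> {1, 2, 3}" "i \<noteq> j" "i \<noteq> k" "j \<noteq> k" and un: "{1, 2, 3} = {i, j, k}"
    using other_two[OF assms(2)] by blast
  obtain t where t: "coord n y i = of_int (2 * t) - coord n x i"
    "coord n y j = of_int (- t - 1) - coord n x k" "coord n y k = of_int (- t - 1) - coord n x j"
    using coord_reflect[OF assms(1,2) jk, of x] unfolding y_def by blast
  show "on_grid n y \<longleftrightarrow> on_grid n x"
    unfolding on_grid_def un using t by (simp only: ball_simps bex_simps Ints_of_int_minus_iff) blast
  have sum: "f 1 + f 2 + f 3 = f i + f j + f k" for f :: "nat \<Rightarrow> int"
  proof -
    have "f 1 + f 2 + f 3 = sum f {1, 2, 3}" by simp
    also have "\<dots> = sum f {i, j, k}" unfolding un ..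
    also have "\<dots> = f i + f j + f k" using jk by simp
    finally show ?thesis .
  qed
  assume ng: "\<not> on_grid n x"
  then have ni: "coord n x i \<notin> \<int>" "coord n x j \<notin> \<int>" "coord n x k \<notin> \<int>"
    unfolding on_grid_def un by auto
  have "\<lceil>coord n y i\<rceil> + \<lceil>coord n y j\<rceil> + \<lceil>coord n y k\<rceil> =
      1 - (\<lceil>coord n x i\<rceil> + \<lceil>coord n x j\<rceil> + \<lceil>coord n x k\<rceil>)"
    unfolding t ceiling_of_int_minus[OF ni(1)] ceiling_of_int_minus[OF ni(2)] ceiling_of_int_minus[OF ni(3)]
    by simp
  moreover have "\<lceil>coord n x i\<rceil> + \<lceil>coord n x j\<rceil> + \<lceil>coord n x k\<rceil> \<in> {0, 1}"
    using ceiling_sum_coord[OF ng] unfolding sum[of "\<lambda>i. \<lceil>coord n x i\<rceil>"] .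
  ultimately show "central n y \<longleftrightarrow> \<not> central n x"
    unfolding central_def sum[of "\<lambda>i. \<lceil>coord n x i\<rceil>"] sum[of "\<lambda>i. \<lceil>coord n y i\<rceil>"] by auto
qed

definition inside :: "nat \<Rightarrow> complex \<Rightarrow> bool" where
  "inside m x \<longleftrightarrow> (\<forall>i\<in>{1, 2, 3}. inner x (xi i) / (-2) ^ m < 1)"

lemma inside_coord: "inside m x \<longleftrightarrow> (\<forall>i\<in>{1, 2, 3}. coord m x i < 0)"
  unfolding inside_def coord_def by auto

lemma inside_imp:
  assumes "inside m x"
  shows "\<not> on_grid m x" "central m x"
proof -
  have neg: "coord m x 1 < 0" "coord m x 2 < 0" "coord m x 3 < 0"
    using assms unfolding inside_coord by auto
  then have gt: "coord m x 1 > -1" "coord m x 2 > -1" "coord m x 3 > -1"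
    using sum_coord[of m x] by linarith+
  have no: "y \<notin> \<int> \<and> \<lceil>y\<rceil> = 0" if "y < 0" "y > -1" for y :: real
  proof -
    have "\<lceil>y\<rceil> = 0" using that by linarith
    moreover have "y \<notin> \<int>"
    proof
      assume "y \<in> \<int>"
      then obtain l :: int where "y = of_int l" by (rule Ints_cases)
      then show False using that by simp
    qed
    ultimately show ?thesis by simp
  qed
  show "\<not> on_grid m x" "central m x"
    unfolding on_grid_def central_def using no neg gt by auto
qed

lemma coord_Suc: "coord n x i = - 2 * coord (Suc n) x i - 1"
  unfolding coord_def by (simp add: field_simps)

lemma on_grid_Suc: "on_grid (Suc n) x \<Longrightarrow> on_grid n x"
proof -
  have "coord n x i \<in> \<int>" if "coord (Suc n) x i \<in> \<int>" for i
    unfolding coord_Suc[of n] using that by (auto intro!: Ints_diff Ints_mult)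
  then show "on_grid (Suc n) x \<Longrightarrow> on_grid n x"
    unfolding on_grid_def by blast
qed

lemma on_grid_mono: "n \<le> m \<Longrightarrow> on_grid m x \<Longrightarrow> on_grid n x"
  by (induction m rule: dec_induct) (use on_grid_Suc in auto)

lemma fold_point_cases:
  assumes "inside (Suc m) x" and "\<not> on_fold_line ((-2) ^ m) x"
  obtains (flat) "\<not> turned_over ((-2) ^ m) x" "fold_point ((-2) ^ m) x = x" "inside m x"
  | (turned) i where "turned_over ((-2) ^ m) x" "i \<in> {1, 2, 3}"
      "fold_point ((-2) ^ m) x = reflect ((-2) ^ m) i x" "inside m (reflect ((-2) ^ m) i x)"
proof (cases "turned_over ((-2) ^ m) x")
  case False
  have "inner x (xi i) / (-2) ^ m < 1" if "i \<in> {1, 2, 3}" for i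
  proof -
    have "\<not> inner x (xi i) / (-2) ^ m > 1"
      using False that unfolding turned_over_def in_corner_def by blast
    moreover have "inner x (xi i) / (-2) ^ m \<noteq> 1"
      using assms(2) that unfolding on_fold_line_def by (auto simp: field_simps)
    ultimately show ?thesis by linarith
  qed
  then show ?thesis using False flat by (simp add: fold_point_def inside_def)
next
  case True
  define i where "i = (SOME i. i \<in> {1, 2, 3} \<and> in_corner ((-2) ^ m) i x)"
  have i: "i \<in> {1, 2, 3}" "in_corner ((-2) ^ m) i x"
    using True someI_ex[of "\<lambda>i. i \<in> {1, 2, 3} \<and> in_corner ((-2) ^ m) i x"]
    unfolding turned_over_def i_def by blast+
  obtain j k where jk: "j \<in> {1, 2, 3}" "k \<in> {1, 2, 3}" "i \<noteq> j" "i \<noteq> k" "j \<noteq> k" and un: "{1, 2, 3} = {i, j, k}"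
    using other_two[OF i(1)] by blast
  have lt: "coord (Suc m) x l < 0" if "l \<in> {1, 2, 3}" for l
    using assms(1) that unfolding inside_coord by blast
  have gt: "coord m x l > -1" if "l \<in> {1, 2, 3}" for l
    using lt[OF that] unfolding coord_Suc[of m] by simp
  have ci: "coord m x i > 0"
    using i(2) unfolding in_corner_def coord_def by simp
  define y where "y = reflect ((-2) ^ m) i x"
  obtain t :: int where t: "coord m y i = of_int (2 * t) - coord m x i"
    "coord m y j = of_int (- t - 1) - coord m x k" "coord m y k = of_int (- t - 1) - coord m x j"
    using coord_reflect[OF order_refl i(1) jk, of m x] unfolding y_def by blast
  have "coord m y i = - coord m x i"
    using inner_xi i(1) unfolding y_def reflect_def coord_def
    by (auto simp: inner_diff_left field_simps)
  then have "t = 0" using t(1) by simp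
  then have "inside m y"
    unfolding inside_coord un using t ci gt[OF jk(1)] gt[OF jk(2)] by auto
  then show ?thesis
    using turned[of i] True i(1) unfolding y_def by (simp add: fold_point_def i_def)
qed

text \<open>Off the fold lines the folded point lies in the open central triangle, which meets no
  line of level \<open>m\<close>; as the folding preserves the grid, neither did the original point
  lie on one.\<close>

lemma on_fold_line_iff:
  assumes "inside (Suc m) x"
  shows "on_fold_line ((-2) ^ m) x \<longleftrightarrow> on_grid m x"
proof
  assume "on_fold_line ((-2) ^ m) x"
  then obtain i where i: "i \<in> {1, 2, 3}" "inner x (xi i) = (-2) ^ m"
    unfolding on_fold_line_def by blast
  then have "coord m x i = 0" unfolding coord_def by simp
  then show "on_grid m x" unfolding on_grid_def using i(1) by (metis Ints_0)
next
  assume g: "on_grid m x"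
  show "on_fold_line ((-2) ^ m) x"
  proof (rule ccontr)
    assume "\<not> on_fold_line ((-2) ^ m) x"
    with assms show False
    proof (cases rule: fold_point_cases)
      case flat
      then show False using inside_imp(1) g by blast
    next
      case (turned i)
      then show False using inside_imp(1) g reflect_grid(1)[of m m i x] by blast
    qed
  qed
qed

lemma crease_color_eq:
  assumes "inside m x" "on_grid n x" "\<not> on_grid (Suc n) x"
  shows "crease_color a m up x = (if (a (Suc n) = Up) = (up = central (Suc n) x) then Red else Blue)"
  using assms
proof (induction m arbitrary: x up)
  case 0
  then show ?case using inside_imp(1) on_grid_mono by blast
next
  case (Suc m)
  show ?case
  proof (cases "on_fold_line ((-2) ^ m) x")
    case True
    then have "on_grid m x" using on_fold_line_iff[OF Suc.prems(1)] by blast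
    moreover have "\<not> on_grid (Suc m) x" "central (Suc m) x" using inside_imp[OF Suc.prems(1)] by blast+
    ultimately have "n = m"
      using Suc.prems(2,3) on_grid_mono[of "Suc n" m x] on_grid_mono[of "Suc m" n x] by (meson Suc_leI linorder_neqE_nat)
    then show ?thesis
      using True \<open>central (Suc m) x\<close> by simp
  next
    case False
    then have "\<not> on_grid m x" using on_fold_line_iff[OF Suc.prems(1)] by blast
    then have "n < m" using Suc.prems(2) on_grid_mono by (meson leI)
    have step: "crease_color a (Suc m) up x =
        crease_color a m (up \<noteq> turned_over ((-2) ^ m) x) (fold_point ((-2) ^ m) x)"
      using False by (simp add: Let_def)
    from Suc.prems(1) False show ?thesis
    proof (cases rule: fold_point_cases)
      case flat
      then show ?thesis
        unfolding step using Suc.IH[OF _ Suc.prems(2,3)] by simp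
    next
      case (turned i)
      \<comment> \<open>The reflection toggles both the side facing up and
        \<open>central (Suc n)\<close>, so the comparison of the two that decides the color is
        invariant.\<close>
      define y where "y = reflect ((-2) ^ m) i x"
      have "on_grid n y" "\<not> on_grid (Suc n) y" "central (Suc n) y \<longleftrightarrow> \<not> central (Suc n) x"
        using reflect_grid[of n m i x] reflect_grid[of "Suc n" m i x] turned(2) \<open>n < m\<close> Suc.prems(2,3)
        unfolding y_def by auto
      then show ?thesis
        unfolding step using Suc.IH[of y] turned unfolding y_def by auto
    qed
  qed
qed

subsection \<open>Folding patterns and substitutions\<close>

text \<open>Passing to the next coarser grid acts on the cells by \<open>coarsen\<close>, so two points whose cells agree
  at some level have the same cells at all coarser levels.\<close>

definition cell :: "nat \<Rightarrow> complex \<Rightarrow> nat \<Rightarrow> bool \<times> int" where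
  "cell n x i = (coord n x i \<in> \<int>, \<lceil>coord n x i\<rceil>)"

text \<open>The map sending c to - (c + 1) / 2, from \<open>coord_Suc\<close>, as seen through
  integrality and ceiling; the correction term arises exactly when c is an odd integer.\<close>

fun coarsen :: "bool \<times> int \<Rightarrow> bool \<times> int" where
  "coarsen (f, k) = (f \<and> odd k, - (k div 2) - of_bool (f \<and> odd k))"

text \<open>The offset -1 makes \<open>r = 0\<close> describe the indices of the lines of
  \<open>4 L\<close>.\<close>

lemma int_cases_mod_4:
  obtains m r where "i = 4 * m + r - 1" "r \<in> {0, 1, 2, 3 :: int}"
proof
  show "i = 4 * ((i + 1) div 4) + (i + 1) mod 4 - 1" by simp
  have "0 \<le> (i + 1) mod 4" "(i + 1) mod 4 < 4" by simp_all
  then show "(i + 1) mod 4 \<in> {0, 1, 2, 3}" by auto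
qed

text \<open>Two steps send c to (c - 1) / 4; for c in (k - 1, k] the ceiling of this is
  \<open>(k + 2) div 4\<close>.\<close>

lemma coarsen_coarsen: "coarsen (coarsen (f, k)) = (f \<and> k mod 4 = 1, (k + 2) div 4)"
proof -
  obtain m r where "k = 4 * m + r - 1" "r \<in> {0, 1, 2, 3 :: int}" by (rule int_cases_mod_4)
  then consider "k = 2 * (2 * m - 1) + 1" | "k = 2 * (2 * m)" | "k = 2 * (2 * m) + 1" | "k = 2 * (2 * m + 1)"
    by fastforce
  then show ?thesis
  proof cases
    case 1
    have "k div 2 = 2 * m - 1" "odd k" "k mod 4 = 3" "(k + 2) div 4 = m" unfolding 1 by presburger+
    then show ?thesis by (cases f; simp; presburger)
  next
    case 2
    have "k div 2 = 2 * m" "even k" "k mod 4 = 0" "(k + 2) div 4 = m" unfolding 2 by presburger+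
    then show ?thesis by (cases f) simp_all
  next
    case 3
    have "k div 2 = 2 * m" "odd k" "k mod 4 = 1" "(k + 2) div 4 = m" unfolding 3 by presburger+
    then show ?thesis by (cases f; simp; presburger)
  next
    case 4
    have "k div 2 = 2 * m + 1" "even k" "k mod 4 = 2" "(k + 2) div 4 = m + 1" unfolding 4 by presburger+
    then show ?thesis by (cases f; simp; presburger)
  qed
qed

lemma quarter:
  assumes "i = 4 * m + r - 1" "r \<in> {0, 1, 2, 3 :: int}"
  shows "(- i + 2) div 4 = - m" "even ((i - 1) div 2 + 1) \<longleftrightarrow> r < 2" "((i - 1) div 2 + 1) div 2 = m"
    "(- i) mod 4 = 1 \<longleftrightarrow> r = 0" "even (i - 1) \<longleftrightarrow> even r"
  using assms(2) unfolding assms(1) by (elim insertE emptyE; simp; presburger)+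

lemma two_quarters:
  assumes "i = 4 * m + r - 1" "j = 4 * n + t - 1" "r \<in> {0, 1, 2, 3 :: int}" "t \<in> {0, 1, 2, 3 :: int}"
  shows "(i + j + 2) div 4 = m + n + (r + t) div 4" "(i + j) mod 4 = 1 \<longleftrightarrow> r + t = 3"
proof -
  have *: "i + j = (r + t - 2) + 4 * (m + n)" "i + j + 2 = (r + t) + 4 * (m + n)" using assms by simp_all
  show "(i + j + 2) div 4 = m + n + (r + t) div 4" unfolding * by simp
  have "(i + j) mod 4 = (r + t - 2) mod 4" unfolding * by (rule mod_mult_self2)
  then show "(i + j) mod 4 = 1 \<longleftrightarrow> r + t = 3" using assms(3,4) by auto
qed

lemma Ints_ceiling_iff: "(x :: real) \<in> \<int> \<longleftrightarrow> of_int \<lceil>x\<rceil> = x"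
  by (metis Ints_cases Ints_of_int ceiling_of_int)

lemma cell_Suc: "cell (Suc n) x i = coarsen (cell n x i)"
proof -
  define c where "c = coord n x i"
  define k where "k = \<lceil>c\<rceil>"
  have c': "coord (Suc n) x i = - (c + 1) / 2"
    using coord_Suc[of n x i] by (simp add: c_def)
  have k: "of_int k - 1 < c" "c \<le> of_int k" by (simp_all add: k_def) linarith
  have int: "c \<in> \<int> \<longleftrightarrow> of_int k = c" by (simp add: k_def Ints_ceiling_iff)
  obtain q where q: "k = 2 * q \<or> k = 2 * q + 1" by (metis evenE oddE)
  have ceil: "\<lceil>- (c + 1) / 2\<rceil> = - (k div 2) - of_bool (c \<in> \<int> \<and> odd k)"
    unfolding int using q k by (elim disjE) (auto simp: ceiling_eq_iff)
  have "- (c + 1) / 2 \<in> \<int> \<longleftrightarrow> c \<in> \<int> \<and> odd k"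
    unfolding Ints_ceiling_iff[of "- (c + 1) / 2"] ceil int using q k by (elim disjE) (auto simp: field_simps)
  with ceil show ?thesis
    by (simp add: cell_def c' c_def[symmetric] k_def[symmetric])
qed

lemma on_grid_cell: "on_grid n x \<longleftrightarrow> fst (cell n x 1) \<or> fst (cell n x 2) \<or> fst (cell n x 3)"
  by (auto simp: on_grid_def cell_def)

lemma central_cell: "central n x \<longleftrightarrow> snd (cell n x 1) + snd (cell n x 2) + snd (cell n x 3) = 0"
  by (simp add: central_def cell_def)

lemma cell_add:
  assumes "cell m x i = cell n y i"
  shows "cell (l + m) x i = cell (l + n) y i"
  using assms by (induction l) (simp_all add: cell_Suc del: coarsen.simps)

section \<open>Midpoints of unit edges and the infinite pattern\<close>

definition base :: complex where
  "base = - (1 / 6) *\<^sub>R xi 2"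

definition mid :: "dir \<Rightarrow> int \<Rightarrow> int \<Rightarrow> complex" where
  "mid d i j = (\<Sum>x\<in>edge base True d i j. x) / 2"

lemma inner_pt:
  "inner (pt base True i j) (xi 1) = 1 - 3 * j"
  "inner (pt base True i j) (xi 2) = 3 * (i + j) - 2"
  "inner (pt base True i j) (xi 3) = 1 - 3 * i"
  unfolding inner_complex_def Re_pt Im_pt base_def xi_1 xi_2 xi_3
  by (simp_all add: algebra_simps)

lemma edge_pair:
  obtains u v where "edge z g d i j = {u, v}" "u \<noteq> v"
proof (cases d)
  case Hor
  then show ?thesis using that[of "pt z g i j" "pt z g (i + 1) j"] by (simp add: pt_eq_iff)
next
  case Wst
  then show ?thesis using that[of "pt z g i j" "pt z g i (j + 1)"] by (simp add: pt_eq_iff)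
next
  case Dia
  then show ?thesis using that[of "pt z g (i + 1) j" "pt z g i (j + 1)"] by (simp add: pt_eq_iff)
qed

text \<open>A midpoint lies on the grid line through its edge and halfway between consecutive lines
  in the two other directions.\<close>

lemma cell_mid:
  "cell 0 (mid d i j) 1 = (d = Hor, - j)"
  "cell 0 (mid d i j) 2 = (d = Dia, i + j)"
  "cell 0 (mid d i j) 3 = (d = Wst, - i)"
proof -
  have cellI: "cell 0 x l = (b, k)" if "coord 0 x l = (if b then of_int k else of_int k - 1 / 2)" for x l b k
  proof -
    have "\<lceil>of_int k - 1 / 2 :: real\<rceil> = k" by linarith
    moreover from this have "(of_int k - 1 / 2 :: real) \<notin> \<int>" unfolding Ints_ceiling_iff by simp
    ultimately show ?thesis unfolding cell_def that by simp
  qed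
  have half: "inner ((u + v) / 2) w = (inner u w + inner v w) / 2" for u v w :: complex
    by (simp add: inner_complex_def field_simps)
  have mids: "mid Hor i j = (pt base True i j + pt base True (i + 1) j) / 2"
    "mid Wst i j = (pt base True i j + pt base True i (j + 1)) / 2"
    "mid Dia i j = (pt base True (i + 1) j + pt base True i (j + 1)) / 2"
    by (simp_all add: mid_def pt_eq_iff)
  have Hor: "coord 0 (mid Hor i j) 1 = of_int (- j)" "coord 0 (mid Hor i j) 2 = of_int (i + j) - 1 / 2"
    "coord 0 (mid Hor i j) 3 = of_int (- i) - 1 / 2"
    unfolding coord_def mids half inner_pt by (simp_all add: field_simps)
  have Wst: "coord 0 (mid Wst i j) 1 = of_int (- j) - 1 / 2" "coord 0 (mid Wst i j) 2 = of_int (i + j) - 1 / 2"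
    "coord 0 (mid Wst i j) 3 = of_int (- i)"
    unfolding coord_def mids half inner_pt by (simp_all add: field_simps)
  have Dia: "coord 0 (mid Dia i j) 1 = of_int (- j) - 1 / 2" "coord 0 (mid Dia i j) 2 = of_int (i + j)"
    "coord 0 (mid Dia i j) 3 = of_int (- i) - 1 / 2"
    unfolding coord_def mids half inner_pt by (simp_all add: field_simps)
  show "cell 0 (mid d i j) 1 = (d = Hor, - j)" "cell 0 (mid d i j) 2 = (d = Dia, i + j)"
    "cell 0 (mid d i j) 3 = (d = Wst, - i)"
    by (rule cellI, cases d, (simp only: Hor Wst Dia dir.distinct if_True if_False simp_thms)+)+
qed

text \<open>The 4 is an upper bound of \<open>norm (xi i)\<close>, whose square is 12.\<close>

lemma ball_subset_scaled_T0: "ball 0 (2 ^ m / 4) \<subseteq> scaled_T0 ((-2) ^ m)"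
proof
  fix y :: complex assume "y \<in> ball 0 (2 ^ m / 4)"
  then have y: "norm y < 2 ^ m / 4" by simp
  have "inner y (xi i) / (-2) ^ m \<le> 1" if "i \<in> {1, 2, 3}" for i
  proof -
    have "(norm (xi i))\<^sup>2 = 12" using inner_xi that by (auto simp: power2_norm_eq_inner)
    then have "norm (xi i) \<le> 4" using power2_le_imp_le[of "norm (xi i)" 4] by simp
    then have "norm y * norm (xi i) \<le> 2 ^ m / 4 * 4"
      using y mult_mono[of "norm y" "2 ^ m / 4" "norm (xi i)" 4] by simp
    moreover have "\<bar>inner y (xi i)\<bar> \<le> norm y * norm (xi i)"
      by (rule Cauchy_Schwarz_ineq2)
    ultimately have "\<bar>inner y (xi i) / (-2) ^ m\<bar> \<le> 1"
      by (simp add: abs_divide power_abs)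
    then show ?thesis by linarith
  qed
  then show "y \<in> scaled_T0 ((-2) ^ m)"
    by (subst scaled_T0_eq) auto
qed

lemma interior_edge_exists: "\<exists>m. interior_edge m {u, v}"
proof -
  have "bounded (convex hull {u, v})"
    by (simp add: bounded_convex_hull)
  then obtain B where B: "\<And>y. y \<in> convex hull {u, v} \<Longrightarrow> norm y \<le> B"
    by (meson bounded_iff)
  obtain m :: nat where "4 * B < 2 ^ m" using real_arch_pow[of 2] by auto
  then have "convex hull {u, v} \<subseteq> ball 0 (2 ^ m / 4)" using B by fastforce
  also have "\<dots> \<subseteq> interior (scaled_T0 ((-2) ^ m))"
    by (rule interior_maximal[OF ball_subset_scaled_T0]) simp
  finally show ?thesis
    unfolding interior_edge_def using rel_interior_subset by blast
qed

definition pat :: "(nat \<Rightarrow> folding) \<Rightarrow> dir \<Rightarrow> int \<Rightarrow> int \<Rightarrow> color" where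
  "pat a = col base True (folding_pattern a)"

lemma inside_exists: "\<exists>m. inside m (mid d i j) \<and> pat a d i j = crease_color a m True (mid d i j)"
proof -
  obtain u v where uv: "edge base True d i j = {u, v}" "u \<noteq> v" by (rule edge_pair)
  obtain m where m: "interior_edge m {u, v}" using interior_edge_exists by blast
  have "inside m (mid d i j)"
    unfolding inside_def mid_def uv(1) using interior_edge_midpoint[OF m _ uv(2)] by blast
  moreover have "edge base True d i j \<in> unit_edges {pt base True i j | i j. True}"
    unfolding unit_edges_pt by blast
  then have "pat a d i j = crease_color a m True (mid d i j)"
    using m folding_pattern_eq[of m "edge base True d i j"]
    by (simp add: pat_def col_def uv(1) finite_pattern_def mid_def)
  ultimately show ?thesis by blast
qed

lemma pat_eq:
  assumes "on_grid n (mid d i j)" "\<not> on_grid (Suc n) (mid d i j)"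
  shows "pat a d i j = (if (a (Suc n) = Up) = central (Suc n) (mid d i j) then Red else Blue)"
  using inside_exists[of d i j a] crease_color_eq[OF _ assms] by auto

lemma level_exists: "\<exists>n. on_grid n (mid d i j) \<and> \<not> on_grid (Suc n) (mid d i j)"
proof -
  obtain m where "inside m (mid d i j)" using inside_exists by blast
  then have "\<not> on_grid m (mid d i j)" by (rule inside_imp)
  moreover have "on_grid 0 (mid d i j)"
    unfolding on_grid_cell cell_mid by (cases d) auto
  moreover have "on_grid m (mid d i j)" if "\<forall>n. on_grid n (mid d i j) \<longrightarrow> on_grid (Suc n) (mid d i j)"
    using \<open>on_grid 0 (mid d i j)\<close> that by (induction m) auto
  ultimately show ?thesis by blast
qed

text \<open>The vertices of the grids \<open>(-2) L\<close> and \<open>4 L\<close> have indices congruent to \<open>1\<close> modulo \<open>2\<close> and to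
  \<open>-1\<close> modulo \<open>4\<close>; this is where the shifts come from.\<close>

lemma folding_pattern_step:
  "pat a d i j = sub (a 1) True (\<lambda>d i j. sub (a 2) True (pat (\<lambda>i. a (i + 2))) d (i + 1) (j + 1)) d (i - 1) (j - 1)"
proof -
  define x where "x = mid d i j"
  \<comment> \<open>The position in the grid of level one after both shifts; halving it once more
    gives the position in the grid of level two.\<close>
  define I J where "I = (i - 1) div 2 + 1" "J = (j - 1) div 2 + 1"
  obtain m r where i: "i = 4 * m + r - 1" "r \<in> {0, 1, 2, 3}" by (rule int_cases_mod_4)
  obtain n t where j: "j = 4 * n + t - 1" "t \<in> {0, 1, 2, 3}" by (rule int_cases_mod_4)
  have even2: "even I \<longleftrightarrow> r < 2" "even J \<longleftrightarrow> t < 2"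
    unfolding I_J_def by (rule quarter(2)[OF i] quarter(2)[OF j])+
  have sum_odd: "odd (i - 1 + (j - 1)) \<longleftrightarrow> even r \<noteq> even t" "odd (I + J) \<longleftrightarrow> (r < 2) \<noteq> (t < 2)"
    unfolding even_add quarter(5)[OF i] quarter(5)[OF j] even2 by blast+
  have on1: "on_coarse d (i - 1) (j - 1) \<longleftrightarrow> (case d of Hor \<Rightarrow> even t | Wst \<Rightarrow> even r | Dia \<Rightarrow> even r \<noteq> even t)"
    by (cases d) (simp_all only: on_coarse.simps dir.case quarter(5)[OF i] quarter(5)[OF j] sum_odd)
  have on2: "on_coarse d I J \<longleftrightarrow> (case d of Hor \<Rightarrow> t < 2 | Wst \<Rightarrow> r < 2 | Dia \<Rightarrow> (r < 2) \<noteq> (t < 2))"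
    by (cases d) (simp_all only: on_coarse.simps dir.case sum_odd even2)
  have side2: "side_of_coarse d I J \<longleftrightarrow> (case d of Hor \<Rightarrow> r < 2 | Wst \<Rightarrow> t < 2 | Dia \<Rightarrow> r < 2)"
    by (cases d) (simp_all only: side_of_coarse.simps dir.case even2)
  have half2: "I div 2 = m" "J div 2 = n"
    unfolding I_J_def by (rule quarter(3)[OF i] quarter(3)[OF j])+
  have grid0: "on_grid 0 x" unfolding x_def on_grid_cell cell_mid by (cases d) auto
  have cells1: "cell (Suc 0) x 1 = coarsen (d = Hor, - j)" "cell (Suc 0) x 2 = coarsen (d = Dia, i + j)"
    "cell (Suc 0) x 3 = coarsen (d = Wst, - i)"
    unfolding x_def cell_Suc cell_mid by simp_all
  have grid1: "on_grid (Suc 0) x \<longleftrightarrow> on_coarse d (i - 1) (j - 1)"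
    unfolding on_grid_cell cells1 by (cases d) auto
  show ?thesis
  proof (cases "on_coarse d (i - 1) (j - 1)")
    case False
    \<comment> \<open>The central triangle \<open>-2 T0\<close> of level one is negative, hence the
      negation.\<close>
    have "central (Suc 0) x \<longleftrightarrow> \<not> side_of_coarse d (i - 1) (j - 1)"
      unfolding central_cell cells1 using False by (cases d; simp; presburger)
    then show ?thesis
      using pat_eq[of 0 d i j a] grid0 grid1 False unfolding x_def
      by (cases "a 1") (auto simp: sub_eq)
  next
    case True
    have cells2: "cell (Suc (Suc 0)) x 1 = (d = Hor \<and> t = 0, - n)"
      "cell (Suc (Suc 0)) x 2 = (d = Dia \<and> r + t = 3, m + n + (r + t) div 4)"
      "cell (Suc (Suc 0)) x 3 = (d = Wst \<and> r = 0, - m)"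
      unfolding cell_Suc[of "Suc 0"] cells1 coarsen_coarsen quarter(1,4)[OF i] quarter(1,4)[OF j]
        two_quarters[OF i(1) j(1) i(2) j(2)] by (rule refl)+
    have grid2: "on_grid (Suc (Suc 0)) x \<longleftrightarrow> on_coarse d I J"
      unfolding on_grid_cell cells2 on2 using True[unfolded on1] i(2) j(2)
      by (cases d; elim insertE emptyE; simp)
    have rhs: "sub (a 1) True (\<lambda>d i j. sub (a 2) True (pat (\<lambda>i. a (i + 2))) d (i + 1) (j + 1)) d (i - 1) (j - 1) =
        opposite (sub (a 2) True (pat (\<lambda>i. a (i + 2))) d I J)"
      using True by (simp add: sub_eq I_J_def)
    show ?thesis
    proof (cases "on_coarse d I J")
      case False
      \<comment> \<open>The central triangle \<open>4 T0\<close> is positive again. This change of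
        sign relative to level one is matched by the \<open>opposite\<close> of the outer
        substitution.\<close>
      have "central (Suc (Suc 0)) x \<longleftrightarrow> side_of_coarse d I J"
        unfolding central_cell cells2 side2 using True[unfolded on1] False[unfolded on2] i(2) j(2)
        by (cases d; elim insertE emptyE; simp)
      then show ?thesis
        unfolding rhs using pat_eq[of "Suc 0" d i j a] grid1 grid2 True False unfolding x_def
        by (cases "a 2") (auto simp: sub_eq numeral_2_eq_2)
    next
      case on2': True
      define y where "y = mid d (I div 2) (J div 2)"
      have "(d = Hor \<longrightarrow> t = 0) \<and> (d = Dia \<longrightarrow> r + t = 3) \<and> (d = Wst \<longrightarrow> r = 0) \<and> (r + t) div 4 = 0"
        using True[unfolded on1] on2'[unfolded on2] i(2) j(2)
        by (cases d; elim insertE emptyE; simp)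
      \<comment> \<open>\<open>x\<close> and \<open>y\<close> are different points in general, but
        the cells of \<open>x\<close> at level two are those of \<open>y\<close> at level zero.
        Hence all higher levels agree up to a shift by 2, and the two \<open>opposite\<close>s
        cancel.\<close>
      then have "cell (Suc (Suc 0)) x 1 = cell 0 y 1" "cell (Suc (Suc 0)) x 2 = cell 0 y 2"
        "cell (Suc (Suc 0)) x 3 = cell 0 y 3"
        unfolding cells2 y_def cell_mid half2 by auto
      then have cells: "cell (n + 2) x 1 = cell n y 1" "cell (n + 2) x 2 = cell n y 2" "cell (n + 2) x 3 = cell n y 3" for n
        using cell_add[of "Suc (Suc 0)" x _ 0 y n] by simp_all
      obtain n where n: "on_grid n y" "\<not> on_grid (Suc n) y"
        using level_exists unfolding y_def by blast
      have "on_grid (n + 2) x" "\<not> on_grid (Suc (n + 2)) x" "central (Suc (n + 2)) x = central (Suc n) y"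
        using n cells[of n] cells[of "Suc n"] unfolding on_grid_cell central_cell by simp_all
      then have "pat a d i j = pat (\<lambda>i. a (i + 2)) d (I div 2) (J div 2)"
        using pat_eq[of "n + 2" d i j a] pat_eq[of n d "I div 2" "J div 2" "\<lambda>i. a (i + 2)"] n
        unfolding x_def y_def by simp
      moreover have "opposite (opposite c) = c" for c by (cases c) auto
      ultimately show ?thesis
        unfolding rhs using on2' by (simp add: sub_eq)
    qed
  qed
qed

subsection \<open>Densities\<close>

fun shift :: "int \<Rightarrow> index \<Rightarrow> index" where
  "shift s (b, i, j) = (b, i + s, j + s)"

lemma shift_shift: "shift s (shift t T) = shift (s + t) T" "shift 0 T = T"
  by (cases T; simp)+

lemma bij_shift: "bij (shift s)"
  by (rule o_bij[of "shift (- s)"]) (auto simp: fun_eq_iff shift_shift simp del: shift.simps)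

lemma sum_shift_vimage: "(\<Sum>t\<in>shift s -` A. f (shift s t)) = sum f A"
proof -
  have "bij_betw (shift s) (shift s -` A) A"
    using bij_shift[of s] by (auto simp: bij_betw_def inj_on_def bij_def surj_image_vimage_eq)
  then show ?thesis by (rule sum.reindex_bij_betw)
qed

text \<open>The coarsening of triangles that matches \<open>folding_pattern_step\<close>, with the
  same two index shifts.\<close>

definition grandparent :: "index \<Rightarrow> index" where
  "grandparent = parent \<circ> shift 1 \<circ> parent \<circ> shift (-1)"

lemma grandparent_vimage: "grandparent -` A = shift (-1) -` (parent -` (shift 1 -` (parent -` A)))"
  by (auto simp: grandparent_def)

lemma finite_shift_vimage: "finite A \<Longrightarrow> finite (shift s -` A)"
  using bij_shift[of s] by (intro finite_vimageI) (auto simp: bij_def)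

lemma finite_grandparent_vimage: "finite A \<Longrightarrow> finite (grandparent -` A)"
  unfolding grandparent_vimage by (intro finite_shift_vimage finite_parent_vimage)

lemma finite_ancestor_vimage: "finite A \<Longrightarrow> finite ((grandparent ^^ m) -` A)"
proof (induction m arbitrary: A)
  case (Suc m)
  have "(grandparent ^^ Suc m) -` A = (grandparent ^^ m) -` (grandparent -` A)" by auto
  then show ?case using Suc finite_grandparent_vimage by metis
qed simp

lemma moment_shift: "moment g (\<lambda>d i j. \<psi> d (i + s) (j + s)) T r = moment g \<psi> (shift s T) r"
  by (cases T) (simp add: algebra_simps)

lemma moment_pat_grandparent:
  assumes "finite A"
  shows "(\<Sum>t\<in>grandparent -` A. moment True (pat a) t r) =
    advance (fold_sign (a 1)) (advance (fold_sign (a 2)) (\<lambda>r. \<Sum>T\<in>A. moment True (pat (\<lambda>i. a (i + 2))) T r)) r"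
proof -
  define \<psi>2 where "\<psi>2 = sub (a 2) True (pat (\<lambda>i. a (i + 2)))"
  define \<psi>1 where "\<psi>1 = sub (a 1) True (\<lambda>d i j. \<psi>2 d (i + 1) (j + 1))"
  have pat: "pat a = (\<lambda>d i j. \<psi>1 d (i + (-1)) (j + (-1)))"
    unfolding \<psi>1_def \<psi>2_def using folding_pattern_step[of a] by (simp add: fun_eq_iff)
  have inner: "(\<lambda>r. \<Sum>t\<in>shift 1 -` (parent -` A). moment True (\<lambda>d i j. \<psi>2 d (i + 1) (j + 1)) t r) =
      advance (fold_sign (a 2)) (\<lambda>r. \<Sum>T\<in>A. moment True (pat (\<lambda>i. a (i + 2))) T r)"
  proof
    fix r
    have "(\<Sum>t\<in>shift 1 -` (parent -` A). moment True (\<lambda>d i j. \<psi>2 d (i + 1) (j + 1)) t r) =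
        (\<Sum>t\<in>shift 1 -` (parent -` A). moment True \<psi>2 (shift 1 t) r)"
      by (simp only: moment_shift)
    also have "\<dots> = (\<Sum>t\<in>parent -` A. moment True \<psi>2 t r)"
      by (rule sum_shift_vimage)
    finally show "(\<Sum>t\<in>shift 1 -` (parent -` A). moment True (\<lambda>d i j. \<psi>2 d (i + 1) (j + 1)) t r) =
        advance (fold_sign (a 2)) (\<lambda>r. \<Sum>T\<in>A. moment True (pat (\<lambda>i. a (i + 2))) T r) r"
      unfolding \<psi>2_def moment_parent_vimage[OF assms] .
  qed
  have "(\<Sum>t\<in>grandparent -` A. moment True (pat a) t r) =
      (\<Sum>t\<in>shift (-1) -` (parent -` (shift 1 -` (parent -` A))). moment True \<psi>1 (shift (-1) t) r)"
    unfolding grandparent_vimage pat by (simp only: moment_shift)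
  also have "\<dots> = (\<Sum>t\<in>parent -` (shift 1 -` (parent -` A)). moment True \<psi>1 t r)"
    by (rule sum_shift_vimage)
  also have "\<dots> = advance (fold_sign (a 1))
      (\<lambda>r. \<Sum>t\<in>shift 1 -` (parent -` A). moment True (\<lambda>d i j. \<psi>2 d (i + 1) (j + 1)) t r) r"
    unfolding \<psi>1_def by (intro moment_parent_vimage finite_shift_vimage finite_parent_vimage assms)
  finally show ?thesis unfolding inner .
qed

text \<open>In the infinite pattern, the descendants of any finite set of supertriangles thus have
  the moments prescribed by the substitutions, with the pattern of the shifted sequence as initial
  coloring.\<close>

lemma moment_pat_ancestor:
  assumes "finite A"
  shows "(\<lambda>r. \<Sum>t\<in>(grandparent ^^ m) -` A. moment True (pat a) t r) =
    advances a (2 * m) (\<lambda>r. \<Sum>T\<in>A. moment True (pat (\<lambda>i. a (i + 2 * m))) T r)"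
proof (induction m arbitrary: a)
  case 0
  then show ?case by simp
next
  case (Suc m)
  have v: "(grandparent ^^ Suc m) -` A = grandparent -` ((grandparent ^^ m) -` A)"
    by (auto simp: funpow_swap1)
  have "(\<Sum>t\<in>grandparent -` ((grandparent ^^ m) -` A). moment True (pat a) t r) =
      advance (fold_sign (a 1)) (advance (fold_sign (a 2))
        (\<lambda>r. \<Sum>T\<in>(grandparent ^^ m) -` A. moment True (pat (\<lambda>i. a (i + 2))) T r)) r" for r
    by (rule moment_pat_grandparent[OF finite_ancestor_vimage[OF assms]])
  then show ?case
    unfolding v Suc.IH by (simp add: fun_eq_iff numeral_2_eq_2)
qed

text \<open>The bounds 5, 4, 3, 1 define a weighted maximum norm in which \<open>advance\<close>
  expands the first seven moments by at most 3. The critical rows are 4 + 2 * 3 + 2 * 1 = 3 * 4 and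
  2 * 3 + 3 * 1 = 3 * 3. A rate below the 4 of the last moment is what matters.\<close>

lemma advances_bound:
  fixes a :: "nat \<Rightarrow> folding" and k :: nat
  assumes "\<bar>q 0\<bar> \<le> 5 * C" "\<bar>q 1\<bar> \<le> 5 * C" "\<bar>q 2\<bar> \<le> 4 * C" "\<bar>q 3\<bar> \<le> 4 * C" "\<bar>q 4\<bar> \<le> 3 * C" "\<bar>q 5\<bar> \<le> 3 * C" "\<bar>q 6\<bar> \<le> C"
  defines "Q \<equiv> advances a k q"
  shows "\<bar>Q 0\<bar> \<le> 5 * (3 ^ k * C) \<and> \<bar>Q 1\<bar> \<le> 5 * (3 ^ k * C) \<and> \<bar>Q 2\<bar> \<le> 4 * (3 ^ k * C) \<and> \<bar>Q 3\<bar> \<le> 4 * (3 ^ k * C) \<and>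
    \<bar>Q 4\<bar> \<le> 3 * (3 ^ k * C) \<and> \<bar>Q 5\<bar> \<le> 3 * (3 ^ k * C) \<and> \<bar>Q 6\<bar> \<le> 3 ^ k * C \<and> Q 7 = 4 ^ k * q 7"
  unfolding Q_def
proof (induction k arbitrary: a)
  case 0
  then show ?case using assms by simp
next
  case (Suc k)
  define Q where "Q = advances (\<lambda>i. a (Suc i)) k q"
  define D where "D = 3 ^ k * C"
  have IH: "\<bar>Q 0\<bar> \<le> 5 * D" "\<bar>Q 1\<bar> \<le> 5 * D" "\<bar>Q 2\<bar> \<le> 4 * D" "\<bar>Q 3\<bar> \<le> 4 * D"
    "\<bar>Q 4\<bar> \<le> 3 * D" "\<bar>Q 5\<bar> \<le> 3 * D" "\<bar>Q 6\<bar> \<le> D" "Q 7 = 4 ^ k * q 7"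
    using Suc[of "\<lambda>i. a (Suc i)"] unfolding Q_def D_def by simp_all
  have s: "fold_sign (a 1) = 1 \<or> fold_sign (a 1) = -1" by (cases "a 1") auto
  have D': "3 ^ Suc k * C = 3 * D" by (simp add: D_def)
  have adv: "advances a (Suc k) q = advance (fold_sign (a 1)) Q" by (simp add: Q_def)
  have "\<bar>advance (fold_sign (a 1)) Q 0\<bar> \<le> 5 * (3 * D)" "\<bar>advance (fold_sign (a 1)) Q (Suc 0)\<bar> \<le> 5 * (3 * D)"
    "\<bar>advance (fold_sign (a 1)) Q 2\<bar> \<le> 4 * (3 * D)" "\<bar>advance (fold_sign (a 1)) Q 3\<bar> \<le> 4 * (3 * D)"
    "\<bar>advance (fold_sign (a 1)) Q 4\<bar> \<le> 3 * (3 * D)" "\<bar>advance (fold_sign (a 1)) Q 5\<bar> \<le> 3 * (3 * D)"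
    "\<bar>advance (fold_sign (a 1)) Q 6\<bar> \<le> 3 * D"
    unfolding advance_simps using s IH by (elim disjE; simp add: abs_le_iff)+
  then show ?case
    unfolding adv D' using IH(8) by (simp add: advance_simps)
qed

lemma moment_bound:
  "\<bar>moment g \<psi> T 0\<bar> \<le> 5" "\<bar>moment g \<psi> T 1\<bar> \<le> 5" "\<bar>moment g \<psi> T 2\<bar> \<le> 4" "\<bar>moment g \<psi> T 3\<bar> \<le> 4"
  "\<bar>moment g \<psi> T 4\<bar> \<le> 3" "\<bar>moment g \<psi> T 5\<bar> \<le> 3" "\<bar>moment g \<psi> T 6\<bar> \<le> 1" "moment g \<psi> T 7 = 1"
proof -
  have "ttype g \<psi> T - 1 < 8" using ttype_range[of g \<psi> T] by auto
  then show "\<bar>moment g \<psi> T 0\<bar> \<le> 5" "\<bar>moment g \<psi> T 1\<bar> \<le> 5" "\<bar>moment g \<psi> T 2\<bar> \<le> 4" "\<bar>moment g \<psi> T 3\<bar> \<le> 4"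
    "\<bar>moment g \<psi> T 4\<bar> \<le> 3" "\<bar>moment g \<psi> T 5\<bar> \<le> 3" "\<bar>moment g \<psi> T 6\<bar> \<le> 1" "moment g \<psi> T 7 = 1"
    by (simp_all add: moment_eq_moment_mat)
      (cases "ttype g \<psi> T - 1" rule: less_8_cases; simp add: moment_mat_def)+
qed

lemma card_ancestor_ttype:
  fixes a :: "nat \<Rightarrow> folding" and m :: nat
  assumes "finite A" "i < 8"
  defines "D \<equiv> (grandparent ^^ m) -` A"
  shows "real (card D) = 4 ^ (2 * m) * card A"
    and "\<bar>real (card {t \<in> D. ttype True (pat a) t = Suc i}) - card D / 8\<bar> \<le> 3 * (3 / 4) ^ (2 * m) * card D"
proof -
  define q where "q r = (\<Sum>T\<in>A. moment True (pat (\<lambda>i. a (i + 2 * m))) T r)" for r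
  define C where "C = real (card A)"
  define Q where "Q = advances a (2 * m) q"
  have finD: "finite D" unfolding D_def by (rule finite_ancestor_vimage[OF assms(1)])
  have Q: "(\<Sum>t\<in>D. moment True (pat a) t r) = Q r" for r
    using moment_pat_ancestor[OF assms(1), of a m] unfolding D_def Q_def q_def by (rule fun_cong)
  have sb: "\<bar>q r\<bar> \<le> c * C" if "\<And>T. \<bar>moment True (pat (\<lambda>i. a (i + 2 * m))) T r\<bar> \<le> c" for r c
  proof -
    have "\<bar>q r\<bar> \<le> (\<Sum>T\<in>A. \<bar>moment True (pat (\<lambda>i. a (i + 2 * m))) T r\<bar>)"
      unfolding q_def by (rule sum_abs)
    also have "\<dots> \<le> (\<Sum>T\<in>A. c)" by (rule sum_mono) (rule that)
    finally show ?thesis by (simp add: C_def mult.commute)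
  qed
  have "\<bar>Q 0\<bar> \<le> 5 * (3 ^ (2 * m) * C) \<and> \<bar>Q 1\<bar> \<le> 5 * (3 ^ (2 * m) * C) \<and> \<bar>Q 2\<bar> \<le> 4 * (3 ^ (2 * m) * C) \<and>
    \<bar>Q 3\<bar> \<le> 4 * (3 ^ (2 * m) * C) \<and> \<bar>Q 4\<bar> \<le> 3 * (3 ^ (2 * m) * C) \<and> \<bar>Q 5\<bar> \<le> 3 * (3 ^ (2 * m) * C) \<and>
    \<bar>Q 6\<bar> \<le> 3 ^ (2 * m) * C \<and> Q 7 = 4 ^ (2 * m) * q 7"
    unfolding Q_def
    by (rule advances_bound) (rule sb moment_bound order_trans[OF sb[of _ 1]] | simp add: moment_bound[simplified])+
  moreover define E where "E = 3 ^ (2 * m) * C"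
  ultimately have b: "\<bar>Q 0\<bar> \<le> 5 * E" "\<bar>Q (Suc 0)\<bar> \<le> 5 * E" "\<bar>Q 2\<bar> \<le> 4 * E" "\<bar>Q 3\<bar> \<le> 4 * E"
    "\<bar>Q 4\<bar> \<le> 3 * E" "\<bar>Q 5\<bar> \<le> 3 * E" "\<bar>Q 6\<bar> \<le> E" "Q 7 = 4 ^ (2 * m) * q 7"
    by simp_all
  have q7: "q 7 = C" by (simp add: q_def moment_bound C_def)
  have cD: "real (card D) = Q 7"
    unfolding Q[symmetric] by (simp add: moment_bound)
  show card: "real (card D) = 4 ^ (2 * m) * card A"
    unfolding cD b q7 C_def by simp
  have E: "E = (3 / 4) ^ (2 * m) * card D"
    unfolding card E_def C_def by (simp add: power_divide)
  have "real (card {t \<in> D. ttype True (pat a) t = Suc i}) = (\<Sum>r<8. moment_inv $$ (i, r) * Q r)"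
    unfolding card_ttype_eq[OF assms(2) finD] Q ..
  \<comment> \<open>With the weights of the norm, each row of \<open>moment_inv\<close> contributes
    at most (3 * 5 + 4 + 3 + 1) / 8 = 23 / 8.\<close>
  moreover have "\<bar>(\<Sum>r<8. moment_inv $$ (i, r) * Q r) - Q 7 / 8\<bar> \<le> 3 * E"
    using assms(2) unfolding sum_lessThan_8 abs_le_iff
    by (intro conjI; cases i rule: less_8_cases; simp add: moment_inv_def;
        insert b(1-7)[unfolded abs_le_iff]; linarith)
  ultimately show "\<bar>real (card {t \<in> D. ttype True (pat a) t = Suc i}) - card D / 8\<bar> \<le> 3 * (3 / 4) ^ (2 * m) * card D"
    unfolding cD[symmetric] E by simp
qed

text \<open>Where two lines meet, a third passes as well: since the three inner products add up to
  zero, the last one is 3 (- m - n - 1) + 1.\<close>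

lemma grid_vertices_eq: "grid_vertices = {pt base True i j | i j. True}"
proof (intro equalityI subsetI)
  fix x assume "x \<in> grid_vertices"
  then obtain i j m n where ij: "i \<in> {1, 2, 3}" "j \<in> {1, 2, 3}" "i \<noteq> j"
    and x: "inner x (xi i) = 3 * real_of_int m + 1" "inner x (xi j) = 3 * real_of_int n + 1"
    unfolding grid_vertices_def grid_line_def by blast
  have sum: "inner x (xi 1) + inner x (xi 2) + inner x (xi 3) = 0"
    by (metis inner_add_right inner_zero_right xi_sum)
  have "\<exists>p. inner x (xi l) = 3 * real_of_int p + 1" if l: "l \<in> {1, 2, 3}" for l
  proof (cases "l = i \<or> l = j")
    case True
    then show ?thesis using x by blast
  next
    case False
    then have "{1, 2, 3} = {i, j, l}" using ij l by auto
    then have "(\<Sum>k\<in>{1, 2, 3}. inner x (xi k)) = (\<Sum>k\<in>{i, j, l}. inner x (xi k))" by simp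
    moreover have "(\<Sum>k\<in>{1, 2, 3}. inner x (xi k)) = 0" using sum by (simp add: add.assoc)
    moreover have "(\<Sum>k\<in>{i, j, l}. inner x (xi k)) = inner x (xi i) + inner x (xi j) + inner x (xi l)"
      using False ij(3) by simp
    ultimately have "inner x (xi l) = 3 * real_of_int (- m - n - 1) + 1" unfolding x by simp
    then show ?thesis by blast
  qed
  from this[of 1] this[of 3] obtain p q
    where pq: "inner x (xi 1) = 3 * real_of_int p + 1" "inner x (xi 3) = 3 * real_of_int q + 1"
    by auto
  let ?y = "pt base True (- q) (- p)"
  have "inner (x - ?y) (xi 1) = 0" "inner (x - ?y) (xi 3) = 0"
    unfolding inner_diff_left pq inner_pt by simp_all
  then have "x = ?y"
    unfolding xi_1 xi_3 inner_complex_def by (simp add: complex_eq_iff)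
  then show "x \<in> {pt base True i j | i j. True}" by blast
next
  fix x assume "x \<in> {pt base True i j | i j. True}"
  then obtain i j where x: "x = pt base True i j" by blast
  have "x \<in> grid_line 1 (- j)" "x \<in> grid_line 3 (- i)"
    unfolding x grid_line_def mem_Collect_eq inner_pt by simp_all
  moreover have "(1::nat) \<in> {1, 2, 3}" "(3::nat) \<in> {1, 2, 3}" "(1::nat) \<noteq> 3" by simp_all
  ultimately show "x \<in> grid_vertices"
    unfolding grid_vertices_def by blast
qed

section \<open>Counting unit triangles in discs\<close>

fun loc :: "index \<Rightarrow> complex" where
  "loc (b, i, j) = pt base True i j"

definition disc :: "real \<Rightarrow> index set" where
  "disc R = {T. convex hull (tri base True T) \<subseteq> cball 0 R}"

lemma disc_iff: "T \<in> disc R \<longleftrightarrow> (\<forall>v\<in>tri base True T. norm v \<le> R)"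
proof -
  have "convex hull (tri base True T) \<subseteq> cball 0 R \<longleftrightarrow> tri base True T \<subseteq> cball 0 R"
    by (metis convex_cball hull_minimal hull_subset subset_trans)
  then show ?thesis by (auto simp: disc_def simp del: tri.simps)
qed

lemma dist_pt_le: "dist (pt z g i j) (pt z g k l) \<le> \<bar>i - k\<bar> + \<bar>j - l\<bar>"
proof -
  have n: "norm omega = 1"
    by (simp add: omega_def complex_norm power_divide)
  have "pt z g i j - pt z g k l = (if g then 1 else -1) * (of_int (i - k) + of_int (j - l) * omega)"
    by (simp add: pt_def algebra_simps)
  then have "dist (pt z g i j) (pt z g k l) = norm (of_int (i - k) + of_int (j - l) * omega)"
    by (simp add: dist_norm norm_mult)
  also have "\<dots> \<le> norm (of_int (i - k) :: complex) + norm (of_int (j - l) * omega)"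
    by (rule norm_triangle_ineq)
  also have "\<dots> = \<bar>i - k\<bar> + \<bar>j - l\<bar>"
    by (simp only: norm_mult norm_of_int n) simp
  finally show ?thesis .
qed

lemma dist_loc_le:
  assumes "v \<in> tri base True T"
  shows "dist v (loc T) \<le> 2"
proof -
  obtain b i j where T: "T = (b, i, j)" by (metis surj_pair)
  \<comment> \<open>For the flag \<open>False\<close>, the point \<open>loc T\<close> is not a
    vertex of the triangle but the opposite corner of its rhombus, so all four corners are
    considered.\<close>
  have "v \<in> {pt base True i j, pt base True (i + 1) j, pt base True i (j + 1), pt base True (i + 1) (j + 1)}"
    using assms unfolding T by (auto split: if_splits)
  then show ?thesis
    unfolding T loc.simps
    using dist_pt_le[of base True "i + 1" j i j] dist_pt_le[of base True i "j + 1" i j]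
      dist_pt_le[of base True "i + 1" "j + 1" i j] by auto
qed

lemma disc_loc: "T \<in> disc R \<Longrightarrow> norm (loc T) \<le> R + 2" "T \<notin> disc R \<Longrightarrow> norm (loc T) > R - 2"
proof -
  obtain v where v: "v \<in> tri base True T"
    using card_tri[of base True T] by (metis card.empty ex_in_conv zero_neq_numeral)
  show "norm (loc T) \<le> R + 2" if "T \<in> disc R"
  proof -
    have "norm v \<le> R" using that v unfolding disc_iff by blast
    moreover have "dist v (loc T) \<le> 2" using v by (rule dist_loc_le)
    ultimately show ?thesis by norm
  qed
  show "norm (loc T) > R - 2" if nd: "T \<notin> disc R"
  proof -
    obtain u where u: "u \<in> tri base True T" "\<not> norm u \<le> R" using nd unfolding disc_iff by blast
    have "dist u (loc T) \<le> 2" using u(1) by (rule dist_loc_le)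
    with u(2) show ?thesis by norm
  qed
qed

text \<open>The bound reproduces itself: 4 (4^m - 1) + 3 = 4^(m+1) - 1. Hence triangles with a
  common ancestor lie within a distance depending on \<open>m\<close> alone.\<close>

lemma ancestor_near:
  assumes "(grandparent ^^ m) (b, i, j) = (b', i', j')"
  shows "\<bar>i - 4 ^ m * i'\<bar> \<le> 4 ^ m - 1 \<and> \<bar>j - 4 ^ m * j'\<bar> \<le> 4 ^ m - 1"
  using assms
proof (induction m arbitrary: b i j)
  case 0
  then show ?case by simp
next
  case (Suc m)
  obtain b1 i1 j1 where g: "grandparent (b, i, j) = (b1, i1, j1)" by (metis surj_pair)
  then have ij1: "i1 = ((i - 1) div 2 + 1) div 2" "j1 = ((j - 1) div 2 + 1) div 2"
    by (auto simp: grandparent_def)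
  have near: "\<bar>k - 4 * (((k - 1) div 2 + 1) div 2)\<bar> \<le> 3" for k :: int by presburger
  have IH: "\<bar>i1 - 4 ^ m * i'\<bar> \<le> 4 ^ m - 1" "\<bar>j1 - 4 ^ m * j'\<bar> \<le> 4 ^ m - 1"
    using Suc.IH[of b1 i1 j1] Suc.prems g by (simp_all add: funpow_swap1)
  have step: "\<bar>k - 4 ^ Suc m * l'\<bar> \<le> 4 ^ Suc m - 1"
    if "\<bar>k - 4 * l\<bar> \<le> 3" "\<bar>l - 4 ^ m * l'\<bar> \<le> 4 ^ m - 1" for k l l' :: int
  proof -
    define x where "x = 4 ^ m * l'"
    have "4 ^ Suc m * l' = 4 * x" "(4 :: int) ^ Suc m = 4 * 4 ^ m" by (simp_all add: x_def)
    then show ?thesis using that unfolding x_def[symmetric] by linarith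
  qed
  show ?case
    using step[OF near[of i] IH(1)[unfolded ij1]] step[OF near[of j] IH(2)[unfolded ij1]] by blast
qed

lemma same_ancestor_near:
  assumes "(grandparent ^^ m) t = (grandparent ^^ m) t'"
  shows "dist (loc t) (loc t') \<le> 4 * 4 ^ m"
proof -
  obtain b i j b' i' j' where t: "t = (b, i, j)" "t' = (b', i', j')" by (metis surj_pair)
  obtain B I J where T: "(grandparent ^^ m) t = (B, I, J)" by (metis surj_pair)
  have "\<bar>i - 4 ^ m * I\<bar> \<le> 4 ^ m - 1 \<and> \<bar>j - 4 ^ m * J\<bar> \<le> 4 ^ m - 1"
    "\<bar>i' - 4 ^ m * I\<bar> \<le> 4 ^ m - 1 \<and> \<bar>j' - 4 ^ m * J\<bar> \<le> 4 ^ m - 1"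
    using T assms unfolding t by (metis ancestor_near)+
  then have "\<bar>i - i'\<bar> + \<bar>j - j'\<bar> \<le> 4 * 4 ^ m" by linarith
  then have "real_of_int (\<bar>i - i'\<bar> + \<bar>j - j'\<bar>) \<le> real_of_int (4 * 4 ^ m)" by (simp only: of_int_le_iff)
  then show ?thesis
    using dist_pt_le[of base True i j i' j'] unfolding t by simp
qed

lemma finite_loc: "finite {T. norm (loc T) \<le> R}"
proof -
  define K where "K = \<lceil>4 * R + 4\<rceil>"
  have "{T. norm (loc T) \<le> R} \<subseteq> UNIV \<times> {- K..K} \<times> {- K..K}"
  proof
    fix T assume a: "T \<in> {T. norm (loc T) \<le> R}"
    obtain b i j where T: "T = (b, i, j)" by (metis surj_pair)
    have n: "norm (pt base True i j) \<le> R" using a unfolding T by simp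
    have "\<bar>inner (pt base True i j) (xi l)\<bar> \<le> 4 * R" if "l \<in> {1, 3}" for l
    proof -
      have "(norm (xi l))\<^sup>2 = 12" using inner_xi that by (auto simp: power2_norm_eq_inner)
      then have "norm (xi l) \<le> 4" using power2_le_imp_le[of "norm (xi l)" 4] by simp
      then have "norm (pt base True i j) * norm (xi l) \<le> R * 4"
        using n mult_mono[of "norm (pt base True i j)" R "norm (xi l)" 4]
          order_trans[OF norm_ge_zero n] by simp
      then show ?thesis
        using Cauchy_Schwarz_ineq2[of "pt base True i j" "xi l"] by linarith
    qed
    from this[of 1] this[of 3] have "\<bar>1 - 3 * real_of_int j\<bar> \<le> 4 * R" "\<bar>1 - 3 * real_of_int i\<bar> \<le> 4 * R"
      unfolding inner_pt by simp_all
    then have "\<bar>real_of_int i\<bar> \<le> 4 * R + 4" "\<bar>real_of_int j\<bar> \<le> 4 * R + 4" by linarith+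
    then have "\<bar>i\<bar> \<le> K" "\<bar>j\<bar> \<le> K" unfolding K_def by linarith+
    then show "T \<in> UNIV \<times> {- K..K} \<times> {- K..K}" unfolding T by auto
  qed
  then show ?thesis by (rule finite_subset) auto
qed

lemma finite_disc: "finite (disc R)"
  using disc_loc(1) by (intro finite_subset[OF _ finite_loc[of "R + 2"]]) auto

lemma area_ball: "r \<ge> 0 \<Longrightarrow> measure lborel (ball (c :: complex) r) = pi * r\<^sup>2"
  and area_cball: "r \<ge> 0 \<Longrightarrow> measure lborel (cball (c :: complex) r) = pi * r\<^sup>2"
  by (simp_all add: content_ball content_cball unit_ball_vol_2)

lemma fmeasurable_disc: "ball (c :: complex) r \<in> fmeasurable lborel" "cball (c :: complex) r \<in> fmeasurable lborel"
  using emeasure_lborel_ball_finite[of c r] emeasure_lborel_cball_finite[of c r]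
  by (auto intro!: fmeasurableI)

text \<open>Packing argument: the discs of radius 1/2 about the points are disjoint, have area pi /
  4 each, and lie in the annulus enlarged by 1 on both sides.\<close>

lemma card_annulus_le:
  fixes S :: "complex set" and p q :: real
  assumes "finite S" "\<And>u v. u \<in> S \<Longrightarrow> v \<in> S \<Longrightarrow> u \<noteq> v \<Longrightarrow> dist u v \<ge> 1"
    and "\<And>v. v \<in> S \<Longrightarrow> p \<le> norm v \<and> norm v \<le> q" and "1 \<le> p" "p \<le> q"
  shows "card S \<le> 4 * ((q + 1)\<^sup>2 - (p - 1)\<^sup>2)"
proof -
  have disj: "disjoint_family_on (\<lambda>v. ball v (1 / 2)) S"
    unfolding disjoint_family_on_def
  proof (intro ballI impI)
    fix u v assume "u \<in> S" "v \<in> S" "u \<noteq> v"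
    then have "dist u v \<ge> 1" by (rule assms(2))
    then show "ball u (1 / 2) \<inter> ball v (1 / 2) = {}"
      by (intro disjoint_ballI) simp
  qed
  have "card S * (pi / 4) = (\<Sum>v\<in>S. measure lborel (ball v (1 / 2)))"
    by (simp add: area_ball power_divide)
  also have "\<dots> = measure lborel (\<Union>v\<in>S. ball v (1 / 2))"
    by (rule measure_finite_Union[symmetric]) (use assms(1) disj fmeasurableD2[OF fmeasurable_disc(1)] in auto)
  also have "\<dots> \<le> measure lborel (cball (0 :: complex) (q + 1) - ball 0 (p - 1))"
  proof (rule measure_mono_fmeasurable)
    show "(\<Union>v\<in>S. ball v (1 / 2)) \<subseteq> cball 0 (q + 1) - ball 0 (p - 1)"
    proof
      fix x assume "x \<in> (\<Union>v\<in>S. ball v (1 / 2))"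
      then obtain v where v: "v \<in> S" "dist v x < 1 / 2" by auto
      then have "p \<le> norm v" "norm v \<le> q" using assms(3) by auto
      with v(2) have "norm x \<le> q + 1" "norm x \<ge> p - 1" by norm+
      then show "x \<in> cball 0 (q + 1) - ball 0 (p - 1)" by simp
    qed
  qed (use assms(1) fmeasurable_disc in \<open>auto intro!: fmeasurable.Diff\<close>)
  also have "\<dots> = measure lborel (cball (0 :: complex) (q + 1)) - measure lborel (ball (0 :: complex) (p - 1))"
  proof (rule measure_Diff)
    show "ball (0 :: complex) (p - 1) \<subseteq> cball 0 (q + 1)" using assms(5) by auto
  qed (use fmeasurableD2[OF fmeasurable_disc(2)] in auto)
  also have "\<dots> = pi * ((q + 1)\<^sup>2 - (p - 1)\<^sup>2)"
    using assms(4,5) by (simp add: area_ball area_cball right_diff_distrib)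
  finally have "pi * card S \<le> pi * (4 * ((q + 1)\<^sup>2 - (p - 1)\<^sup>2))" by simp
  then show ?thesis by (simp only: mult_le_cancel_left_pos[OF pi_gt_zero])
qed

text \<open>Covering argument: discs of radius 2, each of area 4 pi, about the points
  \<open>loc T\<close> cover a ball. The quadratic lower bound makes linear boundary terms
  negligible.\<close>

lemma card_disc_ge:
  assumes "R \<ge> 4"
  shows "(R - 4)\<^sup>2 \<le> 4 * card (disc R)"
proof -
  define S where "S = {T. norm (loc T) \<le> R - 2}"
  have fin: "finite S" unfolding S_def by (rule finite_loc)
  have sub: "S \<subseteq> disc R"
  proof
    fix T assume "T \<in> S"
    then have "norm v \<le> R" if "v \<in> tri base True T" for v
      using dist_loc_le[OF that] unfolding S_def mem_Collect_eq by norm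
    then show "T \<in> disc R" unfolding disc_iff by blast
  qed
  have cover: "ball 0 (R - 4) \<subseteq> (\<Union>T\<in>S. cball (loc T) 2)"
  proof
    fix x :: complex assume x: "x \<in> ball 0 (R - 4)"
    \<comment> \<open>\<open>s\<close> and \<open>t\<close> are the real coordinates of
      \<open>x\<close> in the basis 1, \<open>omega\<close>; rounding them down selects the rhombus
      containing \<open>x\<close>.\<close>
    define t where "t = (Im x - Im base) / (sqrt 3 / 2)"
    define s where "s = Re x - Re base - t / 2"
    define T where "T = (True, \<lfloor>s\<rfloor>, \<lfloor>t\<rfloor>)"
    have n: "norm omega = 1" by (simp add: omega_def complex_norm power_divide)
    have "x = base + of_real s + of_real t * omega"
      by (simp add: complex_eq_iff omega_def s_def t_def field_simps)
    then have "x - loc T = of_real (s - \<lfloor>s\<rfloor>) + of_real (t - \<lfloor>t\<rfloor>) * omega"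
      by (simp add: T_def pt_def algebra_simps)
    then have "norm (x - loc T) \<le> norm (complex_of_real (s - \<lfloor>s\<rfloor>)) + norm (of_real (t - \<lfloor>t\<rfloor>) * omega)"
      by (metis norm_triangle_ineq)
    also have "\<dots> = \<bar>s - \<lfloor>s\<rfloor>\<bar> + \<bar>t - \<lfloor>t\<rfloor>\<bar>"
      by (simp only: norm_mult norm_of_real n) simp
    also have "\<dots> \<le> 2" by linarith
    finally have d: "norm (x - loc T) \<le> 2" .
    with x have "norm (loc T) \<le> R - 2" unfolding mem_ball by norm
    then show "x \<in> (\<Union>T\<in>S. cball (loc T) 2)"
      using d by (intro UN_I[of T]) (auto simp: S_def dist_norm norm_minus_commute simp del: loc.simps)
  qed
  have "pi * (R - 4)\<^sup>2 = measure lborel (ball (0 :: complex) (R - 4))"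
    using assms by (simp add: area_ball)
  also have "\<dots> \<le> measure lborel (\<Union>T\<in>S. cball (loc T) 2)"
    by (rule measure_mono_fmeasurable[OF cover]) (use fin fmeasurable_disc in \<open>auto intro!: fmeasurable.finite_UN simp del: loc.simps\<close>)
  also have "\<dots> \<le> (\<Sum>T\<in>S. measure lborel (cball (loc T) 2))"
    by (rule measure_UNION_le) (use fin in auto)
  also have "\<dots> = pi * (4 * card S)" by (simp add: area_cball)
  finally have "(R - 4)\<^sup>2 \<le> 4 * card S"
    by (simp only: mult_le_cancel_left_pos[OF pi_gt_zero])
  also have "\<dots> \<le> 4 * card (disc R)"
    using card_mono[OF finite_disc sub] by simp
  finally show ?thesis .
qed

lemma loeschian_ge_1:
  fixes i j i' j' :: int
  assumes "(i', j') \<noteq> (i, j)"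
  shows "(i' - i)\<^sup>2 + (i' - i) * (j' - j) + (j' - j)\<^sup>2 \<ge> 1"
proof -
  define x y where "x = i' - i" "y = j' - j"
  have "x \<noteq> 0 \<or> y \<noteq> 0" using assms by (auto simp: x_y_def)
  then have "x\<^sup>2 + y\<^sup>2 > 0" by (simp add: sum_power2_gt_zero_iff)
  then have "x\<^sup>2 + y\<^sup>2 + (x + y)\<^sup>2 > 0" by (rule add_pos_nonneg) simp
  moreover have "x\<^sup>2 + y\<^sup>2 + (x + y)\<^sup>2 = 2 * (x\<^sup>2 + x * y + y\<^sup>2)" by (simp add: power2_eq_square algebra_simps)
  ultimately have "2 * (x\<^sup>2 + x * y + y\<^sup>2) > 0" by (simp only:)
  moreover have "s \<ge> 1" if "2 * s > 0" for s :: int using that by simp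
  ultimately show ?thesis unfolding x_y_def[symmetric] by blast
qed

lemma card_disc_ttype:
  assumes "i < 8"
  obtains K where "\<And>R. R \<ge> K \<Longrightarrow>
    \<bar>real (card {t \<in> disc R. ttype True (pat a) t = Suc i}) - card (disc R) / 8\<bar>
      \<le> 3 * (3 / 4) ^ (2 * m) * card (disc R) + K * R"
proof -
  define c :: real where "c = 4 * 4 ^ m"
  \<comment> \<open>The first entry is the final constant in the count of boundary triangles; the
    second keeps the inner radius R - 2 - c of the annulus at least 1.\<close>
  define K where "K = max (16 * (c + 6)) (c + 8)"
  have c: "c > 0" by (simp add: c_def)
  have "\<bar>real (card {t \<in> disc R. ttype True (pat a) t = Suc i}) - card (disc R) / 8\<bar>
      \<le> 3 * (3 / 4) ^ (2 * m) * card (disc R) + K * R" if "R \<ge> K" for R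
  proof -
    have R: "R \<ge> c + 8" using that by (simp add: K_def)
    \<comment> \<open>\<open>B\<close> collects the ancestors whose descendants all lie in the disc.
      A triangle left over in \<open>E\<close> shares its ancestor with one outside the disc, so it
      is close to the boundary circle.\<close>
    define B where "B = {T \<in> (grandparent ^^ m) ` disc R. (grandparent ^^ m) -` {T} \<subseteq> disc R}"
    define D where "D = (grandparent ^^ m) -` B"
    define E where "E = disc R - D"
    have finB: "finite B" unfolding B_def using finite_disc by auto
    have "D \<subseteq> disc R" unfolding D_def B_def by auto
    then have finD: "finite D" "finite E" and split: "disc R = D \<union> E" "D \<inter> E = {}"
      using finite_disc[of R] finite_subset unfolding E_def by auto
    have ann: "R - 2 - c \<le> norm (loc t) \<and> norm (loc t) \<le> R + 2" if tE: "t \<in> E" for t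
    proof -
      have t: "t \<in> disc R" "t \<notin> D" using tE unfolding E_def by auto
      then have "\<not> (grandparent ^^ m) -` {(grandparent ^^ m) t} \<subseteq> disc R"
        unfolding D_def B_def by auto
      then obtain t' where t': "(grandparent ^^ m) t = (grandparent ^^ m) t'" "t' \<notin> disc R"
        by (metis singletonD subsetI vimageD)
      have "norm (loc t') > R - 2" using t'(2) by (rule disc_loc)
      moreover have "dist (loc t) (loc t') \<le> c"
        unfolding c_def by (rule same_ancestor_near[OF t'(1)])
      moreover have "norm (loc t) \<le> R + 2" using t(1) by (rule disc_loc)
      ultimately show ?thesis by norm
    qed
    have "card (loc ` E) \<le> 4 * ((R + 2 + 1)\<^sup>2 - (R - 2 - c - 1)\<^sup>2)"
    proof (rule card_annulus_le)
      fix u v assume "u \<in> loc ` E" "v \<in> loc ` E" "u \<noteq> v"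
      then obtain b i j b' i' j' where uv: "u = loc (b, i, j)" "v = loc (b', i', j')"
        by (metis imageE surj_pair)
      then have "(i', j') \<noteq> (i, j)" using \<open>u \<noteq> v\<close> by auto
      then have "(i' - i)\<^sup>2 + (i' - i) * (j' - j) + (j' - j)\<^sup>2 \<ge> 1"
        by (rule loeschian_ge_1)
      then have "(dist u v)\<^sup>2 \<ge> 1"
        unfolding uv loc.simps dist_pt of_int_1_le_iff .
      then show "dist u v \<ge> 1"
        by (metis abs_le_square_iff abs_one power_one zero_le_dist abs_of_nonneg)
    qed (use ann finD R c in auto)
    \<comment> \<open>The two triangles of a rhombus have the same \<open>loc\<close>.\<close>
    moreover have "real (card E) \<le> 2 * real (card (loc ` E))"
    proof -
      have "E \<subseteq> (\<Union>v\<in>loc ` E. {t \<in> E. loc t = v})" by auto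
      then have "card E \<le> card (\<Union>v\<in>loc ` E. {t \<in> E. loc t = v})"
        using finD(2) by (intro card_mono) auto
      also have "\<dots> \<le> (\<Sum>v\<in>loc ` E. card {t \<in> E. loc t = v})"
        using finD(2) by (intro card_UN_le) auto
      also have "\<dots> \<le> (\<Sum>v\<in>loc ` E. 2)"
      proof (rule sum_mono)
        fix v assume "v \<in> loc ` E"
        then obtain b i j where v: "v = loc (b, i, j)" by (metis imageE surj_pair)
        have "{t \<in> E. loc t = v} \<subseteq> {(True, i, j), (False, i, j)}"
          unfolding v by (auto simp: pt_eq_iff)
        then have "card {t \<in> E. loc t = v} \<le> card {(True, i, j), (False, i, j)}"
          by (intro card_mono) auto
        then show "card {t \<in> E. loc t = v} \<le> 2" by simp
      qed
      finally have "card E \<le> 2 * card (loc ` E)" by simp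
      then show ?thesis by linarith
    qed
    moreover have "(R + 2 + 1)\<^sup>2 - (R - 2 - c - 1)\<^sup>2 = (c + 6) * (2 * R - c)"
      by (simp add: power2_eq_square algebra_simps)
    moreover have "8 * ((c + 6) * (2 * R - c)) \<le> K * R"
    proof -
      have "8 * ((c + 6) * (2 * R - c)) \<le> 8 * ((c + 6) * (2 * R))"
        using c by (intro mult_left_mono) auto
      also have "\<dots> = 16 * (c + 6) * R" by simp
      also have "\<dots> \<le> K * R" using R c by (intro mult_right_mono) (auto simp: K_def)
      finally show ?thesis .
    qed
    moreover have "e \<le> k" if "l \<le> 4 * x" "e \<le> 2 * l" "x = y" "8 * y \<le> k" for e l x y k :: real
      using that by linarith
    ultimately have cE: "card E \<le> K * R" by blast
    define n where "n X = real (card {t \<in> X. ttype True (pat a) t = Suc i})" for X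
    have "{t \<in> disc R. ttype True (pat a) t = Suc i} =
        {t \<in> D. ttype True (pat a) t = Suc i} \<union> {t \<in> E. ttype True (pat a) t = Suc i}"
      using split by auto
    moreover have "{t \<in> D. ttype True (pat a) t = Suc i} \<inter> {t \<in> E. ttype True (pat a) t = Suc i} = {}"
      using split(2) by blast
    ultimately have nsplit: "n (disc R) = n D + n E"
      unfolding n_def using finD by (simp add: card_Un_disjoint)
    have csplit: "real (card (disc R)) = card D + card E"
      unfolding split(1) using finD split(2) by (simp add: card_Un_disjoint)
    have nE: "0 \<le> n E" "n E \<le> card E"
      unfolding n_def using finD(2) by (auto intro!: card_mono)
    have "\<bar>n D - card D / 8\<bar> \<le> 3 * (3 / 4) ^ (2 * m) * card D"
      unfolding n_def D_def by (rule card_ancestor_ttype(2)[OF finB assms])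
    also have "\<dots> \<le> 3 * (3 / 4) ^ (2 * m) * card (disc R)"
      unfolding csplit by (intro mult_left_mono) auto
    finally show ?thesis
      unfolding n_def[symmetric] using nsplit csplit nE cE by linarith
  qed
  then show ?thesis by (rule that)
qed

lemma has_type_density_pat:
  assumes "i < 8"
  shows "has_type_density (folding_pattern a) (Suc i) (1 / 8)"
proof -
  define N where "N R = real (card (disc R))" for R
  define n where "n R = real (card {t \<in> disc R. ttype True (pat a) t = Suc i})" for R
  have tri: "unit_triangles grid_vertices = range (tri base True)"
    unfolding grid_vertices_eq unit_triangles_pt by simp
  have inj: "inj_on (tri base True) X" for X
    by (simp only: inj_on_def tri_inj) blast
  have sets: "{t \<in> unit_triangles grid_vertices. convex hull t \<subseteq> cball 0 R} = tri base True ` disc R"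
    "{t \<in> unit_triangles grid_vertices. convex hull t \<subseteq> cball 0 R \<and> triangle_type (folding_pattern a) t = Suc i} =
      tri base True ` {t \<in> disc R. ttype True (pat a) t = Suc i}" for R
    unfolding tri disc_def pat_def triangle_type_tri[symmetric] by blast+
  have "((\<lambda>R. n R / N R) \<longlongrightarrow> 1 / 8) at_top"
  proof (rule tendstoI)
    fix e :: real assume "e > 0"
    \<comment> \<open>The level is fixed before the radius, because the boundary constant
      \<open>K\<close> depends on it.\<close>
    obtain l :: nat where l: "(3 / 4) ^ l < e / 6"
      using real_arch_pow_inv[of "e / 6" "3 / 4"] \<open>e > 0\<close> by auto
    have "(3 / 4 :: real) ^ (2 * l) \<le> (3 / 4) ^ l" by (rule power_decreasing) auto
    with l have small: "3 * (3 / 4) ^ (2 * l) < e / 2" by linarith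
    obtain K where K: "\<And>R. R \<ge> K \<Longrightarrow> \<bar>n R - N R / 8\<bar> \<le> 3 * (3 / 4) ^ (2 * l) * N R + K * R"
      using card_disc_ttype[OF assms, of a l] unfolding n_def N_def by blast
    define K' where "K' = max K 0"
    have "dist (n R / N R) (1 / 8) < e" if "R \<ge> max (max K 8) (64 * K' / e)" for R
    proof -
      \<comment> \<open>The three bounds on \<open>R\<close> validate the count, make R - 4 at least
        R / 2, and absorb the boundary term into e / 4 times the number of triangles, which is at
        least R^2 / 16; this is where 64 = 4 * 16 comes from.\<close>
      have R: "R \<ge> K" "R \<ge> 8" "R \<ge> 64 * K' / e" using that by auto
      have "(R / 2)\<^sup>2 \<le> (R - 4)\<^sup>2" using R(2) by (intro power_mono) auto
      also have "\<dots> \<le> 4 * N R" unfolding N_def using card_disc_ge[of R] R(2) by simp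
      finally have N: "R\<^sup>2 / 16 \<le> N R" by (simp add: power_divide)
      have pos: "N R > 0" using N R(2) by (smt (verit) divide_pos_pos zero_less_power)
      have "K * R \<le> K' * R" using R(2) by (intro mult_right_mono) (auto simp: K'_def)
      also have "\<dots> \<le> (e * R / 64) * R"
        using R(2,3) \<open>e > 0\<close> by (intro mult_right_mono) (auto simp: field_simps)
      also have "\<dots> = e / 4 * (R\<^sup>2 / 16)" by (simp add: power2_eq_square)
      also have "\<dots> \<le> e / 4 * N R" using N \<open>e > 0\<close> by (intro mult_left_mono) auto
      finally have "\<bar>n R - N R / 8\<bar> \<le> 3 * (3 / 4) ^ (2 * l) * N R + e / 4 * N R"
        using K[OF R(1)] by linarith
      also have "\<dots> \<le> e / 2 * N R + e / 4 * N R"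
        using small pos by (intro add_right_mono mult_right_mono) auto
      also have "\<dots> < e * N R" using \<open>e > 0\<close> pos by simp
      finally have "\<bar>n R - N R / 8\<bar> / N R < e" using pos by (simp add: divide_less_eq)
      moreover have "n R / N R - 1 / 8 = (n R - N R / 8) / N R" using pos by (simp add: field_simps)
      ultimately show ?thesis using pos by (simp add: dist_real_def abs_divide)
    qed
    then show "\<forall>\<^sub>F R in at_top. dist (n R / N R) (1 / 8) < e"
      unfolding eventually_at_top_linorder by blast
  qed
  then show ?thesis
    unfolding has_type_density_def sets card_image[OF inj] n_def N_def .
qed

theorem theorem5p6:
  fixes a :: "nat \<Rightarrow> folding" and k :: nat and M :: "real mat"
  assumes "even k" and "k > 0"
    and "\<forall>i\<ge>1. a (i + k) = a i"
    and "M = substitution_matrix (subst_comp a k)"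
  shows "char_poly M = (\<Prod>r\<leftarrow>[4 ^ k, 2 ^ k, 2 ^ k, 2 ^ k, 1, 1, 0, 0]. [:- r, 1:])
    \<and> perron_frobenius_eigenvalue M (4 ^ k)
    \<and> eigenvector M (vec_of_list [1, 1, 1, 1, 1, 1, 1, 1]) (4 ^ k)
    \<and> (\<forall>i\<in>{1..8}. has_type_density (folding_pattern a) i (1 / 8))
    \<and> (a 1 = Up \<longrightarrow> eigenspace M 1 =
         vec_span 8 {vec_of_list [0, 1, -2, 1, 0, 0, 0, 0], vec_of_list [0, 0, 0, 0, 0, 1, -2, 1]})
    \<and> (a 1 = Down \<longrightarrow> eigenspace M 1 =
         vec_span 8 {vec_of_list [1, -2, 1, 0, 0, 0, 0, 0], vec_of_list [0, 0, 0, 0, 1, -2, 1, 0]})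
    \<and> eigenspace M 0 =
         vec_span 8 {vec_of_list [1, -3, 3, -1, 0, 0, 0, 0], vec_of_list [0, 0, 0, 0, 1, -3, 3, -1]}
    \<and> eigenspace_dim M (2 ^ k) \<in> {2, 3}"
proof -
  obtain \<alpha> \<beta> \<gamma> \<delta> c where MU: "moment_mat * M =
    moment_step (fold_sign (a 1)) \<alpha> \<beta> \<gamma> \<delta> c (2 ^ k) (2 ^ k) (4 ^ k) * moment_mat"
    unfolding assms(4) by (rule moment_mat_substitution_matrix[OF assms(1,2)])
  have "(2 :: real) ^ k > 1" using assms(2) by simp
  moreover have "(4 :: real) ^ k > 2 ^ k" using assms(2) by (intro power_strict_mono) auto
  moreover have "fold_sign (a 1) = 1 \<or> fold_sign (a 1) = -1" by (cases "a 1") auto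
  ultimately interpret moment_similar M "fold_sign (a 1)" \<alpha> \<beta> \<gamma> \<delta> c "2 ^ k" "4 ^ k"
    using MU by unfold_locales (simp_all add: assms(4) substitution_matrix_def)
  have "char_poly M = (\<Prod>r\<leftarrow>[4 ^ k, 2 ^ k, 2 ^ k, 2 ^ k, 1, 1, 0, 0]. [:- r, 1:])"
    unfolding char_poly_eq by (simp only: list.map prod_list.Cons prod_list.Nil mult_1_right mult_ac)
  moreover have "perron_frobenius_eigenvalue M (4 ^ k)"
    by (rule perron_frobenius_r) (simp add: assms(4) substitution_matrix_def)
  moreover have "has_type_density (folding_pattern a) i (1 / 8)" if "i \<in> {1..8}" for i
    using has_type_density_pat[of "i - 1" a] that by auto
  moreover have "eigenspace M 1 =
      vec_span 8 {vec_of_list [0, 1, -2, 1, 0, 0, 0, 0], vec_of_list [0, 0, 0, 0, 0, 1, -2, 1]}" if "a 1 = Up"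
    by (rule eigenspace_1) (simp_all add: that[unfolded One_nat_def])
  moreover have "eigenspace M 1 =
      vec_span 8 {vec_of_list [1, -2, 1, 0, 0, 0, 0, 0], vec_of_list [0, 0, 0, 0, 1, -2, 1, 0]}" if "a 1 = Down"
    by (rule eigenspace_1) (simp_all add: that[unfolded One_nat_def])
  ultimately show ?thesis
    using eigenvector_r eigenspace_0 eigenspace_dim_p by blast
qed

end
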